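(* Let $k$ be a positive integer, $L=\mathbb{Z}\alpha$ with $\langle\alpha,\alpha\rangle=2k$, and let $\mathcal U\cong(V_L\otimes V_L)^{\mathbb{Z}_2}$. For $0\le i,j\le 2k-1$ with $i>j$ (for the modules $(i\ j)$) and $\epsilon=0,1$, the quantum dimensions over $\mathcal U$ of the irreducible $\mathcal U$-modules $(i\ j)$, $\widetilde{(i\ \epsilon)}$, $\widehat{(i\ \epsilon)}$ are $$\mathrm{qdim}_{\mathcal U}(i\ j)=2,\qquad \mathrm{qdim}_{\mathcal U}\widetilde{(i\ \epsilon)}=1,\qquad \mathrm{qdim}_{\mathcal U}\widehat{(i\ \epsilon)}=\sqrt{2k}.$$
   Context: Quantum dimension. For a vertex operator algebra $V$ of central charge $c$ and a $V$-module $M=\bigoplus_{n\in\mathbb{Z}_{\ge0}}M_{\lambda+n}$ put $Z_M(\tau)=\mathrm{tr}_M q^{L(0)-c/24}=q^{\lambda-c/24}\sum_{n}(\dim M_{\lambda+n})q^n$ with $q=e^{2\pi i\tau}$, $\tau$ in the upper half plane. The quantum dimension of $M$ over $V$ is $\mathrm{qdim}_VM=\lim_{y\to0}\frac{Z_M(iy)}{Z_V(iy)}$ with $y$ real and positive. Lattice vertex operator algebras. For a rank one positive definite even lattice $\mathbb{Z}\gamma$ put $\mathfrak h=\mathbb{C}\otimes_{\mathbb Z}\mathbb{Z}\gamma$, let $M(1)$ be the rank one Heisenberg vertex operator algebra, $V_{\mathbb{Z}\gamma}=M(1)\otimes\mathbb{C}[\mathbb{Z}\gamma]$ the lattice vertex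 operator algebra, and, for $\lambda$ in the dual lattice, $V_{\mathbb{Z}\gamma+\lambda}=M(1)\otimes\mathbb{C}[\mathbb{Z}\gamma+\lambda]$ the corresponding irreducible $V_{\mathbb{Z}\gamma}$-module. Let $\theta$ be the linear map with $$\theta(\gamma(-n_1)\cdots\gamma(-n_r)\otimes e^{\mu})=(-1)^r\gamma(-n_1)\cdots\gamma(-n_r)\otimes e^{-\mu}$$ for $n_j>0$ and $\mu$ in the dual lattice; it restricts to an automorphism of $V_{\mathbb{Z}\gamma}$. For a $\theta$-stable subspace $U$, $U^{\pm}$ denotes the $\pm1$-eigenspace of $\theta$ on $U$. $V_{\mathbb{Z}\gamma}^{+}$ is a simple vertex operator algebra. Twisted modules. Let $M(1)(\theta)$ be the irreducible Fock module of the $\theta$-twisted Heisenberg algebra (generated from a vacuum vector by the operators $\gamma(-n)$, $n\in\frac12+\mathbb{Z}_{\ge0}$), and for $s=1,2$ let $T_s=\mathbb{C}$ be the one-dimensional module for $\mathbb{Z}\gamma/2\mathbb{Z}\gamma$ on which $\gamma$ acts as $(-1)^{s-1}$. Then $V_{\mathbb{Z}\gamma}^{T_s}=M(1)(\theta)\otimes T_s$ is an irreducible $\theta$-twisted $V_{\mathbb{Z}\gamma}$-module (Frenkel–Lepowsky–Meurman). $\theta$ acts on it by $\theta(\gamma(-n_1)\cdots\gamma(-n_r)\otimes t)=(-1)^r\gamma(-n_1)\cdots\gamma(-n_r)\otimes t$, and $(V_{\mathbb{Z}\gamma}^{T_s})^{\pm}$ denote the $\pm1$-eigenspaces; these are irreducible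 $V_{\mathbb{Z}\gamma}^+$-modules. The permutation orbifold. $\sigma(u\otimes v)=v\otimes u$ is an automorphism of order $2$ of $V_L\otimes V_L\cong V_{L\oplus L}$, and $(V_L\otimes V_L)^{\mathbb{Z}_2}$ is its fixed point subalgebra. Let $\alpha^1,\alpha^2$ be the copies of $\alpha$ in the two summands of $L\oplus L$, $\beta_1=\alpha^1+\alpha^2$, $\beta_2=\alpha^1-\alpha^2$ (orthogonal, of norm $4k$). Then $V_{L\oplus L}\cong V_{\mathbb{Z}\beta_1}\otimes V_{\mathbb{Z}\beta_2}\oplus V_{\frac12\beta_1+\mathbb{Z}\beta_1}\otimes V_{\frac12\beta_2+\mathbb{Z}\beta_2}$ with $\sigma$ acting as $1\otimes\theta$. Identifying $\mathbb{Z}\beta_1$ and $\mathbb{Z}\beta_2$ with $\mathbb{Z}\beta$, $\langle\beta,\beta\rangle=4k$, one gets $$(V_L\otimes V_L)^{\mathbb{Z}_2}\cong\mathcal U=V_{\mathbb{Z}\beta}\otimes V_{\mathbb{Z}\beta}^{+}\oplus V_{\frac12\beta+\mathbb{Z}\beta}\otimes V_{\frac12\beta+\mathbb{Z}\beta}^{+},$$ which contains $V_{\mathbb{Z}\beta}\otimes V_{\mathbb{Z}\beta}^{+}$ as a subalgebra. The modules. Each of the symbols below denotes an irreducible $\mathcal U$-module whose restriction to $V_{\mathbb{Z}\beta}\otimes V_{\mathbb{Z}\beta}^{+}$ is the indicated direct sum. (1) For $0\le j<i\le 2k-1$: $(i\ j)=V_{\mathbb{Z}\beta+\frac{i+j}{4k}\beta}\otimes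 V_{\mathbb{Z}\beta+\frac{i-j}{4k}\beta}+V_{\mathbb{Z}\beta+\frac{2k+i+j}{4k}\beta}\otimes V_{\mathbb{Z}\beta+\frac{2k-i+j}{4k}\beta}$. (2) For $0\le i\le 2k-1$: $\widetilde{(i\ 0)}=V_{\mathbb{Z}\beta+\frac{i}{2k}\beta}\otimes V_{\mathbb{Z}\beta}^{+}+V_{\mathbb{Z}\beta+\frac{i+k}{2k}\beta}\otimes V_{\mathbb{Z}\beta+\frac{\beta}{2}}^{+}$ and $\widetilde{(i\ 1)}=V_{\mathbb{Z}\beta+\frac{i}{2k}\beta}\otimes V_{\mathbb{Z}\beta}^{-}+V_{\mathbb{Z}\beta+\frac{i+k}{2k}\beta}\otimes V_{\mathbb{Z}\beta+\frac{\beta}{2}}^{-}$. (3) For $0\le i\le 2k-1$ with $k+i$ even: $\widehat{(i\ 0)}=V_{\mathbb{Z}\beta+\frac{i}{4k}\beta}\otimes(V_{\mathbb{Z}\beta}^{T_1})^{+}+V_{\mathbb{Z}\beta+\frac{2k+i}{4k}\beta}\otimes(V_{\mathbb{Z}\beta}^{T_1})^{+}$ and $\widehat{(i\ 1)}=V_{\mathbb{Z}\beta+\frac{i}{4k}\beta}\otimes(V_{\mathbb{Z}\beta}^{T_1})^{-}+V_{\mathbb{Z}\beta+\frac{2k+i}{4k}\beta}\otimes(V_{\mathbb{Z}\beta}^{T_1})^{-}$. For $0\le i\le 2k-1$ with $k+i$ odd: $\widehat{(i\ 0)}=V_{\mathbb{Z}\beta+\frac{i}{4k}\beta}\otimes(V_{\mathbb{Z}\beta}^{T_2})^{+}+V_{\mathbb{Z}\beta+\frac{2k+i}{4k}\beta}\otimes(V_{\mathbb{Z}\beta}^{T_2})^{-}$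 and $\widehat{(i\ 1)}=V_{\mathbb{Z}\beta+\frac{i}{4k}\beta}\otimes(V_{\mathbb{Z}\beta}^{T_2})^{-}+V_{\mathbb{Z}\beta+\frac{2k+i}{4k}\beta}\otimes(V_{\mathbb{Z}\beta}^{T_2})^{+}$. *)

theory Defs
  imports "HOL-Analysis.Analysis" "HOL-Library.Poly_Mapping" "HOL-Library.Multiset"
begin

section \<open>Complex vector spaces\<close>

class complex_vector = ab_group_add +
  fixes scaleC :: "complex \<Rightarrow> 'a \<Rightarrow> 'a"  (infixr "*\<^sub>C" 75)
  assumes scaleC_add_right: "a *\<^sub>C (x + y) = a *\<^sub>C x + a *\<^sub>C y"
    and scaleC_add_left: "(a + b) *\<^sub>C x = a *\<^sub>C x + b *\<^sub>C x"
    and scaleC_scaleC: "a *\<^sub>C (b *\<^sub>C x) = (a * b) *\<^sub>C x"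
    and scaleC_one: "1 *\<^sub>C x = x"

interpretation cvec: vector_space "scaleC :: complex \<Rightarrow> 'a \<Rightarrow> 'a :: complex_vector"
  by unfold_locales
    (simp_all add: scaleC_add_right scaleC_add_left scaleC_scaleC scaleC_one)

instantiation complex :: complex_vector
begin
definition scaleC_complex :: "complex \<Rightarrow> complex \<Rightarrow> complex" where
  "scaleC_complex a x = a * x"
instance by standard (simp_all add: scaleC_complex_def algebra_simps)
end

instantiation prod :: (complex_vector, complex_vector) complex_vector
begin
definition scaleC_prod :: "complex \<Rightarrow> 'a \<times> 'b \<Rightarrow> 'a \<times> 'b" where
  "scaleC_prod a p = (a *\<^sub>C fst p, a *\<^sub>C snd p)"
instance by standard (auto simp: scaleC_prod_def scaleC_add_right scaleC_add_left
    scaleC_scaleC scaleC_one)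
end

instantiation poly_mapping :: (type, complex_vector) complex_vector
begin
definition scaleC_poly_mapping ::
  "complex \<Rightarrow> ('a \<Rightarrow>\<^sub>0 'b) \<Rightarrow> ('a \<Rightarrow>\<^sub>0 'b)" where
  "scaleC_poly_mapping a p = Poly_Mapping.map (scaleC a) p"
instance
proof
  have l: "Poly_Mapping.lookup (a *\<^sub>C p) k = a *\<^sub>C Poly_Mapping.lookup p k" for a and p :: "'a \<Rightarrow>\<^sub>0 'b" and k
    by (simp add: scaleC_poly_mapping_def map.rep_eq when_def)
  fix a b :: complex and x y :: "'a \<Rightarrow>\<^sub>0 'b"
  show "a *\<^sub>C (x + y) = a *\<^sub>C x + a *\<^sub>C y"
    by (rule poly_mapping_eqI) (simp add: l lookup_add scaleC_add_right)
  show "(a + b) *\<^sub>C x = a *\<^sub>C x + b *\<^sub>C x"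
    by (rule poly_mapping_eqI) (simp add: l lookup_add scaleC_add_left)
  show "a *\<^sub>C (b *\<^sub>C x) = (a * b) *\<^sub>C x"
    by (rule poly_mapping_eqI) (simp add: l scaleC_scaleC)
  show "1 *\<^sub>C x = x"
    by (rule poly_mapping_eqI) (simp add: l scaleC_one)
qed
end

text \<open>\<^typ>\<open>'b \<Rightarrow>\<^sub>0 complex\<close> is the complex vector space with basis \<^typ>\<open>'b\<close>.\<close>

definition basis_vec :: "'b \<Rightarrow> ('b \<Rightarrow>\<^sub>0 complex)" where
  "basis_vec b = Poly_Mapping.single b 1"

definition lin_ext :: "('b \<Rightarrow> 'v :: complex_vector) \<Rightarrow> ('b \<Rightarrow>\<^sub>0 complex) \<Rightarrow> 'v" where
  "lin_ext f p = (\<Sum>b\<in>Poly_Mapping.keys p. Poly_Mapping.lookup p b *\<^sub>C f b)"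

definition tensor ::
  "('a \<Rightarrow>\<^sub>0 complex) \<Rightarrow> ('b \<Rightarrow>\<^sub>0 complex) \<Rightarrow> ('a \<times> 'b \<Rightarrow>\<^sub>0 complex)" where
  "tensor u v = lin_ext (\<lambda>a. lin_ext (\<lambda>b. basis_vec (a, b)) v) u"

definition tensor_space ::
  "('a \<Rightarrow>\<^sub>0 complex) set \<Rightarrow> ('b \<Rightarrow>\<^sub>0 complex) set \<Rightarrow> ('a \<times> 'b \<Rightarrow>\<^sub>0 complex) set" where
  "tensor_space A B = cvec.span {tensor u v | u v. u \<in> A \<and> v \<in> B}"


section \<open>Vertex operator algebras, modules and quantum dimensions\<close>

text \<open>\<^term>\<open>vmode V u n v\<close> is \<open>u\<^sub>n v\<close>, where \<open>Y(u,z) = \<Sum>\<^sub>n u\<^sub>n z\<^bsup>-n-1\<^esup>\<close>; likewise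
  \<^term>\<open>mmode M u n m\<close> for a module.  The mode functions are total; only their values on the
  underlying spaces matter.\<close>

record 'v voa =
  vspace :: "'v set"
  vmode :: "'v \<Rightarrow> int \<Rightarrow> 'v \<Rightarrow> 'v"
  vacuum :: 'v
  conformal :: 'v

record ('v, 'm) vmodule =
  mspace :: "'m set"
  mmode :: "'v \<Rightarrow> int \<Rightarrow> 'm \<Rightarrow> 'm"

definition adjoint_module :: "'v voa \<Rightarrow> ('v, 'v) vmodule" where
  "adjoint_module V = \<lparr>mspace = vspace V, mmode = vmode V\<rparr>"

definition vir :: "'v voa \<Rightarrow> ('v, 'm) vmodule \<Rightarrow> int \<Rightarrow> 'm \<Rightarrow> 'm" where
  "vir V M n m = mmode M (conformal V) (n + 1) m"

definition central_charge :: "'v :: complex_vector voa \<Rightarrow> complex" where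
  "central_charge V = (THE c. \<forall>m n. \<forall>v\<in>vspace V.
     vir V (adjoint_module V) m (vir V (adjoint_module V) n v) - vir V (adjoint_module V) n (vir V (adjoint_module V) m v)
     = of_int (m - n) *\<^sub>C vir V (adjoint_module V) (m + n) v
       + (if m + n = 0 then (of_int (m ^ 3 - m) / 12 * c) *\<^sub>C v else 0))"

definition weight_space ::
  "'v voa \<Rightarrow> ('v, 'm :: complex_vector) vmodule \<Rightarrow> complex \<Rightarrow> 'm set" where
  "weight_space V M w = {m \<in> mspace M. vir V M 0 m = w *\<^sub>C m}"

text \<open>The Jacobi identity is stated in its component (Borcherds) form.\<close>

definition voa_module ::
  "'v :: complex_vector voa \<Rightarrow> ('v, 'm :: complex_vector) vmodule \<Rightarrow> bool" where
  "voa_module V M \<longleftrightarrow>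
     cvec.subspace (mspace M) \<and>
     (\<forall>u\<in>vspace V. \<forall>n. \<forall>m\<in>mspace M. mmode M u n m \<in> mspace M) \<and>
     (\<forall>u\<in>vspace V. \<forall>v\<in>vspace V. \<forall>a n. \<forall>m\<in>mspace M.
        mmode M (u + v) n m = mmode M u n m + mmode M v n m \<and>
        mmode M (a *\<^sub>C u) n m = a *\<^sub>C mmode M u n m) \<and>
     (\<forall>u\<in>vspace V. \<forall>a n. \<forall>m\<in>mspace M. \<forall>m'\<in>mspace M.
        mmode M u n (m + m') = mmode M u n m + mmode M u n m' \<and>
        mmode M u n (a *\<^sub>C m) = a *\<^sub>C mmode M u n m) \<and>
     (\<forall>u\<in>vspace V. \<forall>m\<in>mspace M. \<exists>n0. \<forall>n\<ge>n0. mmode M u n m = 0) \<and>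
     (\<forall>n. \<forall>m\<in>mspace M. mmode M (vacuum V) n m = (if n = -1 then m else 0)) \<and>
     (\<forall>u\<in>vspace V. \<forall>v\<in>vspace V. \<forall>m\<in>mspace M. \<forall>p q r :: int.
        Sum_any (\<lambda>i::nat. (of_int p gchoose i) *\<^sub>C
            mmode M (vmode V u (r + int i) v) (p + q - int i) m)
        = Sum_any (\<lambda>i::nat. ((-1) ^ i * (of_int r gchoose i)) *\<^sub>C
            (mmode M u (p + r - int i) (mmode M v (q + int i) m)
             - ((-1) powi r) *\<^sub>C mmode M v (q + r - int i) (mmode M u (p + int i) m)))) \<and>
     mspace M \<subseteq> cvec.span (\<Union>w. weight_space V M w) \<and>
     (\<forall>w. \<exists>B. finite B \<and> weight_space V M w \<subseteq> cvec.span B) \<and>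
     (\<forall>w. \<exists>n0. \<forall>n<n0. weight_space V M (w + of_int n) = {0})"

definition irreducible_module ::
  "'v :: complex_vector voa \<Rightarrow> ('v, 'm :: complex_vector) vmodule \<Rightarrow> bool" where
  "irreducible_module V M \<longleftrightarrow> voa_module V M \<and> mspace M \<noteq> {0} \<and>
     (\<forall>W. cvec.subspace W \<and> W \<subseteq> mspace M \<and>
          (\<forall>u\<in>vspace V. \<forall>n. \<forall>m\<in>W. mmode M u n m \<in> W)
        \<longrightarrow> W = {0} \<or> W = mspace M)"

text \<open>\<open>tr\<^sub>M q\<^bsup>L(0)-c/24\<^esup>\<close>, summed over the eigenvalues of \<open>L(0)\<close>.\<close>

definition character ::
  "'v :: complex_vector voa \<Rightarrow> ('v, 'm :: complex_vector) vmodule \<Rightarrow> complex \<Rightarrow> complex" where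
  "character V M \<tau> = (\<Sum>\<^sub>\<infinity>w\<in>UNIV. of_nat (cvec.dim (weight_space V M w)) *
     exp (2 * of_real pi * \<i> * \<tau> * (w - central_charge V / 24)))"

text \<open>The quantum dimension exists and equals \<open>d\<close>.\<close>

definition has_qdim ::
  "'v :: complex_vector voa \<Rightarrow> ('v, 'm :: complex_vector) vmodule \<Rightarrow> complex \<Rightarrow> bool" where
  "has_qdim V M d \<longleftrightarrow>
     ((\<lambda>y::real. character V M (\<i> * of_real y) / character V (adjoint_module V) (\<i> * of_real y))
       \<longlongrightarrow> d) (at_right 0)"

definition module_iso ::
  "'v voa \<Rightarrow> ('v, 'm :: complex_vector) vmodule \<Rightarrow> ('v, 'n :: complex_vector) vmodule \<Rightarrow> bool" where
  "module_iso V M N \<longleftrightarrow> (\<exists>f. bij_betw f (mspace M) (mspace N) \<and>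
     (\<forall>x\<in>mspace M. \<forall>y\<in>mspace M. f (x + y) = f x + f y) \<and>
     (\<forall>a. \<forall>x\<in>mspace M. f (a *\<^sub>C x) = a *\<^sub>C f x) \<and>
     (\<forall>u\<in>vspace V. \<forall>n. \<forall>x\<in>mspace M. f (mmode M u n x) = mmode N u n (f x)))"

definition direct_sum ::
  "('v, 'm) vmodule \<Rightarrow> ('v, 'n) vmodule \<Rightarrow> ('v, 'm \<times> 'n) vmodule" where
  "direct_sum M N = \<lparr>mspace = mspace M \<times> mspace N,
     mmode = (\<lambda>u n (x, y). (mmode M u n x, mmode N u n y))\<rparr>"

definition pullback :: "('a \<Rightarrow> 'v) \<Rightarrow> ('v, 'm) vmodule \<Rightarrow> ('a, 'm) vmodule" where
  "pullback \<phi> M = \<lparr>mspace = mspace M, mmode = (\<lambda>u. mmode M (\<phi> u))\<rparr>"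

text \<open>\<open>Y(u \<otimes> v, z) = Y(u,z) \<otimes> Y(v,z)\<close>.\<close>

definition tensor_mode ::
  "(('a \<Rightarrow>\<^sub>0 complex) \<Rightarrow> int \<Rightarrow> ('m \<Rightarrow>\<^sub>0 complex) \<Rightarrow> ('m \<Rightarrow>\<^sub>0 complex)) \<Rightarrow>
   (('b \<Rightarrow>\<^sub>0 complex) \<Rightarrow> int \<Rightarrow> ('n \<Rightarrow>\<^sub>0 complex) \<Rightarrow> ('n \<Rightarrow>\<^sub>0 complex)) \<Rightarrow>
   ('a \<times> 'b \<Rightarrow>\<^sub>0 complex) \<Rightarrow> int \<Rightarrow> ('m \<times> 'n \<Rightarrow>\<^sub>0 complex) \<Rightarrow> ('m \<times> 'n \<Rightarrow>\<^sub>0 complex)" where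
  "tensor_mode f g t n w =
     lin_ext (\<lambda>(a, b). lin_ext (\<lambda>(c, d).
       Sum_any (\<lambda>i. tensor (f (basis_vec a) i (basis_vec c))
                           (g (basis_vec b) (n - 1 - i) (basis_vec d)))) w) t"

definition tensor_voa ::
  "('a \<Rightarrow>\<^sub>0 complex) voa \<Rightarrow> ('b \<Rightarrow>\<^sub>0 complex) voa \<Rightarrow> ('a \<times> 'b \<Rightarrow>\<^sub>0 complex) voa" where
  "tensor_voa V W = \<lparr>vspace = tensor_space (vspace V) (vspace W),
     vmode = tensor_mode (vmode V) (vmode W),
     vacuum = tensor (vacuum V) (vacuum W),
     conformal = tensor (conformal V) (vacuum W) + tensor (vacuum V) (conformal W)\<rparr>"

definition tensor_module ::
  "('a \<Rightarrow>\<^sub>0 complex, 'm \<Rightarrow>\<^sub>0 complex) vmodule \<Rightarrow> ('b \<Rightarrow>\<^sub>0 complex, 'n \<Rightarrow>\<^sub>0 complex) vmodule \<Rightarrow>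
   ('a \<times> 'b \<Rightarrow>\<^sub>0 complex, 'm \<times> 'n \<Rightarrow>\<^sub>0 complex) vmodule" where
  "tensor_module M N = \<lparr>mspace = tensor_space (mspace M) (mspace N),
     mmode = tensor_mode (mmode M) (mmode N)\<rparr>"

definition fixed_voa :: "('v \<Rightarrow> 'v) \<Rightarrow> 'v voa \<Rightarrow> 'v voa" where
  "fixed_voa g V = V\<lparr>vspace := {v \<in> vspace V. g v = v}\<rparr>"

definition eigen_module ::
  "('m \<Rightarrow> 'm) \<Rightarrow> complex \<Rightarrow> ('v, 'm :: complex_vector) vmodule \<Rightarrow> ('v, 'm) vmodule" where
  "eigen_module g e M = M\<lparr>mspace := {m \<in> mspace M. g m = e *\<^sub>C m}\<rparr>"


section \<open>Rank one lattice vertex operator algebras and their modules\<close>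

text \<open>Let \<open>N = \<langle>\<gamma>,\<gamma>\<rangle>\<close>.  The basis element \<open>({#n\<^sub>1,\<dots>,n\<^sub>r#}, x)\<close> stands for
  \<open>\<gamma>(-n\<^sub>1)\<cdots>\<gamma>(-n\<^sub>r) \<otimes> e\<^bsup>x\<gamma>\<^esup>\<close>.  Twisted Fock spaces have half-integral \<open>n\<^sub>j\<close>, and second
  component \<open>x = 0\<close> throughout, which then carries no meaning.\<close>

type_synonym fock_basis = "real multiset \<times> real"
type_synonym fock = "fock_basis \<Rightarrow>\<^sub>0 complex"

text \<open>The operator \<open>\<gamma>(j)\<close>; \<open>[\<gamma>(i),\<gamma>(j)] = i \<delta>\<^bsub>i+j,0\<^esub> N\<close>.\<close>

definition osc :: "real \<Rightarrow> real \<Rightarrow> fock \<Rightarrow> fock" where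
  "osc N j = lin_ext (\<lambda>(A, x).
     if j < 0 then basis_vec (add_mset (- j) A, x)
     else if j = 0 then of_real (N * x) *\<^sub>C basis_vec (A, x)
     else of_real (j * N * real (count A j)) *\<^sub>C basis_vec (A - {#j#}, x))"

text \<open>\<^term>\<open>exp_coeff b m\<close> is the coefficient of \<open>t\<^sup>m\<close> in \<open>exp (\<Sum>\<^bsub>j\<ge>1\<^esub> b\<^sub>j t\<^sup>j)\<close> for commuting operators
  \<open>b\<^sub>j\<close>, computed from \<open>t E'(t) = (\<Sum>\<^sub>j j b\<^sub>j t\<^sup>j) E(t)\<close>.\<close>

fun exp_coeff :: "(nat \<Rightarrow> 'v \<Rightarrow> 'v :: complex_vector) \<Rightarrow> nat \<Rightarrow> 'v \<Rightarrow> 'v" where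
  "exp_coeff b 0 v = v"
| "exp_coeff b (Suc m) v = (1 / of_nat (Suc m)) *\<^sub>C
     (\<Sum>j\<le>m. of_nat (Suc j) *\<^sub>C b (Suc j) (exp_coeff b (m - j) v))"

text \<open>\<open>J\<close> is the index set of the modes: \<open>\<int>\<close> in the untwisted and \<open>1/2 + \<int>\<close> in the twisted sector.
  The next two are the coefficients of \<open>z\<^bsup>p/2\<^esup>\<close> in \<open>exp (\<Sum>\<^bsub>n\<in>J, n>0\<^esub> x\<gamma>(-n) z\<^sup>n / n)\<close> and of
  \<open>z\<^bsup>-p/2\<^esup>\<close> in \<open>exp (- \<Sum>\<^bsub>n\<in>J, n>0\<^esub> x\<gamma>(n) z\<^bsup>-n\<^esup> / n)\<close>.\<close>

definition exp_create :: "real set \<Rightarrow> real \<Rightarrow> real \<Rightarrow> nat \<Rightarrow> fock \<Rightarrow> fock" where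
  "exp_create J N x = exp_coeff (\<lambda>j v. if real j / 2 \<in> J
     then of_real (x / (real j / 2)) *\<^sub>C osc N (- (real j / 2)) v else 0)"

definition exp_annih :: "real set \<Rightarrow> real \<Rightarrow> real \<Rightarrow> nat \<Rightarrow> fock \<Rightarrow> fock" where
  "exp_annih J N x = exp_coeff (\<lambda>j v. if real j / 2 \<in> J
     then of_real (- (x / (real j / 2))) *\<^sub>C osc N (real j / 2) v else 0)"

text \<open>Coefficient of \<open>z\<^bsup>-m-1\<^esup>\<close> of
  \<open>exp(\<Sum> x\<gamma>(-n) z\<^sup>n/n) exp(-\<Sum> x\<gamma>(n) z\<^bsup>-n\<^esup>/n) G z\<^bsup>E\<^esup>\<close>, where on a vector of charge \<open>y\<close> the operator \<open>G\<close>
  is \<open>g x\<close> and \<open>E = ex x y\<close>.\<close>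

definition exp_vertex_op ::
  "real set \<Rightarrow> real \<Rightarrow> (real \<Rightarrow> fock \<Rightarrow> fock) \<Rightarrow> (real \<Rightarrow> real \<Rightarrow> real) \<Rightarrow>
   real \<Rightarrow> real \<Rightarrow> fock \<Rightarrow> fock" where
  "exp_vertex_op J N g ex x m = lin_ext (\<lambda>(A, y).
     Sum_any (\<lambda>(p, l). if (real p - real l) / 2 + ex x y = - m - 1
       then exp_create J N x p (exp_annih J N x l (g x (basis_vec (A, y)))) else 0))"

text \<open>Coefficient of \<open>z\<^bsup>-m-1\<^esup>\<close> of the normal ordered product of the fields
  \<open>\<partial>\<^bsup>n-1\<^esup>\<gamma>(z) / (n-1)!\<close>, for \<open>n\<close> in the list, and the vertex operator of \<open>e\<^bsup>x\<gamma>\<^esup>\<close>.\<close>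

fun normal_ordered ::
  "real set \<Rightarrow> real \<Rightarrow> (real \<Rightarrow> fock \<Rightarrow> fock) \<Rightarrow> (real \<Rightarrow> real \<Rightarrow> real) \<Rightarrow>
   real list \<Rightarrow> real \<Rightarrow> real \<Rightarrow> fock \<Rightarrow> fock" where
  "normal_ordered J N g ex [] x m w = exp_vertex_op J N g ex x m w"
| "normal_ordered J N g ex (n # ns) x m w = Sum_any (\<lambda>j. if j \<in> J
     then of_real ((- j - 1) gchoose (nat \<lfloor>n\<rfloor> - 1)) *\<^sub>C
       (if j < 0 then osc N j (normal_ordered J N g ex ns x (m - j - n) w)
        else normal_ordered J N g ex ns x (m - j - n) (osc N j w))
     else 0)"

definition half_integers :: "real set" where
  "half_integers = {j. j - 1 / 2 \<in> \<int>}"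

text \<open>Untwisted vertex operators, with \<open>e\<^bsup>x\<gamma>\<^esup>\<close> acting by \<open>e\<^bsup>y\<gamma>\<^esup> \<mapsto> z\<^bsup>N x y\<^esup> e\<^bsup>(x+y)\<gamma>\<^esup>\<close>; a rank one even
  lattice admits the trivial cocycle.\<close>

definition lattice_mode :: "real \<Rightarrow> fock \<Rightarrow> int \<Rightarrow> fock \<Rightarrow> fock" where
  "lattice_mode N v n w = lin_ext (\<lambda>(A, x). normal_ordered \<int> N
     (\<lambda>x. lin_ext (\<lambda>(B, y). basis_vec (B, x + y))) (\<lambda>x y. N * x * y)
     (sorted_list_of_multiset A) x (of_int n) w) v"

text \<open>\<open>V\<^bsub>\<int>\<gamma>+r\<gamma>\<^esub>\<close>\<close>

definition lattice_space :: "real \<Rightarrow> fock set" where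
  "lattice_space r = cvec.span {basis_vec (A, x) | A x.
     (\<forall>n\<in>#A. n \<in> \<int> \<and> n > 0) \<and> x - r \<in> \<int>}"

definition lattice_voa :: "real \<Rightarrow> fock voa" where
  "lattice_voa N = \<lparr>vspace = lattice_space 0, vmode = lattice_mode N,
     vacuum = basis_vec ({#}, 0),
     conformal = of_real (1 / (2 * N)) *\<^sub>C basis_vec ({#1, 1#}, 0)\<rparr>"

definition lattice_module :: "real \<Rightarrow> real \<Rightarrow> (fock, fock) vmodule" where
  "lattice_module N r = \<lparr>mspace = lattice_space r, mmode = lattice_mode N\<rparr>"

text \<open>On twisted Fock spaces, where \<open>x = 0\<close>, this is the action on \<open>M(1)(\<theta>) \<otimes> T\<^sub>s\<close>.\<close>

definition theta :: "fock \<Rightarrow> fock" where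
  "theta = lin_ext (\<lambda>(A, x). (-1) ^ size A *\<^sub>C basis_vec (A, - x))"

text \<open>The Frenkel--Lepowsky--Meurman twisted vertex operators: \<open>Y(v,z) = W(exp(\<Delta>\<^sub>z) v, z)\<close>, where \<open>W\<close> is
  the normal ordered vertex operator over half-integral modes,
  \<open>W(e\<^sup>\<mu>,z) = 2\<^bsup>-\<langle>\<mu>,\<mu>\<rangle>\<^esup> exp(\<dots>) exp(\<dots>) e\<^sub>\<mu> z\<^bsup>-\<langle>\<mu>,\<mu>\<rangle>/2\<^esup>\<close>,
  \<open>\<Delta>\<^sub>z = \<Sum>\<^bsub>m,n\<ge>0\<^esub> c\<^bsub>mn\<^esub> \<gamma>(m)\<gamma>(n) z\<^bsup>-m-n\<^esup> / N\<close>, and the \<open>c\<^bsub>mn\<^esub>\<close> are the Taylor coefficients at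
  \<open>(0,0)\<close> of \<open>-log (((1+x)\<^bsup>1/2\<^esup> + (1+y)\<^bsup>1/2\<^esup>) / 2)\<close>.\<close>

definition flm_coeff :: "nat \<Rightarrow> nat \<Rightarrow> real" where
  "flm_coeff m n = (deriv ^^ m) (\<lambda>x. (deriv ^^ n)
     (\<lambda>y. - ln ((sqrt (1 + x) + sqrt (1 + y)) / 2)) 0) 0 / (fact m * fact n)"

definition flm_delta :: "real \<Rightarrow> nat \<Rightarrow> fock \<Rightarrow> fock" where
  "flm_delta N r v = (\<Sum>m\<le>r. of_real (flm_coeff m (r - m) / N) *\<^sub>C
     osc N (real m) (osc N (real (r - m)) v))"

text \<open>The action of \<open>e\<^bsup>x\<gamma>\<^esup>\<close> (\<open>x \<in> \<int>\<close>) on \<open>T\<^sub>s\<close>, multiplied by \<open>2\<^bsup>-\<langle>x\<gamma>,x\<gamma>\<rangle>\<^esup>\<close>.\<close>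

definition twisted_group :: "real \<Rightarrow> nat \<Rightarrow> real \<Rightarrow> fock \<Rightarrow> fock" where
  "twisted_group N s x w =
     (((-1) ^ (s - 1)) powi \<lfloor>x\<rfloor> * of_real (2 powr (- (N * x\<^sup>2)))) *\<^sub>C w"

definition twisted_mode :: "real \<Rightarrow> nat \<Rightarrow> fock \<Rightarrow> int \<Rightarrow> fock \<Rightarrow> fock" where
  "twisted_mode N s v n w = Sum_any (\<lambda>r::nat.
     lin_ext (\<lambda>(A, x). normal_ordered half_integers N (twisted_group N s)
       (\<lambda>x y. - (N * x\<^sup>2 / 2)) (sorted_list_of_multiset A) x (of_int n - real r) w)
     (exp_coeff (flm_delta N) r v))"

text \<open>\<open>V\<^bsub>\<int>\<gamma>\<^esub>\<^bsup>T\<^sub>s\<^esup>\<close>.  Only the integral modes are recorded; these are all the modes of elements of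
  \<open>V\<^bsub>\<int>\<gamma>\<^esub>\<^sup>+\<close>.\<close>

definition twisted_module :: "real \<Rightarrow> nat \<Rightarrow> (fock, fock) vmodule" where
  "twisted_module N s =
     \<lparr>mspace = cvec.span {basis_vec (A, 0) | A. \<forall>n\<in>#A. n \<in> half_integers \<and> n > 0},
      mmode = twisted_mode N s\<rparr>"


section \<open>The permutation orbifold and its irreducible modules\<close>

definition swap_tensor :: "('b \<times> 'b \<Rightarrow>\<^sub>0 complex) \<Rightarrow> ('b \<times> 'b \<Rightarrow>\<^sub>0 complex)" where
  "swap_tensor = lin_ext (\<lambda>(a, b). basis_vec (b, a))"

type_synonym fock2 = "fock_basis \<times> fock_basis \<Rightarrow>\<^sub>0 complex"

text \<open>\<open>\<U> = (V\<^sub>L \<otimes> V\<^sub>L)\<^bsup>\<int>\<^sub>2\<^esup>\<close> with \<open>L = \<int>\<alpha>\<close>, \<open>\<langle>\<alpha>,\<alpha>\<rangle> = 2k\<close>\<close>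

definition perm_orbifold :: "nat \<Rightarrow> fock2 voa" where
  "perm_orbifold k = fixed_voa swap_tensor
     (tensor_voa (lattice_voa (2 * real k)) (lattice_voa (2 * real k)))"

text \<open>\<open>V\<^bsub>\<int>\<beta>\<^esub>\<^sup>+\<close> and \<open>V\<^bsub>\<int>\<beta>\<^esub> \<otimes> V\<^bsub>\<int>\<beta>\<^esub>\<^sup>+\<close> with \<open>\<langle>\<beta>,\<beta>\<rangle> = 4k\<close>\<close>

definition beta_plus :: "nat \<Rightarrow> fock voa" where
  "beta_plus k = fixed_voa theta (lattice_voa (4 * real k))"

definition beta_sub :: "nat \<Rightarrow> fock2 voa" where
  "beta_sub k = tensor_voa (lattice_voa (4 * real k)) (beta_plus k)"

definition osc_left :: "real \<Rightarrow> real \<Rightarrow> fock2 \<Rightarrow> fock2" where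
  "osc_left N j = lin_ext (\<lambda>(a, b). tensor (osc N j (basis_vec a)) (basis_vec b))"

definition osc_right :: "real \<Rightarrow> real \<Rightarrow> fock2 \<Rightarrow> fock2" where
  "osc_right N j = lin_ext (\<lambda>(a, b). tensor (basis_vec a) (osc N j (basis_vec b)))"

text \<open>The embedding \<open>V\<^bsub>\<int>\<beta>\<^sub>1\<^esub> \<otimes> V\<^bsub>\<int>\<beta>\<^sub>2\<^esub> \<rightarrow> V\<^sub>L \<otimes> V\<^sub>L\<close> given by \<open>\<beta>\<^sub>1 = \<alpha>\<^sup>1 + \<alpha>\<^sup>2\<close>, \<open>\<beta>\<^sub>2 = \<alpha>\<^sup>1 - \<alpha>\<^sup>2\<close>; in
  particular \<open>e\<^bsup>x\<beta>\<^sub>1\<^esup> \<otimes> e\<^bsup>y\<beta>\<^sub>2\<^esup> \<mapsto> e\<^bsup>(x+y)\<alpha>\<^esup> \<otimes> e\<^bsup>(x-y)\<alpha>\<^esup>\<close>.  It intertwines \<open>1 \<otimes> \<theta>\<close> with the swap and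
  hence maps \<open>V\<^bsub>\<int>\<beta>\<^esub> \<otimes> V\<^bsub>\<int>\<beta>\<^esub>\<^sup>+\<close> into \<open>\<U>\<close>.\<close>

definition beta_embed :: "nat \<Rightarrow> fock2 \<Rightarrow> fock2" where
  "beta_embed k = lin_ext (\<lambda>((A, x), (B, y)).
     foldr (\<lambda>n t. osc_left (2 * real k) (- n) t + osc_right (2 * real k) (- n) t)
       (sorted_list_of_multiset A)
     (foldr (\<lambda>n t. osc_left (2 * real k) (- n) t - osc_right (2 * real k) (- n) t)
       (sorted_list_of_multiset B)
     (basis_vec (({#}, x + y), ({#}, x - y)))))"

text \<open>\<open>M\<close> is an irreducible \<open>\<U>\<close>-module whose restriction to \<open>V\<^bsub>\<int>\<beta>\<^esub> \<otimes> V\<^bsub>\<int>\<beta>\<^esub>\<^sup>+\<close> is \<open>N\<^sub>1 \<oplus> N\<^sub>2\<close>.\<close>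

definition irreducible_with_restriction ::
  "nat \<Rightarrow> (fock2, 'm :: complex_vector) vmodule \<Rightarrow>
   (fock2, fock2) vmodule \<Rightarrow> (fock2, fock2) vmodule \<Rightarrow> bool" where
  "irreducible_with_restriction k M N1 N2 \<longleftrightarrow>
     irreducible_module (perm_orbifold k) M \<and>
     module_iso (beta_sub k) (pullback (beta_embed k) M) (direct_sum N1 N2)"

definition beta_mod :: "nat \<Rightarrow> real \<Rightarrow> (fock, fock) vmodule" where
  "beta_mod k r = lattice_module (4 * real k) r"

definition beta_mod_eig :: "nat \<Rightarrow> real \<Rightarrow> complex \<Rightarrow> (fock, fock) vmodule" where
  "beta_mod_eig k r e = eigen_module theta e (beta_mod k r)"

definition beta_twisted_eig :: "nat \<Rightarrow> nat \<Rightarrow> complex \<Rightarrow> (fock, fock) vmodule" where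
  "beta_twisted_eig k s e = eigen_module theta e (twisted_module (4 * real k) s)"

text \<open>\<open>M = (i j)\<close>\<close>

definition is_pair_module ::
  "nat \<Rightarrow> nat \<Rightarrow> nat \<Rightarrow> (fock2, 'm :: complex_vector) vmodule \<Rightarrow> bool" where
  "is_pair_module k i j M \<longleftrightarrow> irreducible_with_restriction k M
     (tensor_module (beta_mod k ((real i + real j) / (4 * real k)))
                    (beta_mod k ((real i - real j) / (4 * real k))))
     (tensor_module (beta_mod k ((2 * real k + real i + real j) / (4 * real k)))
                    (beta_mod k ((2 * real k - real i + real j) / (4 * real k))))"

text \<open>\<open>M = (i \<epsilon>)\<^sup>~\<close>\<close>

definition is_tilde_module ::
  "nat \<Rightarrow> nat \<Rightarrow> nat \<Rightarrow> (fock2, 'm :: complex_vector) vmodule \<Rightarrow> bool" where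
  "is_tilde_module k i \<epsilon> M \<longleftrightarrow> irreducible_with_restriction k M
     (tensor_module (beta_mod k (real i / (2 * real k))) (beta_mod_eig k 0 ((-1) ^ \<epsilon>)))
     (tensor_module (beta_mod k ((real i + real k) / (2 * real k)))
                    (beta_mod_eig k (1 / 2) ((-1) ^ \<epsilon>)))"

text \<open>\<open>M = (i \<epsilon>)\<close> with a hat\<close>

definition is_hat_module ::
  "nat \<Rightarrow> nat \<Rightarrow> nat \<Rightarrow> (fock2, 'm :: complex_vector) vmodule \<Rightarrow> bool" where
  "is_hat_module k i \<epsilon> M \<longleftrightarrow>
     (if even (k + i) then irreducible_with_restriction k M
        (tensor_module (beta_mod k (real i / (4 * real k)))
                       (beta_twisted_eig k 1 ((-1) ^ \<epsilon>)))
        (tensor_module (beta_mod k ((2 * real k + real i) / (4 * real k)))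
                       (beta_twisted_eig k 1 ((-1) ^ \<epsilon>)))
      else irreducible_with_restriction k M
        (tensor_module (beta_mod k (real i / (4 * real k)))
                       (beta_twisted_eig k 2 ((-1) ^ \<epsilon>)))
        (tensor_module (beta_mod k ((2 * real k + real i) / (4 * real k)))
                       (beta_twisted_eig k 2 (- ((-1) ^ \<epsilon>)))))"

end

theory Submission
  imports Defs "HOL-Probability.Distributions" "HOL-Real_Asymp.Real_Asymp"
begin

text \<open>
  The factor \<open>q\<^bsup>-c/24\<^esup>\<close> cancels in the quotient of characters, so everything reduces to counting
  eigenvectors of \<open>L(0)\<close>.  The embedding of \<open>V\<^bsub>\<int>\<beta>\<^esub> \<otimes> V\<^bsub>\<int>\<beta>\<^esub>\<^sup>+\<close> maps the conformal vector to that of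
  \<open>\<U>\<close>, so the character of a \<open>\<U>\<close>-module is that of its restriction.  On the monomial basis \<open>L(0)\<close>
  is diagonal, and the eigenspaces of \<open>\<theta>\<close> and of the swap are spanned by symmetrized monomials; up to
  the contribution of the fixed monomials they carry half of the full character.

  Let \<open>P\<close> and \<open>Q\<close> be the generating functions of multisets of positive integers and of positive
  half-integers, and \<open>\<Theta>\<^bsub>a,r\<^esub>(y) = \<Sum>\<^bsub>x\<in>r+\<int>\<^esub> exp(-2\<pi>y a x\<^sup>2)\<close>.  As \<open>y \<rightarrow> 0\<close>, comparison with the
  Gaussian integral gives \<open>\<surd>y \<Theta>\<^bsub>a,r\<^esub> \<rightarrow> (2a)\<^bsup>-1/2\<^esup>\<close> for every \<open>r\<close>, and \<open>\<surd>y Q/P \<rightarrow> 2\<^bsup>-1/2\<^esup>\<close> by a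
  \<open>q\<close>-analogue of Wallis' product.  The characters are then asymptotic to
  \<open>(\<Theta>\<^bsub>k,0\<^esub>P)\<^sup>2/2\<close> for \<open>\<U>\<close>, to \<open>2(\<Theta>\<^bsub>2k,r\<^esub>P)\<^sup>2\<close> for \<open>(i j)\<close>, to half of that for the modules with a
  tilde, and to \<open>\<Theta>\<^bsub>2k,r\<^esub>PQ\<close> for those with a hat.
\<close>

section \<open>Linear algebra of spaces with a basis\<close>

text \<open>\<open>P\<close> and \<open>Q\<close> grow exponentially as \<open>y\<close> tends to 0,
  so no character has a useful limit by itself. Every character is therefore multiplied by
  \<open>y / P^2\<close>. For \<open>\<U>\<close> the limit is 1/(4k). Each of the two summands of a
  restriction contributes 1/(4k) when both factors are full lattice modules, 1/(8k) when the second
  is an eigenspace of theta on a lattice module, and 1/(2 sqrt(8k)) when it is an eigenspace on a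
  twisted module. Hence the quantum dimensions 4k * 2/(4k) = 2, 4k * 2/(8k) = 1 and 4k / sqrt(8k) =
  sqrt(2k). They do not depend on \<open>i\<close> and \<open>j\<close> because the leading term of
  a theta series is the same for all cosets.

  In the first two cases \<open>P^2\<close> cancels exactly. In the twisted case one power of
  \<open>P\<close> meets one of \<open>Q\<close>; the two share their exponential growth, and the
  remaining order 1/sqrt y of \<open>Q/P\<close> replaces the missing theta series.

  Fixed monomials are negligible because their share of a character is at most of order
  \<open>P^2\<close> times a single theta series, which \<open>y / P^2\<close> sends to 0.\<close>

interpretation cpair: vector_space_pair
  "scaleC :: complex \<Rightarrow> 'a \<Rightarrow> 'a :: complex_vector" "scaleC :: complex \<Rightarrow> 'b \<Rightarrow> 'b :: complex_vector"
  by unfold_locales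

abbreviation clinear :: "('a :: complex_vector \<Rightarrow> 'b :: complex_vector) \<Rightarrow> bool" where
  "clinear f \<equiv> Vector_Spaces.linear scaleC scaleC f"

lemma clinear_iff:
  fixes f :: "'a :: complex_vector \<Rightarrow> 'b :: complex_vector"
  shows "clinear f \<longleftrightarrow> (\<forall>x y. f (x + y) = f x + f y) \<and> (\<forall>a x. f (a *\<^sub>C x) = a *\<^sub>C f x)"
  by (simp add: Vector_Spaces.linear_iff cvec.vector_space_axioms)

lemma clinearI:
  fixes f :: "'a :: complex_vector \<Rightarrow> 'b :: complex_vector"
  assumes "\<And>x y. f (x + y) = f x + f y" "\<And>a x. f (a *\<^sub>C x) = a *\<^sub>C f x"
  shows "clinear f"
  using assms by (simp add: clinear_iff)

lemma clinear_scale2: "clinear f \<Longrightarrow> clinear (\<lambda>x. a *\<^sub>C f x)"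
  by (rule clinearI)
    (simp_all add: cpair.linear_add cpair.linear_scale scaleC_add_right scaleC_scaleC mult.commute)

lemma clinear_sum2:
  "(\<And>i. i \<in> I \<Longrightarrow> clinear (f i)) \<Longrightarrow> clinear (\<lambda>x. \<Sum>i\<in>I. f i x)"
  by (rule clinearI) (simp_all add: cpair.linear_add cpair.linear_scale sum.distrib cvec.scale_sum_right)

lemma lookup_scaleC [simp]: "Poly_Mapping.lookup (a *\<^sub>C p) k = a *\<^sub>C Poly_Mapping.lookup p k"
  by (simp add: scaleC_poly_mapping_def map.rep_eq when_def)

lemma scaleC_complex [simp]: "(a :: complex) *\<^sub>C b = a * b"
  by (simp add: scaleC_complex_def)

lemma lookup_basis_vec: "Poly_Mapping.lookup (basis_vec b) c = (if b = c then 1 else 0)"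
  by (simp add: basis_vec_def lookup_single when_def)

text \<open>Supports are not additive, since coefficients can cancel. Linearity of
  \<open>lin_ext\<close> is therefore proved over one finite set containing all the supports
  involved.\<close>

lemma lin_ext_superset:
  assumes "finite S" "Poly_Mapping.keys p \<subseteq> S"
  shows "lin_ext f p = (\<Sum>b\<in>S. Poly_Mapping.lookup p b *\<^sub>C f b)"
  unfolding lin_ext_def
  by (rule sum.mono_neutral_left) (use assms in \<open>auto simp: in_keys_iff\<close>)

lemma clinear_lin_ext: "clinear (lin_ext f)"
proof (rule clinearI)
  fix x y :: "'a \<Rightarrow>\<^sub>0 complex"
  let ?S = "Poly_Mapping.keys x \<union> Poly_Mapping.keys y"
  show "lin_ext f (x + y) = lin_ext f x + lin_ext f y"
    using Poly_Mapping.keys_add[of x y]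
    by (simp add: lin_ext_superset[of ?S] lookup_add scaleC_add_left sum.distrib)
next
  fix a and x :: "'a \<Rightarrow>\<^sub>0 complex"
  have "Poly_Mapping.keys (a *\<^sub>C x) \<subseteq> Poly_Mapping.keys x"
    by (auto simp: in_keys_iff)
  then show "lin_ext f (a *\<^sub>C x) = a *\<^sub>C lin_ext f x"
    by (simp add: lin_ext_superset[of "Poly_Mapping.keys x"] cvec.scale_sum_right scaleC_scaleC)
qed

lemma lin_ext_add [simp]: "lin_ext f (x + y) = lin_ext f x + lin_ext f y"
  and lin_ext_diff [simp]: "lin_ext f (x - y) = lin_ext f x - lin_ext f y"
  and lin_ext_scale [simp]: "lin_ext f (a *\<^sub>C x) = a *\<^sub>C lin_ext f x"
  and lin_ext_zero [simp]: "lin_ext f 0 = 0"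
  using cpair.linear_add[OF clinear_lin_ext] cpair.linear_diff[OF clinear_lin_ext] cpair.linear_scale[OF clinear_lin_ext]
    cpair.linear_0[OF clinear_lin_ext] by blast+

lemma lin_ext_basis_vec [simp]: "lin_ext f (basis_vec b) = f b"
  by (simp add: lin_ext_superset[of "{b}"] basis_vec_def scaleC_one)

lemma lin_ext_fun_add: "lin_ext (\<lambda>b. f b + g b) x = lin_ext f x + lin_ext g x"
  by (simp add: lin_ext_def scaleC_add_right sum.distrib)

lemma lin_ext_fun_scale: "lin_ext (\<lambda>b. a *\<^sub>C f b) x = a *\<^sub>C lin_ext f x"
  by (simp add: lin_ext_def cvec.scale_sum_right scaleC_scaleC mult.commute)

lemma basis_vec_expand:
  "x = (\<Sum>b\<in>Poly_Mapping.keys x. Poly_Mapping.lookup x b *\<^sub>C basis_vec b)"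
proof (rule poly_mapping_eqI)
  fix k
  show "Poly_Mapping.lookup x k = Poly_Mapping.lookup
      (\<Sum>b\<in>Poly_Mapping.keys x. Poly_Mapping.lookup x b *\<^sub>C basis_vec b) k"
    by (simp add: lookup_sum lookup_basis_vec if_distrib sum.delta in_keys_iff cong: if_cong)
qed

lemma lin_ext_basis_vec_id: "lin_ext basis_vec x = x"
  using basis_vec_expand[of x] by (simp add: lin_ext_def)

section \<open>Bilinearity of the tensor product\<close>

lemma clinear_tensor_left: "clinear (\<lambda>u. tensor u v)"
  unfolding tensor_def by (rule clinear_lin_ext)

lemma clinear_tensor_right: "clinear (\<lambda>v. tensor u v)"
  unfolding tensor_def
  by (rule clinearI) (simp_all add: lin_ext_fun_add lin_ext_fun_scale)

lemma tensor_basis_vec [simp]: "tensor (basis_vec a) (basis_vec b) = basis_vec (a, b)"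
  by (simp add: tensor_def)

lemma tensor_add_left: "tensor (u + u') v = tensor u v + tensor u' v"
  and tensor_scale_left: "tensor (a *\<^sub>C u) v = a *\<^sub>C tensor u v"
  and tensor_zero_left [simp]: "tensor 0 v = 0"
  using cpair.linear_add[OF clinear_tensor_left] cpair.linear_scale[OF clinear_tensor_left]
    cpair.linear_0[OF clinear_tensor_left] by blast+

lemma tensor_add_right: "tensor u (v + v') = tensor u v + tensor u v'"
  and tensor_scale_right: "tensor u (a *\<^sub>C v) = a *\<^sub>C tensor u v"
  and tensor_zero_right [simp]: "tensor u 0 = 0"
  using cpair.linear_add[OF clinear_tensor_right] cpair.linear_scale[OF clinear_tensor_right]
    cpair.linear_0[OF clinear_tensor_right] by blast+

lemma tensor_space_span:
  "tensor_space (cvec.span X) (cvec.span Y) = cvec.span {tensor x y | x y. x \<in> X \<and> y \<in> Y}"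
    (is "_ = cvec.span ?T")
proof
  have X: "tensor u y \<in> cvec.span ?T" if "u \<in> cvec.span X" "y \<in> Y" for u y
    using that(1)
  proof (induction rule: cvec.span_induct_alt)
    case base
    then show ?case by (simp add: cvec.span_zero)
  next
    case (step c x w)
    then show ?case
      unfolding tensor_add_left tensor_scale_left using that(2)
      by (intro cvec.span_add cvec.span_scale) (auto intro!: cvec.span_base)
  qed
  have Y: "tensor u v \<in> cvec.span ?T" if "u \<in> cvec.span X" "v \<in> cvec.span Y" for u v
    using that(2)
  proof (induction rule: cvec.span_induct_alt)
    case base
    then show ?case by (simp add: cvec.span_zero)
  next
    case (step c x w)
    then show ?case
      unfolding tensor_add_right tensor_scale_right
      using X[OF that(1)] by (intro cvec.span_add cvec.span_scale) auto
  qed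
  show "tensor_space (cvec.span X) (cvec.span Y) \<subseteq> cvec.span ?T"
    unfolding tensor_space_def by (rule cvec.span_minimal) (use Y in auto)
  show "cvec.span ?T \<subseteq> tensor_space (cvec.span X) (cvec.span Y)"
    unfolding tensor_space_def by (rule cvec.span_mono) (auto intro: cvec.span_base)
qed

text \<open>The coordinate at \<open>d c\<close> sees only the vector \<open>v c\<close>, so it
  reads its coefficient off any vanishing combination. For symmetrized monomials \<open>d c\<close>
  is the chosen one of the two monomials in \<open>v c\<close>.\<close>

lemma dual_family_independent:
  fixes v :: "'c \<Rightarrow> 'b \<Rightarrow>\<^sub>0 complex"
  assumes "\<And>c c'. c \<in> C \<Longrightarrow> c' \<in> C \<Longrightarrow> Poly_Mapping.lookup (v c) (d c') = (if c = c' then 1 else 0)"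
  shows "inj_on v C" "cvec.independent (v ` C)"
proof -
  show inj: "inj_on v C"
    by (rule inj_onI) (metis assms zero_neq_one)
  show "cvec.independent (v ` C)"
  proof (subst cvec.independent_explicit_finite_subsets, intro allI impI ballI)
    fix t u b
    assume t: "t \<subseteq> v ` C" "finite t" "(\<Sum>w\<in>t. u w *\<^sub>C w) = 0" "b \<in> t"
    then obtain c where c: "c \<in> C" "b = v c" by auto
    have "0 = Poly_Mapping.lookup (\<Sum>w\<in>t. u w *\<^sub>C w) (d c)"
      using t(3) by simp
    also have "\<dots> = (\<Sum>w\<in>t. if w = b then u w else 0)"
      unfolding lookup_sum
    proof (rule sum.cong)
      fix w assume "w \<in> t"
      then obtain c' where c': "c' \<in> C" "w = v c'" using t by auto
      then have "w = b \<longleftrightarrow> c' = c" using inj c by (auto dest: inj_onD)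
      then show "Poly_Mapping.lookup (u w *\<^sub>C w) (d c) = (if w = b then u w else 0)"
        using assms[OF c'(1) c(1)] c' by simp
    qed simp
    also have "\<dots> = u b" using t by simp
    finally show "u b = 0" by simp
  qed
qed

text \<open>A module isomorphism is constrained only on the underlying space, so \<open>f\<close>
  need not be linear on the whole type. A linear \<open>g\<close> that agrees with it on a basis of
  \<open>S\<close>, and hence on \<open>S\<close>, takes its place.\<close>

lemma dim_bij_additive:
  fixes f :: "'a :: complex_vector \<Rightarrow> 'b :: complex_vector"
  assumes S: "cvec.subspace S" and bij: "bij_betw f S T"
    and add: "\<And>x y. x \<in> S \<Longrightarrow> y \<in> S \<Longrightarrow> f (x + y) = f x + f y"
    and scale: "\<And>a x. x \<in> S \<Longrightarrow> f (a *\<^sub>C x) = a *\<^sub>C f x"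
  shows "cvec.dim S = cvec.dim T"
proof -
  obtain B where B: "B \<subseteq> S" "cvec.independent B" "S \<subseteq> cvec.span B" "card B = cvec.dim S"
    using cvec.basis_exists by blast
  have spanB: "cvec.span B = S"
    using B S by (simp add: cvec.span_minimal subset_antisym)
  obtain g where g: "clinear g" "\<And>b. b \<in> B \<Longrightarrow> g b = f b"
    using cpair.linear_independent_extend[OF B(2), of f] by blast
  have f0: "f 0 = 0"
    using scale[of 0 0] cvec.subspace_0[OF S] by simp
  have eq: "g x = f x" if "x \<in> S" for x
  proof -
    have "g x = f x \<and> x \<in> S"
      using that[folded spanB]
    proof (induction rule: cvec.span_induct_alt)
      case base
      then show ?case using f0 g cvec.subspace_0[OF S] by (simp add: cpair.linear_0)
    next
      case (step c x y)
      then have "x \<in> S" "y \<in> S" "c *\<^sub>C x \<in> S" using B S by (auto simp: cvec.subspace_scale)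
      with step S g show ?case
        by (auto simp: cpair.linear_add cpair.linear_scale add scale cvec.subspace_add)
    qed
    then show ?thesis ..
  qed
  have inj: "inj_on g S"
    using bij eq by (metis bij_betw_def inj_on_cong)
  have "T = g ` S"
    using bij eq by (force simp: bij_betw_def)
  also have "\<dots> = cvec.span (g ` B)"
    using cpair.linear_span_image[OF g(1)] spanB by simp
  finally have T: "T = cvec.span (g ` B)" .
  have "cvec.independent (g ` B)"
    using cpair.linear_independent_injective_image[OF g(1) B(2)] inj spanB by simp
  then have "cvec.dim T = card (g ` B)"
    unfolding T by (rule cvec.dim_span_eq_card_independent)
  also have "\<dots> = card B"
    using inj B(1) by (intro card_image) (auto intro: inj_on_subset)
  finally show ?thesis using B by simp
qed

lemma span_prod_zero:
  fixes B1 :: "'a :: complex_vector set" and B2 :: "'b :: complex_vector set"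
  shows "cvec.span (B1 \<times> {0} \<union> {0} \<times> B2) = cvec.span B1 \<times> cvec.span B2"
proof -
  let ?l = "\<lambda>x :: 'a. (x, 0 :: 'b)" and ?r = "\<lambda>y :: 'b. (0 :: 'a, y)"
  have l: "clinear ?l" and r: "clinear ?r"
    by (auto intro!: clinearI simp: scaleC_prod_def)
  have "B1 \<times> {0} = ?l ` B1" "{0} \<times> B2 = ?r ` B2" by auto
  then show ?thesis
    unfolding cvec.span_Un
    using cpair.linear_span_image[OF l, of B1] cpair.linear_span_image[OF r, of B2]
    by (auto simp: image_iff)
qed

lemma dim_Times:
  fixes B1 :: "'a :: complex_vector set" and B2 :: "'b :: complex_vector set"
  assumes "finite B1" "finite B2" "cvec.independent B1" "cvec.independent B2"
  shows "cvec.dim (cvec.span B1 \<times> cvec.span B2) = card B1 + card B2"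
proof -
  let ?B = "B1 \<times> {0} \<union> {0} \<times> B2"
  \<comment> \<open>Only \<open>(0, 0)\<close> could lie in both halves of \<open>?B\<close>, and
    independent sets do not contain 0.\<close>
  have nz: "0 \<notin> B1" "0 \<notin> B2" using assms cvec.dependent_zero by blast+
  have fin: "finite ?B" using assms by auto
  have disj: "B1 \<times> {0} \<inter> {0} \<times> B2 = {}" using nz by auto
  have "cvec.independent ?B"
  proof (rule cvec.independent_if_scalars_zero[OF fin])
    fix u x
    assume s: "(\<Sum>x\<in>?B. u x *\<^sub>C x) = 0" and x: "x \<in> ?B"
    have "(\<Sum>x\<in>?B. u x *\<^sub>C x) = (\<Sum>x\<in>B1 \<times> {0}. u x *\<^sub>C x) + (\<Sum>x\<in>{0} \<times> B2. u x *\<^sub>C x)"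
      using assms disj by (intro sum.union_disjoint) auto
    also have "(\<Sum>x\<in>B1 \<times> {0}. u x *\<^sub>C x) = (\<Sum>b\<in>B1. (u (b, 0) *\<^sub>C b, 0))"
      by (rule sum.reindex_bij_witness[of _ "\<lambda>b. (b, 0)" fst]) (auto simp: scaleC_prod_def)
    also have "(\<Sum>x\<in>{0} \<times> B2. u x *\<^sub>C x) = (\<Sum>b\<in>B2. (0, u (0, b) *\<^sub>C b))"
      by (rule sum.reindex_bij_witness[of _ "\<lambda>b. (0, b)" snd]) (auto simp: scaleC_prod_def)
    finally have "(\<Sum>b\<in>B1. u (b, 0) *\<^sub>C b) = 0" "(\<Sum>b\<in>B2. u (0, b) *\<^sub>C b) = 0"
      using s by (simp_all add: sum_prod zero_prod_def)
    then show "u x = 0"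
      using x cvec.independentD[OF assms(3) assms(1) order.refl, of "\<lambda>b. u (b, 0)"]
        cvec.independentD[OF assms(4) assms(2) order.refl, of "\<lambda>b. u (0, b)"] by auto
  qed
  then have "cvec.dim (cvec.span ?B) = card ?B"
    by (rule cvec.dim_span_eq_card_independent)
  also have "card ?B = card B1 + card B2"
    using assms disj by (simp add: card_Un_disjoint card_cartesian_product)
  finally show ?thesis by (simp add: span_prod_zero)
qed

section \<open>Graded characters\<close>

text \<open>\<open>F y\<close> is the trace of \<open>q\<^bsup>L(0)\<^esup>\<close> at \<open>q = exp (-2\<pi>y)\<close>, that is, the character without its central
  charge factor.\<close>

definition graded_char ::
  "'v :: complex_vector voa \<Rightarrow> ('v, 'm :: complex_vector) vmodule \<Rightarrow> (real \<Rightarrow> real) \<Rightarrow> bool" where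
  "graded_char V M F \<longleftrightarrow>
     (\<forall>w. \<exists>B. finite B \<and> cvec.independent B \<and> weight_space V M w = cvec.span B) \<and>
     (\<forall>y>0. ((\<lambda>w. of_nat (cvec.dim (weight_space V M w)) * exp (complex_of_real (- (2 * pi * y)) * w))
        has_sum complex_of_real (F y)) UNIV)"

text \<open>Applying \<open>L(0) - w\<close> to an expansion in the eigenbasis multiplies each
  coefficient by the eigenvalue minus \<open>w\<close>. By independence only basis vectors of
  eigenvalue \<open>w\<close> survive in a vector that is sent to 0.\<close>

lemma weight_space_eigenbasis:
  fixes v :: "'c \<Rightarrow> 'm :: complex_vector" and wt :: "'c \<Rightarrow> complex"
  assumes inj: "inj_on v C" and ind: "cvec.independent (v ` C)"
    and sp: "mspace M = cvec.span (v ` C)" and lin: "clinear (vir V M 0)"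
    and eig: "\<And>c. c \<in> C \<Longrightarrow> vir V M 0 (v c) = wt c *\<^sub>C v c"
  shows "weight_space V M w = cvec.span (v ` {c \<in> C. wt c = w})"
proof
  show "weight_space V M w \<subseteq> cvec.span (v ` {c \<in> C. wt c = w})"
  proof
    fix x assume "x \<in> weight_space V M w"
    then have x: "x \<in> cvec.span (v ` C)" "vir V M 0 x = w *\<^sub>C x"
      by (auto simp: weight_space_def sp)
    then obtain t r where t: "finite t" "t \<subseteq> v ` C" and xt: "x = (\<Sum>a\<in>t. r a *\<^sub>C a)"
      unfolding cvec.span_explicit by blast
    define h where "h a = wt (inv_into C v a)" for a
    have h: "vir V M 0 a = h a *\<^sub>C a" if "a \<in> t" for a
      using that t inj eig by (auto simp: h_def)
    have "0 = vir V M 0 x - w *\<^sub>C x" using x by simp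
    also have "\<dots> = (\<Sum>a\<in>t. (r a * (h a - w)) *\<^sub>C a)"
      unfolding xt
      by (simp add: cpair.linear_sum[OF lin] cpair.linear_scale[OF lin] h cvec.scale_sum_right
          cvec.scale_left_diff_distrib right_diff_distrib sum_subtractf scaleC_scaleC mult.commute)
    finally have "r a * (h a - w) = 0" if "a \<in> t" for a
      using cvec.independentD[OF ind t] that by metis
    then have *: "r a = 0 \<or> h a = w" if "a \<in> t" for a
      using that by fastforce
    show "x \<in> cvec.span (v ` {c \<in> C. wt c = w})"
      unfolding xt
    proof (rule cvec.span_sum)
      fix a assume a: "a \<in> t"
      then obtain c where c: "c \<in> C" "a = v c" using t by auto
      then have "h a = wt c" using inj by (simp add: h_def)
      then show "r a *\<^sub>C a \<in> cvec.span (v ` {c \<in> C. wt c = w})"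
        using *[OF a] c by (cases "r a = 0") (auto intro: cvec.span_scale cvec.span_base simp: cvec.span_zero)
    qed
  qed
  have "cvec.span (v ` {c \<in> C. wt c = w}) \<subseteq> {x. vir V M 0 x = w *\<^sub>C x}"
  proof (rule cvec.span_minimal)
    show "cvec.subspace {x. vir V M 0 x = w *\<^sub>C x}"
      by (rule cvec.subspaceI)
        (auto simp: cpair.linear_0[OF lin] cpair.linear_add[OF lin] cpair.linear_scale[OF lin]
          scaleC_add_right scaleC_scaleC mult.commute)
  qed (use eig in auto)
  moreover have "cvec.span (v ` {c \<in> C. wt c = w}) \<subseteq> mspace M"
    unfolding sp by (rule cvec.span_mono) auto
  ultimately show "cvec.span (v ` {c \<in> C. wt c = w}) \<subseteq> weight_space V M w"
    by (auto simp: weight_space_def)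
qed

text \<open>The sum over the eigenbasis is regrouped by eigenvalue: the basis vectors of eigenvalue
  \<open>w\<close> form a basis of the weight space, so their number is its dimension.\<close>

lemma graded_char_eigenbasis:
  fixes v :: "'c \<Rightarrow> 'm :: complex_vector" and wt :: "'c \<Rightarrow> real"
  assumes inj: "inj_on v C" and ind: "cvec.independent (v ` C)"
    and sp: "mspace M = cvec.span (v ` C)" and lin: "clinear (vir V M 0)"
    and eig: "\<And>c. c \<in> C \<Longrightarrow> vir V M 0 (v c) = complex_of_real (wt c) *\<^sub>C v c"
    and sum: "\<And>y. y > 0 \<Longrightarrow> ((\<lambda>c. exp (- (2 * pi * y) * wt c)) has_sum F y) C"
  shows "graded_char V M F"
proof -
  let ?C = "\<lambda>w. {c \<in> C. complex_of_real (wt c) = w}"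
  have ws: "weight_space V M w = cvec.span (v ` ?C w)" for w
    using weight_space_eigenbasis[OF inj ind sp lin eig] .
  have ind': "cvec.independent (v ` ?C w)" for w
    by (rule cvec.independent_mono[OF ind]) auto
  \<comment> \<open>Convergence at the single value \<open>y = 1\<close> already excludes an
    infinite eigenspace, which would contribute the same positive number infinitely often.\<close>
  have fin: "finite (?C w)" for w
  proof (rule ccontr)
    assume inf: "infinite (?C w)"
    have "(\<lambda>c. exp (- (2 * pi * 1) * wt c)) summable_on ?C w"
      by (rule summable_on_subset_banach[OF has_sum_imp_summable[OF sum]]) auto
    also have "?this \<longleftrightarrow> (\<lambda>c. exp (- (2 * pi * 1) * Re w)) summable_on ?C w"
      by (rule summable_on_cong) auto
    finally show False
      using inf infsum_diverge_constant by (metis exp_not_eq_zero)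
  qed
  have dim: "cvec.dim (weight_space V M w) = card (?C w)" for w
  proof -
    have "cvec.dim (weight_space V M w) = card (v ` ?C w)"
      unfolding ws by (rule cvec.dim_span_eq_card_independent[OF ind'])
    also have "\<dots> = card (?C w)"
      by (rule card_image, rule inj_on_subset[OF inj]) auto
    finally show ?thesis .
  qed
  have "((\<lambda>w. of_nat (card (?C w)) * exp (complex_of_real (- (2 * pi * y)) * w)) has_sum complex_of_real (F y)) UNIV"
    if y: "y > 0" for y
  proof (rule has_sum_SigmaD[where B = ?C and f = "\<lambda>(w, c). exp (complex_of_real (- (2 * pi * y)) * w)"])
    have "((\<lambda>c. complex_of_real (exp (- (2 * pi * y) * wt c))) has_sum complex_of_real (F y)) C"
      using has_sum_of_real[OF sum[OF y]] .
    also have "?this \<longleftrightarrow> ((\<lambda>(w, c). exp (complex_of_real (- (2 * pi * y)) * w)) has_sum complex_of_real (F y))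
        (Sigma UNIV ?C)"
      by (rule has_sum_reindex_bij_witness[of _ "\<lambda>(w, c). c" "\<lambda>c. (complex_of_real (wt c), c)"])
        (auto simp flip: exp_of_real)
    finally show "((\<lambda>(w, c). exp (complex_of_real (- (2 * pi * y)) * w)) has_sum complex_of_real (F y))
        (Sigma UNIV ?C)" .
    show "((\<lambda>c. (\<lambda>(w, c). exp (complex_of_real (- (2 * pi * y)) * w)) (w, c)) has_sum
        of_nat (card (?C w)) * exp (complex_of_real (- (2 * pi * y)) * w)) (?C w)" for w
      using fin by (intro has_sum_finiteI) auto
  qed
  then show ?thesis
    unfolding graded_char_def dim using fin ind' ws
    by (intro conjI allI impI) (blast intro: finite_imageI)+
qed

lemma exists_orbit_representatives:
  assumes "\<And>b. b \<in> B \<Longrightarrow> p b \<in> B" "\<And>b. b \<in> B \<Longrightarrow> p (p b) = b"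
  obtains R where "R \<subseteq> B" "R \<inter> p ` R = {}" "R \<union> p ` R = {b \<in> B. p b \<noteq> b}"
proof
  \<comment> \<open>The predicate depends only on the set \<open>{b, p b}\<close>, so both members
    of an orbit receive the same choice and exactly one of them chooses itself.\<close>
  define c where "c b = (SOME x. x = b \<or> x = p b)" for b
  have c: "c b = b \<or> c b = p b" for b
    unfolding c_def by (rule someI) auto
  have cp: "c (p b) = c b" if "b \<in> B" for b
    unfolding c_def using assms(2)[OF that] by (metis (no_types, lifting))
  let ?R = "{b \<in> B. c b = b \<and> p b \<noteq> b}"
  show "?R \<subseteq> B" by auto
  show "?R \<inter> p ` ?R = {}"
    using cp assms by auto
  show "?R \<union> p ` ?R = {b \<in> B. p b \<noteq> b}"
  proof (intro equalityI subsetI)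
    fix b assume b: "b \<in> {b \<in> B. p b \<noteq> b}"
    show "b \<in> ?R \<union> p ` ?R"
    proof (cases "c b = b")
      case False
      then have "p b \<in> ?R" using b c[of b] cp[of b] assms[of b] by auto
      then have "p (p b) \<in> p ` ?R" by blast
      then show ?thesis using b assms by auto
    qed (use b in auto)
  qed (use assms in force)
qed

text \<open>An orbit of \<open>p\<close> of size two contributes one eigenvector, a fixed point contributes one if it has
  the right sign.\<close>

lemma graded_char_symmetrized:
  fixes p :: "'b \<Rightarrow> 'b" and s :: "'b \<Rightarrow> complex" and wt :: "'b \<Rightarrow> real"
    and M :: "('v :: complex_vector, 'b \<Rightarrow>\<^sub>0 complex) vmodule"
  defines "f \<equiv> \<lambda>y b. exp (- (2 * pi * y) * wt b)"
  assumes pB: "\<And>b. b \<in> B \<Longrightarrow> p b \<in> B" and pp: "\<And>b. b \<in> B \<Longrightarrow> p (p b) = b"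
    and wtp: "\<And>b. b \<in> B \<Longrightarrow> wt (p b) = wt b"
    and sp: "\<And>b. b \<in> B \<Longrightarrow> s (p b) = s b" and s: "\<And>b. b \<in> B \<Longrightarrow> s b \<in> {1, -1}"
    and e: "e \<in> {1, -1}"
    and M: "mspace M = cvec.span ((\<lambda>b. basis_vec b + (e * s b) *\<^sub>C basis_vec (p b)) ` B)"
    and lin: "clinear (vir V M 0)"
    and eig: "\<And>b. b \<in> B \<Longrightarrow> vir V M 0 (basis_vec b) = complex_of_real (wt b) *\<^sub>C basis_vec b"
    and sum: "\<And>y. y > 0 \<Longrightarrow> f y summable_on B"
  shows "graded_char V M (\<lambda>y. (infsum (f y) B - infsum (f y) {b \<in> B. p b = b}) / 2
           + infsum (f y) {b \<in> B. p b = b \<and> s b = e})"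
proof -
  obtain R where R: "R \<subseteq> B" "R \<inter> p ` R = {}" "R \<union> p ` R = {b \<in> B. p b \<noteq> b}"
    using exists_orbit_representatives[of B p] pB pp by blast
  let ?Fix = "{b \<in> B. p b = b}" and ?Fe = "{b \<in> B. p b = b \<and> s b = e}"
  define C where "C = R \<union> ?Fe"
  define v where "v c = (if p c = c then basis_vec c
    else basis_vec c + (e * s c) *\<^sub>C basis_vec (p c))" for c
  have CB: "C \<subseteq> B" using R by (auto simp: C_def)
  have Rne: "p c \<noteq> c" if "c \<in> R" for c using R that by blast
  have pR: "p c \<notin> C" if "c \<in> R" for c
    using that R pp Rne unfolding C_def by (metis (no_types, lifting) Int_iff Un_iff empty_iff image_eqI mem_Collect_eq subsetD)
  have dual: "Poly_Mapping.lookup (v c) c' = (if c = c' then 1 else 0)" if "c \<in> C" "c' \<in> C" for c c'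
  proof (cases "p c = c")
    case False
    then have "c \<in> R" using that by (auto simp: C_def)
    then show ?thesis using pR[of c] that False by (auto simp: v_def lookup_add lookup_basis_vec)
  qed (auto simp: v_def lookup_basis_vec)
  note ind = dual_family_independent[of C v "\<lambda>c. c", OF dual]
  let ?u = "\<lambda>b. basis_vec b + (e * s b) *\<^sub>C basis_vec (p b)"
  have "cvec.span (?u ` B) = cvec.span (v ` C)"
    unfolding cvec.span_eq
  proof (intro conjI subsetI; elim imageE)
    fix x b assume x: "x = ?u b" and b: "b \<in> B"
    have se: "s b = e \<or> s b = - e" using s[OF b] e by auto
    have ee: "e * e = 1" using e by auto
    show "x \<in> cvec.span (v ` C)"
    proof (cases "p b = b")
      case True
      show ?thesis
      proof (cases "s b = e")
        case True
        then have "b \<in> C" "v b = basis_vec b" using \<open>p b = b\<close> b by (auto simp: C_def v_def)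
        then have "basis_vec b \<in> cvec.span (v ` C)" by (metis cvec.span_base image_eqI)
        then show ?thesis unfolding x \<open>p b = b\<close> by (intro cvec.span_add cvec.span_scale)
      next
        case False
        \<comment> \<open>A fixed monomial of the wrong sign is symmetrized to 0.\<close>
        then have "e * s b = - 1" using se ee by auto
        then show ?thesis
          unfolding x \<open>p b = b\<close> by (simp add: cvec.scale_minus_left scaleC_one cvec.span_zero)
      qed
    next
      case False
      show ?thesis
      proof (cases "b \<in> R")
        case True
        then have "x = v b" "b \<in> C" using False by (auto simp: x v_def C_def)
        then show ?thesis by (auto intro: cvec.span_base)
      next
        case nR: False
        then obtain r where r: "r \<in> R" "b = p r" using R b False by blast
        then have rB: "r \<in> B" using R by blast
        have pr: "p b = r" using r rB pp by simp
        have sr: "s b = s r" using r rB sp by simp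
        have "(e * s r) * (e * s r) = 1" using s[OF rB] ee by auto
        \<comment> \<open>The two members of an orbit have proportional symmetrizations; the factor
          \<open>e * s r\<close> has square 1.\<close>
        then have "x = (e * s r) *\<^sub>C v r"
          using Rne[OF r(1)] unfolding x v_def pr sr
          by (simp add: scaleC_add_right scaleC_scaleC r(2)[symmetric] scaleC_one add.commute)
        moreover have "v r \<in> v ` C" using r by (auto simp: C_def)
        ultimately show ?thesis by (auto intro: cvec.span_scale cvec.span_base)
      qed
    qed
  next
    fix x c assume x: "x = v c" and c: "c \<in> C"
    have ee: "e * e = 1" using e by auto
    have cB: "c \<in> B" using c CB by auto
    then have uc: "?u c \<in> cvec.span (?u ` B)" by (auto intro: cvec.span_base)
    show "x \<in> cvec.span (?u ` B)"
    proof (cases "p c = c")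
      case True
      then have "s c = e" using c Rne by (auto simp: C_def)
      then have "?u c = 2 *\<^sub>C basis_vec c"
        using True ee scaleC_add_left[of 1 1 "basis_vec c"] by (simp add: scaleC_one)
      then have "x = (1 / 2) *\<^sub>C ?u c" using True by (simp add: x v_def scaleC_scaleC scaleC_one)
      then show ?thesis using uc by (simp add: cvec.span_scale)
    qed (use uc x in \<open>simp add: v_def\<close>)
  qed
  with M have Mv: "mspace M = cvec.span (v ` C)" by simp
  have eigv: "vir V M 0 (v c) = complex_of_real (wt c) *\<^sub>C v c" if "c \<in> C" for c
  proof -
    have "c \<in> B" "p c \<in> B" using that CB pB by auto
    then show ?thesis
      using wtp[of c] eig
      by (simp add: v_def cpair.linear_add[OF lin] cpair.linear_scale[OF lin] scaleC_add_right
          scaleC_scaleC mult.commute)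
  qed
  show ?thesis
  proof (rule graded_char_eigenbasis[OF ind Mv lin eigv])
    fix y :: real assume y: "y > 0"
    have sm: "f y summable_on X" if "X \<subseteq> B" for X
      using sum[OF y] that by (rule summable_on_subset_banach)
    have pRB: "p ` R \<subseteq> B" using R by blast
    have injp: "inj_on p R" by (rule inj_on_inverseI[of _ p]) (use R pp in blast)
    have "infsum (f y) (p ` R) = infsum (f y \<circ> p) R"
      by (rule infsum_reindex[OF injp])
    also have "\<dots> = infsum (f y) R"
      using R wtp by (intro infsum_cong) (auto simp: f_def)
    finally have 1: "infsum (f y) (p ` R) = infsum (f y) R" .
    \<comment> \<open>Weights are constant on orbits, so the representatives carry half of what
      remains after removing the fixed points.\<close>
    have "B = (R \<union> p ` R) \<union> ?Fix" using R by blast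
    then have "infsum (f y) B = infsum (f y) ((R \<union> p ` R) \<union> ?Fix)" by simp
    also have "\<dots> = infsum (f y) (R \<union> p ` R) + infsum (f y) ?Fix"
      by (intro infsum_Un_disjoint sm) (use R in auto)
    also have "infsum (f y) (R \<union> p ` R) = infsum (f y) R + infsum (f y) (p ` R)"
      by (intro infsum_Un_disjoint sm) (use R pRB in auto)
    finally have 2: "infsum (f y) R = (infsum (f y) B - infsum (f y) ?Fix) / 2"
      using 1 by simp
    have "infsum (f y) C = infsum (f y) R + infsum (f y) ?Fe"
      unfolding C_def by (intro infsum_Un_disjoint sm) (use R Rne in auto)
    with 2 have "(f y has_sum ((infsum (f y) B - infsum (f y) ?Fix) / 2 + infsum (f y) ?Fe)) C"
      using has_sum_infsum[OF sm[OF CB]] by (simp only:)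
    then show "((\<lambda>c. exp (- (2 * pi * y) * wt c)) has_sum
        ((infsum (f y) B - infsum (f y) ?Fix) / 2 + infsum (f y) ?Fe)) C"
      by (simp add: f_def)
  qed
qed

section \<open>Direct sums, and quantum dimensions as limits of quotients of graded
  characters\<close>

lemma graded_char_direct_sum:
  assumes "graded_char V M F" "graded_char V N G"
  shows "graded_char V (direct_sum M N) (\<lambda>y. F y + G y)"
proof -
  have ws: "weight_space V (direct_sum M N) w = weight_space V M w \<times> weight_space V N w" for w
    by (auto simp: weight_space_def direct_sum_def vir_def scaleC_prod_def)
  have "\<exists>B. finite B \<and> cvec.independent B \<and> weight_space V (direct_sum M N) w = cvec.span B \<and>
      cvec.dim (weight_space V (direct_sum M N) w)
        = cvec.dim (weight_space V M w) + cvec.dim (weight_space V N w)" for w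
  proof -
    obtain B1 B2 where B: "finite B1" "cvec.independent B1" "weight_space V M w = cvec.span B1"
      "finite B2" "cvec.independent B2" "weight_space V N w = cvec.span B2"
      using assms unfolding graded_char_def by meson
    \<comment> \<open>\<open>?S\<close> spans the product of the two weight spaces. A basis chosen
      inside it is the required finite independent set, while \<open>dim_Times\<close> gives the
      dimension.\<close>
    let ?S = "B1 \<times> {0} \<union> {0} \<times> B2"
    obtain B where B': "B \<subseteq> ?S" "cvec.independent B" "?S \<subseteq> cvec.span B"
      using cvec.maximal_independent_subset[of ?S] by blast
    have "finite B" using B' B finite_subset by (metis finite.emptyI finite_SigmaI finite_UnI finite_insert)
    moreover have "cvec.span B = cvec.span ?S" using B' by (auto simp: cvec.span_eq cvec.span_base)
    moreover have "cvec.dim (cvec.span B1 \<times> cvec.span B2) = card B1 + card B2"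
      using dim_Times[of B1 B2] B by blast
    ultimately show ?thesis
      using B B' unfolding ws B(3,6) span_prod_zero
      by (intro exI[of _ B]) (simp add: cvec.dim_span_eq_card_independent cvec.dim_eq_card_independent)
  qed
  then have fin: "\<exists>B. finite B \<and> cvec.independent B \<and> weight_space V (direct_sum M N) w = cvec.span B"
    and dim: "cvec.dim (weight_space V (direct_sum M N) w)
        = cvec.dim (weight_space V M w) + cvec.dim (weight_space V N w)" for w
    by blast+
  show ?thesis
    unfolding graded_char_def dim
  proof (intro conjI allI impI fin)
    fix y :: real assume "y > 0"
    then show "((\<lambda>w. of_nat (cvec.dim (weight_space V M w) + cvec.dim (weight_space V N w))
        * exp (complex_of_real (- (2 * pi * y)) * w)) has_sum complex_of_real (F y + G y)) UNIV"
      using assms has_sum_add unfolding graded_char_def of_nat_add of_real_add distrib_right by blast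
  qed
qed

lemma character_graded:
  assumes "graded_char V M F" "y > 0"
  shows "character V M (\<i> * of_real y) = exp (2 * pi * y * (central_charge V / 24)) * of_real (F y)"
proof -
  let ?c = "exp (2 * pi * y * (central_charge V / 24))"
  have *: "exp (2 * of_real pi * \<i> * (\<i> * of_real y) * (w - central_charge V / 24))
      = ?c * exp (complex_of_real (- (2 * pi * y)) * w)" for w :: complex
    unfolding exp_add[symmetric] by (rule arg_cong[of _ _ exp]) (simp add: algebra_simps)
  have "character V M (\<i> * of_real y)
      = (\<Sum>\<^sub>\<infinity>w. ?c * (of_nat (cvec.dim (weight_space V M w)) * exp (complex_of_real (- (2 * pi * y)) * w)))"
    unfolding character_def * by (intro infsum_cong) (simp add: algebra_simps)
  also have "\<dots> = ?c * of_real (F y)"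
    using assms unfolding graded_char_def infsum_cmult_right' by (simp add: infsumI)
  finally show ?thesis .
qed

lemma has_qdim_graded:
  assumes "graded_char V M F" "graded_char V (adjoint_module V) G"
    and "((\<lambda>y. F y / G y) \<longlongrightarrow> d) (at_right 0)"
  shows "has_qdim V M (complex_of_real d)"
proof -
  have "((\<lambda>y. complex_of_real (F y / G y)) \<longlongrightarrow> complex_of_real d) (at_right 0)"
    using assms(3) by (rule tendsto_of_real)
  moreover have "\<forall>\<^sub>F y in at_right 0. character V M (\<i> * of_real y) / character V (adjoint_module V) (\<i> * of_real y)
      = complex_of_real (F y / G y)"
    using eventually_at_right_less[of "0 :: real"]
    by eventually_elim (simp add: character_graded[OF assms(1)] character_graded[OF assms(2)])
  ultimately show ?thesis
    unfolding has_qdim_def by (simp add: tendsto_cong)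
qed

section \<open>The operator \<open>L(0)\<close> on Fock spaces\<close>

text \<open>The vacuum and the conformal vector have charge 0. Every \<open>b j\<close> in their
  vertex operators vanishes, and both exponentials become the identity.\<close>

lemma exp_coeff_trivial:
  assumes "\<And>j w. b (Suc j) w = 0"
  shows "exp_coeff b p v = (if p = 0 then v else 0)"
  by (cases p) (simp_all add: assms)

lemma exp_create_zero: "exp_create J N 0 p v = (if p = 0 then v else 0)"
  unfolding exp_create_def by (rule exp_coeff_trivial) simp

lemma exp_annih_zero: "exp_annih J N 0 p v = (if p = 0 then v else 0)"
  unfolding exp_annih_def by (rule exp_coeff_trivial) simp

lemma Sum_any_single:
  assumes "\<And>x. x \<noteq> a \<Longrightarrow> f x = 0"
  shows "Sum_any f = f a"
  using Sum_any.expand_superset[of "{a}" f] assms by auto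

lemma clinear_osc: "clinear (osc N j)"
  unfolding osc_def by (rule clinear_lin_ext)

lemma osc_zero [simp]: "osc N j 0 = 0"
  by (rule cpair.linear_0[OF clinear_osc])

lemma osc_scale [simp]: "osc N j (a *\<^sub>C v) = a *\<^sub>C osc N j v"
  by (rule cpair.linear_scale[OF clinear_osc])

lemma osc_basis_vec: "osc N j (basis_vec (A, x)) =
   (if j < 0 then basis_vec (add_mset (- j) A, x)
    else if j = 0 then of_real (N * x) *\<^sub>C basis_vec (A, x)
    else of_real (j * N * real (count A j)) *\<^sub>C basis_vec (A - {#j#}, x))"
  by (simp add: osc_def)

text \<open>Half the norm of the charge plus the total degree of the oscillators. The constant shift
  of the twisted sector is not included.\<close>

definition weight :: "real \<Rightarrow> fock_basis \<Rightarrow> real" where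
  "weight N b = N * (snd b)\<^sup>2 / 2 + sum_mset (fst b)"

definition omega_basis :: fock_basis where "omega_basis = ({#1, 1#}, 0)"
definition vac_basis :: fock_basis where "vac_basis = ({#}, 0)"

lemma sum_count_times:
  fixes A :: "real multiset"
  assumes "finite S" "set_mset A \<subseteq> S"
  shows "(\<Sum>j\<in>S. real (count A j) * j) = sum_mset A"
  using assms(2)
proof (induction A)
  case (add a A)
  have "(\<Sum>j\<in>S. real (count (add_mset a A) j) * j)
      = (\<Sum>j\<in>S. real (count A j) * j + (if j = a then a else 0))"
    by (rule sum.cong) (auto simp: algebra_simps)
  then show ?case using add assms(1) by (simp add: sum.distrib)
qed simp

text \<open>Both sectors are treated at once, with \<open>J\<close> either the integers or the
  half-integers. They differ in the group operator \<open>g\<close> and the exponent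
  \<open>ex\<close>, which are trivial at charge 0 in either case.\<close>

context
  fixes J :: "real set" and N :: real and g :: "real \<Rightarrow> fock \<Rightarrow> fock" and ex :: "real \<Rightarrow> real \<Rightarrow> real"
  assumes g0: "\<And>w. g 0 w = w" and ex0: "\<And>y. ex 0 y = 0"
begin

lemma exp_vertex_op_zero: "exp_vertex_op J N g ex 0 m w = (if m = -1 then w else 0)"
proof -
  have "exp_vertex_op J N g ex 0 m w = lin_ext (\<lambda>b. if m = -1 then basis_vec b else 0) w"
    unfolding exp_vertex_op_def g0 ex0 exp_create_zero exp_annih_zero
    by (rule arg_cong[where f = "\<lambda>f. lin_ext f w"])
      (auto simp: fun_eq_iff intro!: trans[OF Sum_any_single[of "(0, 0)"]] split: if_splits)
  then show ?thesis
    by (cases "m = -1") (simp_all add: lin_ext_basis_vec_id, simp add: lin_ext_def)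
qed

lemma normal_ordered_current:
  "normal_ordered J N g ex [1] 0 m w = (if m \<in> J then osc N m w else 0)"
  unfolding normal_ordered.simps exp_vertex_op_zero
  by (rule trans[OF Sum_any_single[of m]]) (auto simp: scaleC_one)

text \<open>For two currents the binomial coefficients are 1, and the mode is the sum over
  \<open>j\<close> of normal ordered products of the modes \<open>-|j|\<close> and
  \<open>|j|\<close>, each diagonal on monomials. The terms \<open>j\<close> and \<open>-j\<close>
  agree and \<open>j = 0\<close> gives \<open>N^2 x^2\<close>. The total is \<open>2 * N\<close>
  times the weight, which the factor \<open>1 / (2 * N)\<close> of the conformal vector
  compensates.\<close>

lemma normal_ordered_conformal:
  assumes J: "\<And>j. j \<in> J \<Longrightarrow> - j \<in> J" and A: "\<And>n. n \<in># A \<Longrightarrow> n \<in> J \<and> n > 0"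
    and x: "0 \<in> J \<or> x = 0"
  shows "normal_ordered J N g ex [1, 1] 0 1 (basis_vec (A, x))
    = of_real (2 * N * weight N (A, x)) *\<^sub>C basis_vec (A, x)"
proof -
  define h where "h j = (if j = 0 then N\<^sup>2 * x\<^sup>2 else \<bar>j\<bar> * N * real (count A \<bar>j\<bar>))" for j
  have disj: "set_mset A \<inter> uminus ` set_mset A = {}"
  proof -
    have False if "n \<in># A" "- n \<in># A" for n
      using A[OF that(1)] A[OF that(2)] by simp
    then show ?thesis by force
  qed
  have hneg: "h (- j) = h j" for j by (simp add: h_def)
  have tm: "(if j \<in> J then of_real ((- j - 1) gchoose (nat \<lfloor>1 :: real\<rfloor> - 1)) *\<^sub>C
      (if j < 0 then osc N j (normal_ordered J N g ex [1] 0 (1 - j - 1) (basis_vec (A, x)))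
        else normal_ordered J N g ex [1] 0 (1 - j - 1) (osc N j (basis_vec (A, x)))) else 0)
      = of_real (h j) *\<^sub>C basis_vec (A, x)" for j
  proof (cases "j \<in> J")
    case True
    then show ?thesis
      using J[of j] unfolding normal_ordered_current by (cases "\<bar>j\<bar> \<in># A")
        (auto simp: osc_basis_vec h_def scaleC_scaleC scaleC_one
          power2_eq_square insert_DiffM not_in_iff mult_ac cpair.linear_neg[OF clinear_osc])
  next
    \<comment> \<open>Modes outside \<open>J\<close> are absent from the sum. There \<open>h\<close>
      vanishes as well: the parts of \<open>A\<close> lie in \<open>J\<close>, and if 0 is missing
      from \<open>J\<close> then the charge is 0.\<close>
    case False
    then have "\<bar>j\<bar> \<notin># A" using A[of "\<bar>j\<bar>"] J[of "- j"] by (auto simp: abs_if split: if_splits)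
    then show ?thesis using False x by (auto simp: h_def not_in_iff)
  qed
  let ?S = "{0} \<union> (set_mset A \<union> uminus ` set_mset A)"
  have "normal_ordered J N g ex [1, 1] 0 1 (basis_vec (A, x))
      = Sum_any (\<lambda>j. of_real (h j) *\<^sub>C basis_vec (A, x))"
    using tm by (subst normal_ordered.simps) simp
  also have "\<dots> = (\<Sum>j\<in>?S. of_real (h j) *\<^sub>C basis_vec (A, x))"
  proof (rule Sum_any.expand_superset)
    show "{j. complex_of_real (h j) *\<^sub>C basis_vec (A, x) \<noteq> 0} \<subseteq> ?S"
    proof
      fix j assume "j \<in> {j. complex_of_real (h j) *\<^sub>C basis_vec (A, x) \<noteq> 0}"
      then have "j = 0 \<or> \<bar>j\<bar> \<in># A" by (auto simp: h_def not_in_iff split: if_splits)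
      moreover have "j \<in> uminus ` set_mset A" if "- j \<in># A" using that by (rule rev_image_eqI) simp
      ultimately show "j \<in> ?S" by (auto simp: abs_if split: if_splits)
    qed
  qed auto
  also have "\<dots> = of_real (\<Sum>j\<in>?S. h j) *\<^sub>C basis_vec (A, x)"
    by (simp add: cvec.scale_sum_left)
  also have "(\<Sum>j\<in>?S. h j) = (\<Sum>j\<in>{0}. h j) + (\<Sum>j\<in>set_mset A \<union> uminus ` set_mset A. h j)"
    by (rule sum.union_disjoint) (use A in force)+
  also have "(\<Sum>j\<in>set_mset A \<union> uminus ` set_mset A. h j)
      = (\<Sum>j\<in>set_mset A. h j) + (\<Sum>j\<in>uminus ` set_mset A. h j)"
    by (rule sum.union_disjoint) (use disj in auto)
  also have "(\<Sum>j\<in>uminus ` set_mset A. h j) = (\<Sum>j\<in>set_mset A. h j)"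
    by (subst sum.reindex) (simp_all add: inj_on_def hneg)
  also have "(\<Sum>j\<in>set_mset A. h j) = N * (\<Sum>j\<in>set_mset A. real (count A j) * j)"
    unfolding sum_distrib_left by (rule sum.cong) (use A in \<open>force simp: h_def\<close>)+
  also have "(\<Sum>j\<in>set_mset A. real (count A j) * j) = sum_mset A"
    by (rule sum_count_times) simp_all
  finally show ?thesis
    by (simp add: h_def weight_def algebra_simps power2_eq_square)
qed

end

section \<open>Vacuum and conformal vector in the untwisted sector\<close>

lemma lattice_mode_vac: "lattice_mode N (basis_vec vac_basis) i w = (if i = -1 then w else 0)"
  unfolding lattice_mode_def vac_basis_def
  by (subst lin_ext_basis_vec) (auto simp: exp_vertex_op_zero lin_ext_basis_vec_id split_def)

lemma lattice_mode_om:
  assumes "\<And>n. n \<in># A \<Longrightarrow> n \<in> \<int> \<and> n > 0"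
  shows "lattice_mode N (basis_vec omega_basis) 1 (basis_vec (A, x))
    = of_real (2 * N * weight N (A, x)) *\<^sub>C basis_vec (A, x)"
proof -
  have "lattice_mode N (basis_vec omega_basis) 1 (basis_vec (A, x)) = normal_ordered \<int> N
     (\<lambda>x. lin_ext (\<lambda>(B, y). basis_vec (B, x + y))) (\<lambda>x y. N * x * y) [1, 1] 0 1 (basis_vec (A, x))"
    unfolding lattice_mode_def omega_basis_def by (subst lin_ext_basis_vec) simp
  also have "\<dots> = of_real (2 * N * weight N (A, x)) *\<^sub>C basis_vec (A, x)"
    by (rule normal_ordered_conformal) (use assms in \<open>auto simp: lin_ext_basis_vec_id split_def\<close>)
  finally show ?thesis .
qed

section \<open>The correction exp(Delta) and the twisted sector\<close>

lemma flm_delta_vac: "flm_delta N r (basis_vec vac_basis) = 0"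
  by (simp add: flm_delta_def vac_basis_def osc_basis_vec if_distrib[of "osc _ _"] cong: if_cong)

lemma flm_delta_zero: "flm_delta N r 0 = 0"
  by (simp add: flm_delta_def)

text \<open>The two operators must contract with the two factors of mode -1 in the conformal vector,
  so both have mode 1; mode 0 gives 0 because the charge is 0. The contractions produce
  \<open>2 * N^2\<close>, of which one \<open>N\<close> is divided out in
  \<open>flm_delta\<close>.\<close>

lemma flm_delta_om:
  assumes "N \<noteq> 0"
  shows "flm_delta N r (basis_vec omega_basis) =
    (if r = 2 then of_real (2 * N * flm_coeff 1 1) *\<^sub>C basis_vec vac_basis else 0)"
proof -
  have 1: "osc N (real n) (basis_vec omega_basis) =
      (if n = 1 then of_real (2 * N) *\<^sub>C basis_vec ({#1#}, 0) else 0)" for n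
    by (auto simp: omega_basis_def osc_basis_vec mult_ac)
  have 2: "osc N (real m) (basis_vec ({#1#}, 0)) =
      (if m = 1 then of_real N *\<^sub>C basis_vec vac_basis else 0)" for m
    by (auto simp: vac_basis_def osc_basis_vec)
  have "flm_delta N r (basis_vec omega_basis) = (\<Sum>m\<le>r. if m = 1
      then (if r = 2 then of_real (2 * N * flm_coeff 1 1) *\<^sub>C basis_vec vac_basis else 0) else 0)"
    unfolding flm_delta_def
  proof (rule sum.cong)
    fix m assume "m \<in> {..r}"
    then have "r - m = 1 \<and> m = 1 \<longleftrightarrow> m = 1 \<and> r = 2" by auto
    then show "of_real (flm_coeff m (r - m) / N) *\<^sub>C
        osc N (real m) (osc N (real (r - m)) (basis_vec omega_basis)) = (if m = 1
      then (if r = 2 then of_real (2 * N * flm_coeff 1 1) *\<^sub>C basis_vec vac_basis else 0) else 0)"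
      unfolding 1 using assms 2[of 1, simplified] by (auto simp: 2 scaleC_scaleC mult_ac)
  qed simp
  also have "\<dots> = (if r = 2 then of_real (2 * N * flm_coeff 1 1) *\<^sub>C basis_vec vac_basis else 0)"
    by (simp add: sum.delta')
  finally show ?thesis .
qed

text \<open>Delta removes two oscillators, and the conformal vector has only two. Hence the
  exponential series stops after its linear term.\<close>

lemma exp_coeff_flm_om:
  assumes "N \<noteq> 0"
  shows "exp_coeff (flm_delta N) r (basis_vec omega_basis) =
    (if r = 0 then basis_vec omega_basis
     else if r = 2 then of_real (2 * N * flm_coeff 1 1) *\<^sub>C basis_vec vac_basis else 0)"
proof (induction r rule: less_induct)
  case (less r)
  have d: "flm_delta N j (a *\<^sub>C v) = a *\<^sub>C flm_delta N j v" for j a v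
    by (simp add: flm_delta_def cvec.scale_sum_right scaleC_scaleC mult.commute)
  show ?case
  proof (cases r)
    case (Suc m)
    have "exp_coeff (flm_delta N) r (basis_vec omega_basis) = (1 / of_nat (Suc m)) *\<^sub>C
     (\<Sum>j\<le>m. of_nat (Suc j) *\<^sub>C flm_delta N (Suc j) (exp_coeff (flm_delta N) (m - j) (basis_vec omega_basis)))"
      by (simp add: Suc)
    \<comment> \<open>Only \<open>j = m\<close> contributes, where the inner coefficient is the
      conformal vector itself. At index 2 the inner coefficient is a multiple of the vacuum, which
      \<open>flm_delta\<close> kills.\<close>
    also have "(\<Sum>j\<le>m. of_nat (Suc j) *\<^sub>C flm_delta N (Suc j) (exp_coeff (flm_delta N) (m - j) (basis_vec omega_basis)))
       = (\<Sum>j\<le>m. if j = m then of_nat (Suc m) *\<^sub>C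
           (if r = 2 then of_real (2 * N * flm_coeff 1 1) *\<^sub>C basis_vec vac_basis else 0) else 0)"
    proof (rule sum.cong)
      fix j assume "j \<in> {..m}"
      then have "exp_coeff (flm_delta N) (m - j) (basis_vec omega_basis) = (if m - j = 0 then basis_vec omega_basis
     else if m - j = 2 then of_real (2 * N * flm_coeff 1 1) *\<^sub>C basis_vec vac_basis else 0)"
        by (intro less) (auto simp: Suc)
      then show "of_nat (Suc j) *\<^sub>C flm_delta N (Suc j) (exp_coeff (flm_delta N) (m - j) (basis_vec omega_basis))
        = (if j = m then of_nat (Suc m) *\<^sub>C
           (if r = 2 then of_real (2 * N * flm_coeff 1 1) *\<^sub>C basis_vec vac_basis else 0) else 0)"
        using \<open>j \<in> {..m}\<close>
        by (auto simp: flm_delta_om[OF assms] d flm_delta_vac flm_delta_zero Suc)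
    qed simp
    finally show ?thesis
      by (simp add: scaleC_scaleC scaleC_one Suc del: of_nat_Suc)
  qed simp
qed

lemma twisted_group_zero: "twisted_group N s 0 w = w"
  by (simp add: twisted_group_def scaleC_one)

lemma twisted_mode_vac: "twisted_mode N s (basis_vec vac_basis) i w = (if i = -1 then w else 0)"
proof -
  have "exp_coeff (flm_delta N) r (basis_vec vac_basis) = (if r = 0 then basis_vec vac_basis else 0)" for r
    by (induction r rule: less_induct, case_tac x) (auto simp: flm_delta_vac flm_delta_zero if_distrib[of "flm_delta _ _"] cong: if_cong)
  then show ?thesis
    unfolding twisted_mode_def
    by (subst Sum_any_single[of 0]) (auto simp: vac_basis_def exp_vertex_op_zero twisted_group_zero)
qed

lemma half_integers_uminus: "j \<in> half_integers \<Longrightarrow> - j \<in> half_integers"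
proof -
  assume "j \<in> half_integers"
  then have "j - 1 / 2 \<in> \<int>" unfolding half_integers_def by blast
  then have "- (j - 1 / 2) - 1 \<in> \<int>" by (rule Ints_diff[OF Ints_minus Ints_1])
  moreover have "- (j - 1 / 2) - 1 = - j - 1 / 2" by simp
  ultimately show ?thesis unfolding half_integers_def by (metis mem_Collect_eq)
qed

text \<open>The value of \<^term>\<open>flm_coeff 1 1\<close>, the lowest weight of the twisted module, never matters: its factor
  in the character tends to \<open>1\<close>.\<close>

lemma twisted_mode_om:
  assumes N: "N \<noteq> 0" and A: "\<And>n. n \<in># A \<Longrightarrow> n \<in> half_integers \<and> n > 0"
  shows "twisted_mode N s (basis_vec omega_basis) 1 (basis_vec (A, 0))
    = of_real (2 * N * (weight N (A, 0) + flm_coeff 1 1)) *\<^sub>C basis_vec (A, 0)"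
proof -
  let ?G = "\<lambda>r. lin_ext (\<lambda>(B, x). normal_ordered half_integers N (twisted_group N s)
       (\<lambda>x y. - (N * x\<^sup>2 / 2)) (sorted_list_of_multiset B) x (of_int 1 - real r) (basis_vec (A, 0)))
     (exp_coeff (flm_delta N) r (basis_vec omega_basis))"
  have "twisted_mode N s (basis_vec omega_basis) 1 (basis_vec (A, 0)) = Sum_any ?G"
    by (simp add: twisted_mode_def)
  \<comment> \<open>The term \<open>r = 0\<close> is the normal ordered zero mode; the term
    \<open>r = 2\<close> comes from a multiple of the vacuum and shifts all weights by the same
    constant.\<close>
  also have "\<dots> = (\<Sum>r\<in>{0, 2}. ?G r)"
    by (rule Sum_any.expand_superset) (auto simp: exp_coeff_flm_om[OF N])
  also have "\<dots> = ?G 0 + ?G 2" by simp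
  also have "?G 2 = of_real (2 * N * flm_coeff 1 1) *\<^sub>C basis_vec (A, 0)"
    by (simp add: exp_coeff_flm_om[OF N] vac_basis_def exp_vertex_op_zero twisted_group_zero)
  also have "?G 0 = normal_ordered half_integers N (twisted_group N s)
       (\<lambda>x y. - (N * x\<^sup>2 / 2)) [1, 1] 0 1 (basis_vec (A, 0))"
    by (simp add: omega_basis_def)
  also have "\<dots> = of_real (2 * N * weight N (A, 0)) *\<^sub>C basis_vec (A, 0)"
    by (rule normal_ordered_conformal) (use A half_integers_uminus in \<open>auto simp: twisted_group_zero\<close>)
  finally show ?thesis
    by (simp add: scaleC_add_left[symmetric] distrib_left)
qed

text \<open>The common shape of the two conformal vectors to be compared: \<open>N = 2k\<close> for
  \<open>\<U>\<close> and \<open>N = 4k\<close> for its subalgebra.\<close>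

definition conf2 :: "real \<Rightarrow> fock2" where
  "conf2 N = of_real (1 / (2 * N)) *\<^sub>C (basis_vec (omega_basis, vac_basis) + basis_vec (vac_basis, omega_basis))"

lemma clinear_tensor_mode: "clinear (tensor_mode f g t n)"
  unfolding tensor_mode_def lin_ext_def[of _ t] split_def
  by (intro clinear_sum2 clinear_scale2 clinear_lin_ext)

text \<open>At \<open>n = 1\<close> the mode indices in the two factors add up to 0. The vacuum acts
  only through mode -1, which forces mode 1 on the other factor. The result is \<open>L(0)\<close>
  on the left factor plus \<open>L(0)\<close> on the right one.\<close>

lemma tensor_mode_conf2:
  assumes N: "N \<noteq> 0"
    and f: "\<And>i w. f (basis_vec vac_basis) i w = (if i = -1 then w else 0)"
      "f (basis_vec omega_basis) 1 (basis_vec c) = of_real (2 * N * r) *\<^sub>C basis_vec c"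
    and g: "\<And>i w. g (basis_vec vac_basis) i w = (if i = -1 then w else 0)"
      "g (basis_vec omega_basis) 1 (basis_vec d) = of_real (2 * N * s) *\<^sub>C basis_vec d"
  shows "tensor_mode f g (conf2 N) 1 (basis_vec (c, d)) = of_real (r + s) *\<^sub>C basis_vec (c, d)"
proof -
  have "tensor_mode f g (basis_vec (omega_basis, vac_basis)) 1 (basis_vec (c, d)) = of_real (2 * N * r) *\<^sub>C basis_vec (c, d)"
    unfolding tensor_mode_def lin_ext_basis_vec prod.case
    by (rule trans[OF Sum_any_single[of 1]]) (auto simp: f g tensor_scale_left)
  moreover have "tensor_mode f g (basis_vec (vac_basis, omega_basis)) 1 (basis_vec (c, d)) = of_real (2 * N * s) *\<^sub>C basis_vec (c, d)"
    unfolding tensor_mode_def lin_ext_basis_vec prod.case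
    by (rule trans[OF Sum_any_single[of "-1"]]) (auto simp: f g tensor_scale_right)
  moreover have "tensor_mode f g (conf2 N) 1 (basis_vec (c, d)) = of_real (1 / (2 * N)) *\<^sub>C
      (tensor_mode f g (basis_vec (omega_basis, vac_basis)) 1 (basis_vec (c, d))
        + tensor_mode f g (basis_vec (vac_basis, omega_basis)) 1 (basis_vec (c, d)))"
    by (simp only: conf2_def tensor_mode_def lin_ext_scale lin_ext_add)
  ultimately show ?thesis
    using N by (simp add: scaleC_add_left[symmetric] scaleC_scaleC add_divide_distrib)
qed

lemma conformal_tensor_lattice:
  "conformal (tensor_voa (lattice_voa N) (lattice_voa N)) = conf2 N"
  by (simp add: tensor_voa_def lattice_voa_def conf2_def tensor_scale_left tensor_scale_right
      scaleC_add_right omega_basis_def vac_basis_def)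

lemma conformal_perm_orbifold: "conformal (perm_orbifold k) = conf2 (2 * real k)"
  using conformal_tensor_lattice[of "2 * real k"] by (simp add: perm_orbifold_def fixed_voa_def)

lemma conformal_beta_sub: "conformal (beta_sub k) = conf2 (4 * real k)"
  using conformal_tensor_lattice[of "4 * real k"]
  by (simp add: beta_sub_def beta_plus_def fixed_voa_def tensor_voa_def)

section \<open>Asymptotics of partition functions and theta series\<close>

lemma has_sum_product_nonneg:
  fixes f :: "'a \<Rightarrow> real" and g :: "'b \<Rightarrow> real"
  assumes f: "(f has_sum s) A" and g: "(g has_sum t) B"
    and "\<And>a. a \<in> A \<Longrightarrow> f a \<ge> 0" "\<And>b. b \<in> B \<Longrightarrow> g b \<ge> 0"
  shows "((\<lambda>(a, b). f a * g b) has_sum s * t) (A \<times> B)"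
proof (rule has_sum_SigmaI)
  show 1: "((\<lambda>b. (\<lambda>(a, b). f a * g b) (a, b)) has_sum f a * t) B" for a
    using has_sum_cmult_right[OF g] by simp
  show 2: "((\<lambda>a. f a * t) has_sum s * t) A"
    using has_sum_cmult_left[OF f] .
  show "(\<lambda>(a, b). f a * g b) summable_on A \<times> B"
    by (rule summable_on_SigmaI[OF 1 has_sum_imp_summable[OF 2]]) (use assms in auto)
qed

text \<open>Every finite subset of the union lies in some \<open>X n\<close>, so for nonnegative
  terms the sum over the union is the supremum of the sums over the \<open>X n\<close>.\<close>

lemma has_sum_incseq_Union:
  fixes f :: "'a \<Rightarrow> real"
  assumes sum: "\<And>n. (f has_sum c n) (X n)" and mono: "incseq X" and lim: "c \<longlonglongrightarrow> S"
    and nonneg: "\<And>x. x \<in> (\<Union>n. X n) \<Longrightarrow> f x \<ge> 0"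
  shows "(f has_sum S) (\<Union>n. X n)"
proof -
  have inc: "incseq c"
  proof (rule incseq_SucI)
    show "c n \<le> c (Suc n)" for n
      by (rule has_sum_mono2[OF sum sum]) (use mono nonneg in \<open>auto simp: incseq_Suc_iff\<close>)
  qed
  have fin: "sum f F \<le> S" if F: "finite F" "F \<subseteq> (\<Union>n. X n)" for F
  proof -
    have "\<exists>n. F \<subseteq> X n"
      using F
    proof (induction F)
      case (insert x F)
      then obtain n m where "F \<subseteq> X n" "x \<in> X m" by auto
      then have "insert x F \<subseteq> X (max n m)"
        using incseqD[OF mono, of n "max n m"] incseqD[OF mono, of m "max n m"] by auto
      then show ?case ..
    qed auto
    then obtain n where n: "F \<subseteq> X n" ..
    have "sum f F \<le> c n"
      using has_sum_mono2[OF has_sum_finite[OF F(1)] sum n] nonneg by blast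
    also have "c n \<le> S" by (rule incseq_le[OF inc lim])
    finally show ?thesis .
  qed
  have summ: "f summable_on (\<Union>n. X n)"
    by (rule nonneg_bdd_above_summable_on) (use nonneg fin in \<open>auto intro!: bdd_aboveI\<close>)
  have "infsum f (\<Union>n. X n) \<le> S"
    by (rule infsum_le_finite_sums[OF summ]) (use fin in auto)
  moreover have "S \<le> infsum f (\<Union>n. X n)"
    by (rule LIMSEQ_le_const2[OF lim])
      (use has_sum_mono2[OF sum has_sum_infsum[OF summ]] nonneg in blast)
  ultimately have "infsum f (\<Union>n. X n) = S" by (rule antisym)
  then show ?thesis
    using has_sum_infsum[OF summ] by blast
qed

text \<open>A multiset amounts to its multiplicity at \<open>p n\<close> together with the remaining
  parts. Summing over the multiplicity gives a geometric series, that is, one more Euler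
  factor.\<close>

lemma has_sum_multisets_finite_parts:
  fixes p :: "nat \<Rightarrow> real"
  assumes p: "inj p" "\<And>i. p i > 0" and t: "t > 0"
  shows "((\<lambda>A. exp (- t * sum_mset A)) has_sum (\<Prod>i<n. 1 / (1 - exp (- t * p i))))
    {A. set_mset A \<subseteq> p ` {..<n}}"
proof (induction n)
  case 0
  have "{A :: real multiset. set_mset A \<subseteq> p ` {..<0}} = {{#}}" by auto
  then show ?case using has_sum_finite[of "{{#}}" "\<lambda>A. exp (- t * sum_mset A)"] by simp
next
  case (Suc n)
  let ?q = "exp (- t * p n)"
  have q: "0 < ?q" "?q < 1" using p t by simp_all
  have "(\<lambda>k. ?q ^ k) sums (1 / (1 - ?q))"
    using q by (intro geometric_sums) simp
  then have geo: "((\<lambda>k. ?q ^ k) has_sum (1 / (1 - ?q))) UNIV"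
    by (rule sums_nonneg_imp_has_sum) (use q in simp)
  have "((\<lambda>(k, A). ?q ^ k * exp (- t * sum_mset A)) has_sum
      (1 / (1 - ?q)) * (\<Prod>i<n. 1 / (1 - exp (- t * p i)))) (UNIV \<times> {A. set_mset A \<subseteq> p ` {..<n}})"
    by (rule has_sum_product_nonneg[OF geo Suc]) (use q in auto)
  also have "?this \<longleftrightarrow> ((\<lambda>A. exp (- t * sum_mset A)) has_sum (\<Prod>i<Suc n. 1 / (1 - exp (- t * p i))))
      {A. set_mset A \<subseteq> p ` {..<Suc n}}"
  proof (rule has_sum_reindex_bij_witness[where j = "\<lambda>(k, A). A + replicate_mset k (p n)"
        and i = "\<lambda>A. (count A (p n), filter_mset (\<lambda>x. x \<noteq> p n) A)"], goal_cases)
    have pn: "p n \<notin> p ` {..<n}" using p(1) by (auto dest: injD)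
    {
      case (1 a)
      then obtain k A where a: "a = (k, A)" "set_mset A \<subseteq> p ` {..<n}" by auto
      then have "p n \<notin># A" using pn by auto
      then have "count A (p n) = 0" "filter_mset (\<lambda>x. x \<noteq> p n) A = A"
        by (auto simp: count_eq_zero_iff filter_mset_eq_conv)
      moreover have "filter_mset (\<lambda>x. x \<noteq> p n) (replicate_mset k (p n)) = {#}"
        by (rule multiset_eqI) auto
      ultimately show ?case using a by simp
    next
      case (2 a)
      then show ?case by (auto simp: lessThan_Suc split: if_splits)
    next
      case (3 A)
      show ?case
        by (rule multiset_eqI) auto
    next
      case (4 A)
      then show ?case by (auto simp: lessThan_Suc)
    next
      case (5 a)
      then show ?case
        by (cases a) (simp add: exp_add[symmetric] exp_of_nat_mult[symmetric] algebra_simps)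
    next
      case 6
      then show ?case by simp
    }
  qed
  finally show ?case .
qed

text \<open>The growth condition fits both sequences of modes, \<open>i + 1\<close> and
  \<open>i + 1/2\<close>. With \<open>u = exp (- t / 2)\<close> it bounds the i-th Euler factor by
  \<open>exp (u^i / (1 - u))\<close>, so the increasing partial products stay below the exponential
  of a geometric series. Sum and product are delivered together: the sum counts monomials, the
  product gives access to \<open>Q/P\<close>.\<close>

lemma has_sum_multisets:
  fixes p :: "nat \<Rightarrow> real"
  assumes p: "inj p" "\<And>i. p i \<ge> (real i + 1) / 2" and t: "t > 0"
  obtains S where "S \<ge> 1" "((\<lambda>A. exp (- t * sum_mset A)) has_sum S) {A. set_mset A \<subseteq> range p}"
    "(\<lambda>n. \<Prod>i<n. 1 / (1 - exp (- t * p i))) \<longlonglongrightarrow> S"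
proof -
  let ?c = "\<lambda>n. \<Prod>i<n. 1 / (1 - exp (- t * p i))"
  let ?u = "exp (- t / 2)"
  have p0: "p i > 0" for i using p(2)[of i] by simp
  have u: "0 < ?u" "?u < 1" using t by simp_all
  have q: "exp (- t * p i) \<le> ?u ^ Suc i" for i
  proof -
    have "t * ((real i + 1) / 2) \<le> t * p i" using p(2) t by (intro mult_left_mono) auto
    then show ?thesis unfolding exp_of_nat_mult[symmetric] by (simp add: algebra_simps)
  qed
  have q1: "exp (- t * p i) < 1" for i using p0 t by simp
  have fac: "1 \<le> 1 / (1 - exp (- t * p i))" "1 / (1 - exp (- t * p i)) \<le> exp (?u ^ i * (1 / (1 - ?u)))" for i
  proof -
    let ?x = "exp (- t * p i)"
    show "1 \<le> 1 / (1 - ?x)" using q1[of i] by (simp add: field_simps)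
    have "?u ^ Suc i \<le> ?u" using u power_decreasing[of 1 "Suc i" ?u] by simp
    then have "?x \<le> ?u" using q[of i] by linarith
    moreover have "?x \<le> ?u ^ i" using q[of i] u power_decreasing[of i "Suc i" ?u] by linarith
    ultimately have "?x * (1 / (1 - ?x)) \<le> ?u ^ i * (1 / (1 - ?u))"
      using u q1[of i] by (intro mult_mono divide_left_mono) auto
    moreover have "1 / (1 - x) = 1 + x * (1 / (1 - x))" if "x < 1" for x :: real
      using that by (simp add: field_simps)
    note this[OF q1[of i]]
    ultimately show "1 / (1 - ?x) \<le> exp (?u ^ i * (1 / (1 - ?u)))"
      using exp_ge_add_one_self[of "?u ^ i * (1 / (1 - ?u))"] by linarith
  qed
  have inc: "incseq ?c"
  proof (rule incseq_SucI)
    show "?c n \<le> ?c (Suc n)" for n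
      using mult_left_mono[OF fac(1)[of n], of "?c n"] q1
      by (simp add: prod_nonneg less_imp_le)
  qed
  have bound: "?c n \<le> exp (1 / (1 - ?u) * (1 / (1 - ?u)))" for n
  proof -
    have "?c n \<le> (\<Prod>i<n. exp (?u ^ i * (1 / (1 - ?u))))"
      using q1 by (intro prod_mono conjI fac) (simp add: less_imp_le)
    also have "\<dots> = exp ((\<Sum>i<n. ?u ^ i) * (1 / (1 - ?u)))"
      unfolding sum_distrib_right by (simp add: exp_sum)
    also have "(\<Sum>i<n. ?u ^ i) \<le> 1 / (1 - ?u)"
      using u sum_le_suminf[of "\<lambda>i. ?u ^ i" "{..<n}"] by (simp add: suminf_geometric summable_geometric)
    finally show ?thesis using u by (simp add: mult_right_mono divide_right_mono)
  qed
  obtain S where S: "?c \<longlonglongrightarrow> S" "\<And>n. ?c n \<le> S"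
    using incseq_convergent[OF inc] bound by blast
  have "((\<lambda>A. exp (- t * sum_mset A)) has_sum S) (\<Union>n. {A. set_mset A \<subseteq> p ` {..<n}})"
  proof (rule has_sum_incseq_Union[OF has_sum_multisets_finite_parts[OF p(1) p0 t] _ S(1)])
    show "incseq (\<lambda>n. {A. set_mset A \<subseteq> p ` {..<n}})"
      by (rule incseq_SucI) auto
  qed simp
  also have "(\<Union>n. {A. set_mset A \<subseteq> p ` {..<n}}) = {A. set_mset A \<subseteq> range p}"
  proof (intro equalityI subsetI)
    fix A assume "A \<in> {A. set_mset A \<subseteq> range p}"
    then obtain F where F: "finite F" "set_mset A = p ` F"
      using finite_subset_image[of "set_mset A" p UNIV] by auto
    then obtain n where "F \<subseteq> {..<n}" using finite_nat_iff_bounded by blast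
    then show "A \<in> (\<Union>n. {A. set_mset A \<subseteq> p ` {..<n}})" using F by auto
  qed auto
  finally show ?thesis using that S(1) S(2)[of 0] by simp
qed

lemma positive_Ints_range: "{n :: real. n \<in> \<int> \<and> n > 0} = range (\<lambda>i. real i + 1)"
proof (intro equalityI subsetI)
  fix n :: real assume "n \<in> {n. n \<in> \<int> \<and> n > 0}"
  then obtain m where "n = of_int m" "m > 0" by (auto elim: Ints_cases)
  then have "n = real (nat (m - 1)) + 1" by simp
  then show "n \<in> range (\<lambda>i. real i + 1)" by blast
qed auto

lemma positive_half_integers_range: "{n. n \<in> half_integers \<and> n > 0} = range (\<lambda>i. real i + 1 / 2)"
proof (intro equalityI subsetI)
  fix n :: real assume n: "n \<in> {n. n \<in> half_integers \<and> n > 0}"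
  then have "n - 1 / 2 \<in> \<int>" unfolding half_integers_def by blast
  then obtain m where m: "n - 1 / 2 = of_int m" by (auto elim: Ints_cases)
  with n have "m \<ge> 0" by auto
  then have "n = real (nat m) + 1 / 2" using m by simp
  then show "n \<in> range (\<lambda>i. real i + 1 / 2)" by blast
qed (auto simp: half_integers_def)

definition parts :: "real set \<Rightarrow> real multiset set" where
  "parts J = {A. \<forall>n\<in>#A. n \<in> J \<and> n > 0}"

text \<open>The generating functions \<open>P\<close> (for \<open>J = \<int>\<close>) and
  \<open>Q\<close> (for \<open>J = half_integers\<close>).\<close>

definition part_sum :: "real set \<Rightarrow> real \<Rightarrow> real" where
  "part_sum J y = (\<Sum>\<^sub>\<infinity>A\<in>parts J. exp (- (2 * pi * y) * sum_mset A))"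

lemma part_sum_Ints:
  assumes "y > 0"
  shows "(\<lambda>A. exp (- (2 * pi * y) * sum_mset A)) summable_on parts \<int>" "part_sum \<int> y \<ge> 1"
    "(\<lambda>n. \<Prod>i<n. 1 / (1 - exp (- (2 * pi * y) * (real i + 1)))) \<longlonglongrightarrow> part_sum \<int> y"
proof -
  have "parts \<int> = {A. set_mset A \<subseteq> range (\<lambda>i. real i + 1)}"
    unfolding positive_Ints_range[symmetric] parts_def by auto
  moreover obtain S where "S \<ge> 1" "((\<lambda>A. exp (- (2 * pi * y) * sum_mset A)) has_sum S)
      {A. set_mset A \<subseteq> range (\<lambda>i. real i + 1)}"
    "(\<lambda>n. \<Prod>i<n. 1 / (1 - exp (- (2 * pi * y) * (real i + 1)))) \<longlonglongrightarrow> S"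
    by (rule has_sum_multisets[of "\<lambda>i. real i + 1" "2 * pi * y"]) (use assms in \<open>auto simp: inj_on_def\<close>)
  ultimately show "(\<lambda>A. exp (- (2 * pi * y) * sum_mset A)) summable_on parts \<int>" "part_sum \<int> y \<ge> 1"
    "(\<lambda>n. \<Prod>i<n. 1 / (1 - exp (- (2 * pi * y) * (real i + 1)))) \<longlonglongrightarrow> part_sum \<int> y"
    unfolding part_sum_def by (auto simp: infsumI has_sum_imp_summable)
qed

lemma part_sum_half_integers:
  assumes "y > 0"
  shows "(\<lambda>A. exp (- (2 * pi * y) * sum_mset A)) summable_on parts half_integers"
    "part_sum half_integers y \<ge> 1"
    "(\<lambda>n. \<Prod>i<n. 1 / (1 - exp (- (2 * pi * y) * (real i + 1 / 2)))) \<longlonglongrightarrow> part_sum half_integers y"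
proof -
  have "parts half_integers = {A. set_mset A \<subseteq> range (\<lambda>i. real i + 1 / 2)}"
    unfolding positive_half_integers_range[symmetric] parts_def by auto
  moreover obtain S where "S \<ge> 1" "((\<lambda>A. exp (- (2 * pi * y) * sum_mset A)) has_sum S)
      {A. set_mset A \<subseteq> range (\<lambda>i. real i + 1 / 2)}"
    "(\<lambda>n. \<Prod>i<n. 1 / (1 - exp (- (2 * pi * y) * (real i + 1 / 2)))) \<longlonglongrightarrow> S"
    by (rule has_sum_multisets[of "\<lambda>i. real i + 1 / 2" "2 * pi * y"]) (use assms in \<open>auto simp: inj_on_def\<close>)
  ultimately show "(\<lambda>A. exp (- (2 * pi * y) * sum_mset A)) summable_on parts half_integers"
    "part_sum half_integers y \<ge> 1"
    "(\<lambda>n. \<Prod>i<n. 1 / (1 - exp (- (2 * pi * y) * (real i + 1 / 2)))) \<longlonglongrightarrow> part_sum half_integers y"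
    unfolding part_sum_def by (auto simp: infsumI has_sum_imp_summable)
qed

text \<open>Adding a part \<open>1/2\<close> switches the parity of the number of parts at the cost of a factor tending
  to \<open>1\<close>, so both parities carry asymptotically half of the sum.\<close>

lemma part_sum_parity:
  assumes e: "e \<in> {1, -1 :: complex}"
  shows "((\<lambda>y. (\<Sum>\<^sub>\<infinity>A\<in>{A \<in> parts half_integers. (-1) ^ size A = e}. exp (- (2 * pi * y) * sum_mset A))
     / part_sum half_integers y) \<longlongrightarrow> 1 / 2) (at_right 0)"
proof -
  define X where "X e = {A \<in> parts half_integers. (-1) ^ size A = (e :: complex)}" for e
  define f where "f y A = exp (- (2 * pi * y) * sum_mset A)" for y :: real and A :: "real multiset"
  have 12: "n \<in> half_integers" if "n * 2 = 1" for n
  proof -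
    have n: "n = 1 / 2" using that by simp
    show ?thesis unfolding n half_integers_def by simp
  qed
  have bounds: "exp (- (pi * y)) / (1 + exp (- (pi * y))) \<le> infsum (f y) (X e) / part_sum half_integers y
      \<and> infsum (f y) (X e) / part_sum half_integers y \<le> 1 / (1 + exp (- (pi * y)))"
    if y: "y > 0" for y
  proof -
    let ?u = "exp (- (pi * y))" and ?Q = "part_sum half_integers y"
    have summ: "f y summable_on Y" if "Y \<subseteq> parts half_integers" for Y
      unfolding f_def by (rule summable_on_subset_banach[OF part_sum_half_integers(1)[OF y] that])
    \<comment> \<open>With \<open>S\<close> and \<open>T\<close> the sums over the two parities,
      this is used in both directions: \<open>?u * S \<le> T\<close> and
      \<open>?u * T \<le> S\<close>. Together with \<open>S + T = ?Q\<close> it confines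
      \<open>S / ?Q\<close> between \<open>?u / (1 + ?u)\<close> and
      \<open>1 / (1 + ?u)\<close>.\<close>
    have toggle: "?u * infsum (f y) (X d) \<le> infsum (f y) (X (- d))" for d
    proof -
      have "?u * infsum (f y) (X d) = infsum (f y \<circ> add_mset (1 / 2)) (X d)"
        unfolding infsum_cmult_right'[symmetric]
        by (rule infsum_cong) (simp add: f_def exp_add[symmetric] algebra_simps)
      also have "\<dots> = infsum (f y) (add_mset (1 / 2) ` X d)"
        by (rule infsum_reindex[symmetric]) (simp add: inj_on_def)
      also have "\<dots> \<le> infsum (f y) (X (- d))"
        by (rule infsum_mono2) (use 12 in \<open>auto intro!: summ simp: X_def parts_def f_def\<close>)
      finally show ?thesis .
    qed
    have "(-1) ^ size A = e \<or> (-1) ^ size A = - e" for A :: "real multiset"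
      using e by (cases "even (size A)") auto
    then have "parts half_integers = X e \<union> X (- e)" by (auto simp: X_def)
    then have "?Q = infsum (f y) (X e \<union> X (- e))" unfolding part_sum_def f_def by (rule arg_cong)
    also have "\<dots> = infsum (f y) (X e) + infsum (f y) (X (- e))"
      by (rule infsum_Un_disjoint) (use e in \<open>auto intro!: summ simp: X_def\<close>)
    finally have Q: "?Q = infsum (f y) (X e) + infsum (f y) (X (- e))" .
    have "?Q > 0" using part_sum_half_integers(2)[OF y] by linarith
    then show ?thesis
      using Q toggle[of e] toggle[of "- e"] by (auto simp: field_simps add_pos_pos)
  qed
  have ev: "\<forall>\<^sub>F y in at_right 0. (0 :: real) < y" by (rule eventually_at_right_less)
  have "((\<lambda>y. infsum (f y) (X e) / part_sum half_integers y) \<longlongrightarrow> 1 / 2) (at_right 0)"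
  proof (rule tendsto_sandwich)
    show "\<forall>\<^sub>F y in at_right 0. exp (- (pi * y)) / (1 + exp (- (pi * y)))
        \<le> infsum (f y) (X e) / part_sum half_integers y"
      using ev by eventually_elim (use bounds in blast)
    show "\<forall>\<^sub>F y in at_right 0. infsum (f y) (X e) / part_sum half_integers y
        \<le> 1 / (1 + exp (- (pi * y)))"
      using ev by eventually_elim (use bounds in blast)
    have "((\<lambda>y :: real. exp (- (pi * y)) / (1 + exp (- (pi * y)))) \<longlongrightarrow>
        exp (- (pi * 0)) / (1 + exp (- (pi * 0)))) (at_right 0)"
      by (intro tendsto_intros) (simp add: add_pos_pos)
    then show "((\<lambda>y :: real. exp (- (pi * y)) / (1 + exp (- (pi * y)))) \<longlongrightarrow> 1 / 2) (at_right 0)"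
      by simp
    have "((\<lambda>y :: real. 1 / (1 + exp (- (pi * y)))) \<longlongrightarrow> 1 / (1 + exp (- (pi * 0)))) (at_right 0)"
      by (intro tendsto_intros) (simp add: add_pos_pos)
    then show "((\<lambda>y :: real. 1 / (1 + exp (- (pi * y)))) \<longlongrightarrow> 1 / 2) (at_right 0)"
      by simp
  qed
  then show ?thesis unfolding X_def f_def .
qed

text \<open>This is the inequality of arithmetic and geometric means for 1, \<open>v^2\<close>, ...,
  \<open>v^(2m)\<close>: their sum is the right-hand side divided by \<open>1 - v^2\<close>, and
  their geometric mean is \<open>v^m\<close>. It will yield the sharp upper bound on the factors of
  a q-analogue of Wallis' product.\<close>

lemma one_minus_power_bound:
  fixes v :: real
  assumes "0 < v" "v < 1"
  shows "real (Suc m) * v ^ m * (1 - v\<^sup>2) \<le> 1 - v ^ (2 * Suc m)"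
proof (induction m)
  case (Suc m)
  have "0 \<le> (1 - v) * (1 - v ^ Suc m) * (1 - v ^ Suc (Suc m))"
    using assms power_le_one[of v "Suc m"] power_le_one[of v "Suc (Suc m)"]
    by (intro mult_nonneg_nonneg) auto
  moreover have "v * (real (Suc m) * v ^ m * (1 - v\<^sup>2)) \<le> v * (1 - v ^ (2 * Suc m))"
    using Suc assms by (intro mult_left_mono) auto
  moreover have "1 - v ^ (2 * Suc (Suc m)) - real (Suc (Suc m)) * v ^ Suc m * (1 - v\<^sup>2)
     = (1 - v) * (1 - v ^ Suc m) * (1 - v ^ Suc (Suc m)) + (v * (1 - v ^ (2 * Suc m))
       - v * (real (Suc m) * v ^ m * (1 - v\<^sup>2)))"
  proof -
    \<comment> \<open>With the powers abbreviated, the claim becomes a polynomial identity in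
      \<open>v\<close>, \<open>p\<close> and \<open>M\<close>.\<close>
    define p M where "p = v ^ m" and "M = real (Suc m)"
    have "v ^ (2 * Suc m) = p\<^sup>2 * v\<^sup>2" "v ^ (2 * Suc (Suc m)) = p\<^sup>2 * v ^ 4"
      "v ^ Suc m = v * p" "v ^ Suc (Suc m) = v\<^sup>2 * p" "real (Suc (Suc m)) = M + 1"
      by (simp_all add: p_def M_def power_mult[symmetric] power_add[symmetric] mult.commute
          power2_eq_square eval_nat_numeral)
    moreover have "1 - p\<^sup>2 * v ^ 4 - (M + 1) * (v * p) * (1 - v\<^sup>2) = (1 - v) * (1 - v * p) * (1 - v\<^sup>2 * p)
        + (v * (1 - p\<^sup>2 * v\<^sup>2) - v * (M * p * (1 - v\<^sup>2)))"
      by algebra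
    ultimately show ?thesis by (simp only: p_def[symmetric] M_def[symmetric])
  qed
  ultimately show ?case by linarith
qed simp

text \<open>The classical factor \<open>(2n+2)^2 / ((2n+1)(2n+3))\<close> with every integer
  \<open>m\<close> replaced by \<open>1 - u^m\<close>.\<close>

definition wallis_factor :: "real \<Rightarrow> nat \<Rightarrow> real" where
  "wallis_factor u n = (1 - u ^ (2 * n + 2))\<^sup>2 / ((1 - u ^ (2 * n + 1)) * (1 - u ^ (2 * n + 3)))"

text \<open>The numerator exceeds the denominator by \<open>x * (1 - u)^2\<close> with
  \<open>x = u^(2n+1)\<close>, whence the lower bound. The upper bound says that this excess is at
  most the fraction \<open>1 / (4 (n+1)^2)\<close> of the numerator. That is the square of
  \<open>one_minus_power_bound\<close> for \<open>v = sqrt u\<close> with \<open>2n + 2\<close>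
  terms.\<close>

lemma wallis_factor_bounds:
  assumes "0 < u" "u < 1"
  shows "1 \<le> wallis_factor u n" "wallis_factor u n \<le> (4 * real (Suc n)^2) / (4 * real (Suc n)^2 - 1)"
proof -
  define v where "v = sqrt u"
  have v: "0 < v" "v < 1" "u = v\<^sup>2" using assms by (auto simp: v_def)
  let ?x = "u ^ (2 * n + 1)" and ?D = "(1 - u ^ (2 * n + 1)) * (1 - u ^ (2 * n + 3))"
  have "u ^ (2 * n + 1) < 1" "u ^ (2 * n + 3) < 1"
    using assms by (auto intro!: power_less_one_iff[THEN iffD2] simp del: power_Suc)
  then have D: "?D > 0" by simp
  have *: "(1 - u ^ (2 * n + 2))\<^sup>2 = ?D + ?x * (1 - u)\<^sup>2"
  proof -
    define q where "q = u ^ (2 * n)"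
    have "(1 - q * u\<^sup>2)\<^sup>2 = (1 - q * u) * (1 - q * u ^ 3) + q * u * (1 - u)\<^sup>2"
      by algebra
    then show ?thesis by (simp only: q_def power_add power_one_right)
  qed
  then show "1 \<le> wallis_factor u n"
    using D assms by (simp add: wallis_factor_def)
  have "real (Suc (2 * n + 1)) * v ^ (2 * n + 1) * (1 - v\<^sup>2) \<le> 1 - v ^ (2 * Suc (2 * n + 1))"
    by (rule one_minus_power_bound[OF v(1,2)])
  then have "(real (Suc (2 * n + 1)) * v ^ (2 * n + 1) * (1 - v\<^sup>2))\<^sup>2 \<le> (1 - v ^ (2 * Suc (2 * n + 1)))\<^sup>2"
    using v power_le_one[of v 2] by (intro power_mono mult_nonneg_nonneg) auto
  moreover have "v ^ (2 * Suc (2 * n + 1)) = u ^ (2 * n + 2)"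
    by (simp only: v(3) power_mult[symmetric]) simp
  moreover have "(v ^ (2 * n + 1))\<^sup>2 = ?x"
    by (simp only: v(3) power_mult[symmetric] mult.commute)
  ultimately have "4 * (real (Suc n))\<^sup>2 * (?x * (1 - u)\<^sup>2) \<le> (1 - u ^ (2 * n + 2))\<^sup>2"
    by (simp only: power_mult_distrib v(3)[symmetric])
      (simp add: power2_eq_square algebra_simps)
  then have "(1 - u ^ (2 * n + 2))\<^sup>2 * (4 * real (Suc n)^2 - 1) \<le> 4 * real (Suc n)^2 * ?D"
    unfolding * by (simp add: algebra_simps)
  moreover have "4 * real (Suc n)^2 - 1 > 0"
    by (simp add: power2_eq_square algebra_simps add_pos_nonneg)
  ultimately show "wallis_factor u n \<le> (4 * real (Suc n)^2) / (4 * real (Suc n)^2 - 1)"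
    unfolding wallis_factor_def using D by (simp add: divide_le_eq le_divide_eq mult.commute)
qed

text \<open>Cancelling \<open>(1 - u)^2\<close> leaves geometric sums of \<open>2n+1\<close>,
  \<open>2n+2\<close> and \<open>2n+3\<close> terms, each of which tends to its number of
  terms.\<close>

lemma wallis_factor_tendsto:
  "((\<lambda>u. wallis_factor u n) \<longlongrightarrow> (4 * real (Suc n)^2) / (4 * real (Suc n)^2 - 1)) (at_left 1)"
proof -
  define g where "g m u = (\<Sum>i<m. u ^ i)" for m and u :: real
  have g: "((\<lambda>u. g m u) \<longlongrightarrow> real m) (at_left 1)" for m
  proof -
    have "((\<lambda>u. g m u) \<longlongrightarrow> (\<Sum>i<m. 1 ^ i)) (at_left 1)"
      unfolding g_def by (intro tendsto_intros)
    then show ?thesis by simp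
  qed
  have "((\<lambda>u. (g (2 * n + 2) u)\<^sup>2 / (g (2 * n + 1) u * g (2 * n + 3) u)) \<longlongrightarrow>
      (real (2 * n + 2))\<^sup>2 / (real (2 * n + 1) * real (2 * n + 3))) (at_left 1)"
    by (intro tendsto_intros g) auto
  also have "(real (2 * n + 2))\<^sup>2 / (real (2 * n + 1) * real (2 * n + 3))
      = (4 * real (Suc n)^2) / (4 * real (Suc n)^2 - 1)"
    by (simp add: power2_eq_square algebra_simps)
  finally have lim: "((\<lambda>u. (g (2 * n + 2) u)\<^sup>2 / (g (2 * n + 1) u * g (2 * n + 3) u)) \<longlongrightarrow>
      (4 * real (Suc n)^2) / (4 * real (Suc n)^2 - 1)) (at_left 1)" .
  have "\<forall>\<^sub>F u in at_left 1. (g (2 * n + 2) u)\<^sup>2 / (g (2 * n + 1) u * g (2 * n + 3) u) = wallis_factor u n"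
    unfolding eventually_at_filter
  proof (rule always_eventually, intro allI impI)
    fix u :: real assume "u \<in> {..<1}"
    then have ne: "1 - u \<noteq> 0" by simp
    have "1 - u ^ m = (1 - u) * g m u" for m
      unfolding g_def by (rule one_diff_power_eq)
    then show "(g (2 * n + 2) u)\<^sup>2 / (g (2 * n + 1) u * g (2 * n + 3) u) = wallis_factor u n"
      unfolding wallis_factor_def using ne by (simp only: power_mult_distrib) (simp add: power2_eq_square)
  qed
  then show ?thesis using lim by (rule Lim_transform_eventually[rotated])
qed

text \<open>With \<open>u\<^sup>2 = q\<close> one has \<open>Q/P = \<Prod>\<^sub>n (1 - u\<^bsup>2n\<^esup>) / (1 - u\<^bsup>2n-1\<^esup>)\<close>; in its square, shifting one of the
  denominators costs the telescoping factor \<open>1 - u\<close>.\<close>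

lemma part_sum_ratio_wallis:
  assumes y: "y > 0"
  defines "u \<equiv> exp (- (pi * y))"
  shows "(\<lambda>n. \<Prod>i<n. wallis_factor u i)
    \<longlonglongrightarrow> (part_sum half_integers y / part_sum \<int> y)\<^sup>2 * (1 - u)"
proof -
  have u: "0 < u" "u < 1" using y by (auto simp: u_def)
  have e1: "exp (- (2 * pi * y) * (real i + 1)) = u ^ (2 * i + 2)" for i
    unfolding u_def exp_of_nat_mult[symmetric] by (simp add: algebra_simps)
  have e2: "exp (- (2 * pi * y) * (real i + 1 / 2)) = u ^ (2 * i + 1)" for i
    unfolding u_def exp_of_nat_mult[symmetric] by (simp add: algebra_simps)
  have lt: "u ^ Suc m < 1" for m using u by (intro power_Suc_less_one)
  have ne: "1 - u ^ (2 * i + 1) \<noteq> 0" "1 - u ^ (2 * i + 2) \<noteq> 0" "1 - u ^ (2 * i + 3) \<noteq> 0" for i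
    using lt[of "2 * i"] lt[of "2 * i + 1"] lt[of "2 * i + 2"] by (auto simp: eval_nat_numeral)
  \<comment> \<open>Shifting one denominator within the first \<open>n\<close> factors leaves the
    boundary terms \<open>1 - u\<close> and \<open>1 - u ^ (2 * n + 1)\<close>; the second tends to
    1.\<close>
  have "(\<lambda>n. ((\<Prod>i<n. 1 / (1 - u ^ (2 * i + 1))) / (\<Prod>i<n. 1 / (1 - u ^ (2 * i + 2))))\<^sup>2
       * (1 - u)  / (1 - u ^ (2 * n + 1)))
    \<longlonglongrightarrow> (part_sum half_integers y / part_sum \<int> y)\<^sup>2 * (1 - u) / (1 - 0)"
  proof (intro tendsto_intros)
    show "(\<lambda>n. \<Prod>i<n. 1 / (1 - u ^ (2 * i + 1))) \<longlonglongrightarrow> part_sum half_integers y"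
      using part_sum_half_integers(3)[OF y] by (simp only: e2)
    show "(\<lambda>n. \<Prod>i<n. 1 / (1 - u ^ (2 * i + 2))) \<longlonglongrightarrow> part_sum \<int> y"
      using part_sum_Ints(3)[OF y] by (simp only: e1)
    show "part_sum \<int> y \<noteq> 0" using part_sum_Ints(2)[OF y] by auto
    have "strict_mono (\<lambda>n :: nat. 2 * n + 1)" by (rule strict_monoI) simp
    from LIMSEQ_subseq_LIMSEQ[OF LIMSEQ_realpow_zero[OF less_imp_le[OF u(1)] u(2)] this]
    show "(\<lambda>n. u ^ (2 * n + 1)) \<longlonglongrightarrow> 0"
      unfolding o_def .
  qed simp
  moreover have "((\<Prod>i<n. 1 / (1 - u ^ (2 * i + 1))) / (\<Prod>i<n. 1 / (1 - u ^ (2 * i + 2))))\<^sup>2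
       * (1 - u)  / (1 - u ^ (2 * n + 1)) = (\<Prod>i<n. wallis_factor u i)" for n
  proof (induction n)
    case 0
    then show ?case using u by simp
  next
    case (Suc n)
    have "(\<Prod>i<Suc n. wallis_factor u i) = ((\<Prod>i<n. 1 / (1 - u ^ (2 * i + 1))) / (\<Prod>i<n. 1 / (1 - u ^ (2 * i + 2))))\<^sup>2
       * (1 - u)  / (1 - u ^ (2 * n + 1)) * wallis_factor u n"
      by (simp only: Suc prod.lessThan_Suc)
    also have "\<dots> = ((\<Prod>i<n. 1 / (1 - u ^ (2 * i + 1))) / (\<Prod>i<n. 1 / (1 - u ^ (2 * i + 2))))\<^sup>2
       * ((1 - u ^ (2 * n + 2)) / (1 - u ^ (2 * n + 1)))\<^sup>2 * (1 - u) / (1 - u ^ (2 * n + 3))"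
    proof -
      have "P\<^sup>2 * v / x * (z\<^sup>2 / (x * w)) = P\<^sup>2 * (z / x)\<^sup>2 * v / w" for P v x z w :: real
        by (simp add: power2_eq_square mult_ac)
      then show ?thesis unfolding wallis_factor_def .
    qed
    also have "\<dots> = ((\<Prod>i<Suc n. 1 / (1 - u ^ (2 * i + 1))) / (\<Prod>i<Suc n. 1 / (1 - u ^ (2 * i + 2))))\<^sup>2
       * (1 - u)  / (1 - u ^ (2 * Suc n + 1))"
    proof -
      have "(P / Q)\<^sup>2 * (z / x)\<^sup>2 * v / w = (P * (1 / x) / (Q * (1 / z)))\<^sup>2 * v / w" for P Q v x z w :: real
        by (simp add: power2_eq_square mult_ac)
      moreover have "2 * n + 3 = 2 * Suc n + 1" by simp
      ultimately show ?thesis by (simp only: prod.lessThan_Suc)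
    qed
    finally show ?case by simp
  qed
  ultimately show ?thesis by simp
qed

text \<open>All factors lie between \<open>1\<close> and their limits at \<open>u = 1\<close>, so the partial products bound the infinite
  product from below and the limit product bounds it from above.\<close>

lemma wallis_limit_at_left:
  assumes W: "\<And>u. 0 < u \<Longrightarrow> u < 1 \<Longrightarrow> (\<lambda>n. \<Prod>i<n. wallis_factor u i) \<longlonglongrightarrow> W u"
  shows "(W \<longlongrightarrow> pi / 2) (at_left 1)"
proof -
  define w where "w n = (\<Prod>i<n. (4 * real (Suc i)^2) / (4 * real (Suc i)^2 - 1))" for n
  have w: "w \<longlonglongrightarrow> pi / 2"
  proof -
    have "(\<Prod>k=1..n. (4 * real k^2) / (4 * real k^2 - 1)) = w n" for n
      unfolding w_def by (rule prod.reindex_bij_witness[of _ Suc "\<lambda>k. k - 1"]) auto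
    then show ?thesis using wallis by simp
  qed
  have w1: "1 \<le> (4 * real (Suc i)^2) / (4 * real (Suc i)^2 - 1)" for i
    by (simp add: power2_eq_square field_simps add_pos_nonneg)
  have w_le: "w n \<le> pi / 2" for n
  proof (rule incseq_le[OF _ w])
    show "incseq w"
    proof (rule incseq_SucI)
      have "0 \<le> w n" for n unfolding w_def by (intro prod_nonneg ballI) (use w1 order_trans zero_le_one in blast)
      then show "w n \<le> w (Suc n)" for n
        using mult_left_mono[OF w1[of n], of "w n"] by (simp add: w_def)
    qed
  qed
  have ev: "\<forall>\<^sub>F u in at_left 1. 0 < u \<and> u < (1 :: real)"
    using eventually_at_left_real[of 0 "1 :: real"] by simp
  show ?thesis
  proof (rule order_tendstoI)
    fix a assume "pi / 2 < a"
    from ev show "\<forall>\<^sub>F u in at_left 1. W u < a"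
    proof eventually_elim
      case (elim u)
      have "W u \<le> pi / 2"
      proof (rule LIMSEQ_le_const2[OF W])
        have "(\<Prod>i<n. wallis_factor u i) \<le> w n" for n
          unfolding w_def using wallis_factor_bounds elim
          by (intro prod_mono) (meson order_trans zero_le_one)
        then show "\<exists>N. \<forall>n\<ge>N. (\<Prod>i<n. wallis_factor u i) \<le> pi / 2"
          using w_le order_trans by blast
      qed (use elim in auto)
      with \<open>pi / 2 < a\<close> show ?case by linarith
    qed
  next
    fix a assume "a < pi / 2"
    then obtain n where n: "a < w n"
      using order_tendstoD(1)[OF w] by (meson eventually_sequentially order_refl)
    have "((\<lambda>u. \<Prod>i<n. wallis_factor u i) \<longlongrightarrow> w n) (at_left 1)"
      unfolding w_def by (intro tendsto_prod wallis_factor_tendsto)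
    then have "\<forall>\<^sub>F u in at_left 1. a < (\<Prod>i<n. wallis_factor u i)"
      using n order_tendstoD(1) by blast
    then show "\<forall>\<^sub>F u in at_left 1. a < W u"
      using ev
    proof eventually_elim
      case (elim u)
      have f1: "1 \<le> wallis_factor u i" for i using wallis_factor_bounds elim by blast
      have "incseq (\<lambda>n. \<Prod>i<n. wallis_factor u i)"
      proof (rule incseq_SucI)
        show "(\<Prod>i<n. wallis_factor u i) \<le> (\<Prod>i<Suc n. wallis_factor u i)" for n
          using mult_left_mono[OF f1[of n], of "\<Prod>i<n. wallis_factor u i"] f1
          by (simp add: prod_nonneg order_trans[OF zero_le_one])
      qed
      then have "(\<Prod>i<n. wallis_factor u i) \<le> W u"
        by (rule incseq_le) (use W elim in auto)
      with elim show ?case by linarith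
    qed
  qed
qed

text \<open>In the variable \<open>u = exp (- (pi * y))\<close>, where
  \<open>y = - ln u / pi\<close>, the Wallis limit reads
  \<open>(Q/P)^2 * (1 - u) \<longlonglongrightarrow> pi / 2\<close>. Since
  \<open>y / (1 - u)\<close> tends to \<open>1 / pi\<close>, the two occurrences of pi cancel and
  \<open>y * (Q/P)^2\<close> tends to 1/2.\<close>

lemma part_sum_ratio:
  "((\<lambda>y. sqrt y * (part_sum half_integers y / part_sum \<int> y)) \<longlongrightarrow> 1 / sqrt 2) (at_right 0)"
proof -
  define R where "R y = part_sum half_integers y / part_sum \<int> y" for y
  define W where "W u = (R (- ln u / pi))\<^sup>2 * (1 - u)" for u
  have lim: "(W \<longlongrightarrow> pi / 2) (at_left 1)"
  proof (rule wallis_limit_at_left)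
    fix u :: real assume u: "0 < u" "u < 1"
    then have "- ln u / pi > 0" by (simp add: divide_neg_pos)
    from part_sum_ratio_wallis[OF this] show "(\<lambda>n. \<Prod>i<n. wallis_factor u i) \<longlonglongrightarrow> W u"
      using u by (simp add: W_def R_def)
  qed
  have fl: "filterlim (\<lambda>y :: real. exp (- (pi * y))) (at_left 1) (at_right 0)"
    unfolding filterlim_at
  proof
    show "\<forall>\<^sub>F y in at_right 0. exp (- (pi * y)) \<in> {..<1} \<and> exp (- (pi * y)) \<noteq> 1"
      using eventually_at_right_less[of "0 :: real"] by eventually_elim auto
    have "((\<lambda>y :: real. exp (- (pi * y))) \<longlongrightarrow> exp (- (pi * 0))) (at_right 0)"
      by (intro tendsto_intros)
    then show "((\<lambda>y :: real. exp (- (pi * y))) \<longlongrightarrow> 1) (at_right 0)" by simp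
  qed
  have "((\<lambda>y. W (exp (- (pi * y)))) \<longlongrightarrow> pi / 2) (at_right 0)"
    by (rule filterlim_compose[OF lim fl])
  then have 1: "((\<lambda>y. (R y)\<^sup>2 * (1 - exp (- (pi * y)))) \<longlongrightarrow> pi / 2) (at_right 0)"
    by (simp add: W_def)
  have 2: "((\<lambda>y. y / (1 - exp (- (pi * y)))) \<longlongrightarrow> 1 / pi) (at_right 0)"
    by real_asymp (simp add: field_simps)
  have ev: "\<forall>\<^sub>F y in at_right 0. (0 :: real) < y" by (rule eventually_at_right_less)
  have "((\<lambda>y. (R y)\<^sup>2 * (1 - exp (- (pi * y))) * (y / (1 - exp (- (pi * y))))) \<longlongrightarrow> pi / 2 * (1 / pi)) (at_right 0)"
    by (rule tendsto_mult[OF 1 2])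
  moreover have "\<forall>\<^sub>F y in at_right 0. (R y)\<^sup>2 * (1 - exp (- (pi * y))) * (y / (1 - exp (- (pi * y)))) = y * (R y)\<^sup>2"
    using ev by eventually_elim simp
  ultimately have "((\<lambda>y. y * (R y)\<^sup>2) \<longlongrightarrow> 1 / 2) (at_right 0)"
    by (simp add: tendsto_cong)
  then have "((\<lambda>y. sqrt (y * (R y)\<^sup>2)) \<longlongrightarrow> sqrt (1 / 2)) (at_right 0)"
    by (rule tendsto_real_sqrt)
  moreover have "\<forall>\<^sub>F y in at_right 0. sqrt (y * (R y)\<^sup>2) = sqrt y * R y"
    using ev
  proof eventually_elim
    case (elim y)
    have "R y \<ge> 0"
      unfolding R_def using part_sum_Ints(2)[OF elim] part_sum_half_integers(2)[OF elim] by simp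
    then show ?case by (simp add: real_sqrt_mult)
  qed
  ultimately show ?thesis by (simp add: tendsto_cong R_def real_sqrt_divide)
qed

section \<open>Theta series compared with the Gaussian integral\<close>

lemma gaussian_integral_tendsto:
  assumes c: "c > 0"
  shows "(\<lambda>n. integral {0..real n} (\<lambda>x. exp (- c * x\<^sup>2))) \<longlonglongrightarrow> sqrt (pi / c) / 2"
proof -
  let ?f = "\<lambda>x :: real. indicator {0..} x *\<^sub>R exp (- c * x\<^sup>2)"
  have "has_bochner_integral lborel (\<lambda>x. indicator {0..} (0 + sqrt c * x) *\<^sub>R exp (- (0 + sqrt c * x)\<^sup>2))
      ((sqrt pi / 2) /\<^sub>R \<bar>sqrt c\<bar>)"
    using gaussian_moment_0 c by (subst lborel_has_bochner_integral_real_affine_iff[symmetric]) auto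
  also have "(\<lambda>x. indicator {0..} (0 + sqrt c * x) *\<^sub>R exp (- (0 + sqrt c * x)\<^sup>2)) = ?f"
    using c by (auto simp: fun_eq_iff indicator_def power_mult_distrib zero_le_mult_iff)
  also have "(sqrt pi / 2) /\<^sub>R \<bar>sqrt c\<bar> = sqrt (pi / c) / 2"
    using c unfolding real_sqrt_divide by (simp add: divide_simps)
  finally have hbi: "has_bochner_integral lborel ?f (sqrt (pi / c) / 2)" .
  then have int: "integrable lborel ?f" and val: "integral\<^sup>L lborel ?f = sqrt (pi / c) / 2"
    by (auto simp: has_bochner_integral_iff)
  have "((\<lambda>y. \<integral>x. indicator {..y} x *\<^sub>R ?f x \<partial>lborel) \<longlongrightarrow> sqrt (pi / c) / 2) at_top"
    using tendsto_integral_at_top[OF sets_lborel int] unfolding val .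
  then have "(\<lambda>n. \<integral>x. indicator {..real n} x *\<^sub>R ?f x \<partial>lborel) \<longlonglongrightarrow> sqrt (pi / c) / 2"
    by (rule filterlim_compose[OF _ filterlim_real_sequentially])
  moreover have "(\<integral>x. indicator {..real n} x *\<^sub>R ?f x \<partial>lborel) = integral {0..real n} (\<lambda>x. exp (- c * x\<^sup>2))" for n
  proof -
    have "(\<integral>x. indicator {..real n} x *\<^sub>R ?f x \<partial>lborel) = (LINT x:{0..real n}|lborel. exp (- c * x\<^sup>2))"
      unfolding set_lebesgue_integral_def
      by (intro Bochner_Integration.integral_cong) (auto simp: indicator_def)
    also have "\<dots> = integral {0..real n} (\<lambda>x. exp (- c * x\<^sup>2))"
      by (intro set_borel_integral_eq_integral borel_integrable_atLeastAtMost') (intro continuous_intros)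
    finally show ?thesis .
  qed
  ultimately show ?thesis by simp
qed

text \<open>For a decreasing function the unshifted series \<open>?T\<close> exceeds the integral by
  at most the value 1 at the origin. The shifted terms interlace the unshifted ones, so
  \<open>?S\<close> lies between \<open>?T - 1\<close> and \<open>?T\<close>; the two errors have
  opposite signs and the total stays within 1.\<close>

lemma gaussian_series_bounds:
  assumes c: "c > 0" and r: "0 \<le> r" "r \<le> 1"
  obtains S where "((\<lambda>n :: nat. exp (- c * (real n + r)\<^sup>2)) has_sum S) UNIV" "\<bar>S - sqrt (pi / c) / 2\<bar> \<le> 1"
proof -
  let ?f = "\<lambda>x :: real. exp (- c * x\<^sup>2)" and ?I = "sqrt (pi / c) / 2"
  have mono: "?f y \<le> ?f x" if "0 \<le> x" "x \<le> y" for x y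
    using that c by (simp add: power_mono)
  interpret antimono_fun_sum_integral_diff ?f
    by unfold_locales (use mono in \<open>auto intro!: continuous_intros\<close>)
  let ?J = "\<lambda>n :: nat. integral {0..real n} ?f"
  have lb: "?J n \<le> (\<Sum>k\<le>n. ?f (real k))" for n
    using sum_integral_diff_series_nonneg[of n] unfolding sum_integral_diff_series_def by simp
  have ub: "(\<Sum>k\<le>n. ?f (real k)) \<le> ?J n + 1" for n
    using sum_integral_diff_series_antimono[of 0 n] unfolding sum_integral_diff_series_def by simp
  have "convergent ?J"
    using gaussian_integral_tendsto[OF c] convergentI by blast
  then have summ0: "summable (\<lambda>n. ?f (real n))" using integral_test by simp
  let ?T = "suminf (\<lambda>n. ?f (real n))"
  have lim: "(\<lambda>n. \<Sum>k\<le>n. ?f (real k)) \<longlonglongrightarrow> ?T" by (rule summable_LIMSEQ'[OF summ0])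
  have "?I \<le> ?T" by (rule LIMSEQ_le[OF gaussian_integral_tendsto[OF c] lim]) (use lb in auto)
  have "?T \<le> ?I + 1"
    by (rule LIMSEQ_le[OF lim tendsto_add[OF gaussian_integral_tendsto[OF c] tendsto_const]]) (use ub in auto)
  have le: "?f (real n + r) \<le> ?f (real n)" and ge: "?f (real (Suc n)) \<le> ?f (real n + r)" for n
    using r mono[of "real n" "real n + r"] mono[of "real n + r" "real (Suc n)"] by simp_all
  have summr: "summable (\<lambda>n. ?f (real n + r))"
    by (rule summable_comparison_test'[OF summ0, of 0]) (use le in auto)
  have summ1: "summable (\<lambda>n. ?f (real (Suc n)))" using summ0 by (subst summable_Suc_iff)
  let ?S = "suminf (\<lambda>n. ?f (real n + r))"
  have "?S \<le> ?T" by (rule suminf_le[OF _ summr summ0]) (rule le)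
  have "suminf (\<lambda>n. ?f (real (Suc n))) \<le> ?S" by (rule suminf_le[OF _ summ1 summr]) (rule ge)
  then have "?T - 1 \<le> ?S" using suminf_split_head[OF summ0] by simp
  have "(\<lambda>n. ?f (real n + r)) sums ?S" using summr by (rule summable_sums)
  then have "((\<lambda>n. ?f (real n + r)) has_sum ?S) UNIV" by (rule sums_nonneg_imp_has_sum) simp
  then show ?thesis
    by (rule that) (use \<open>?I \<le> ?T\<close> \<open>?T \<le> ?I + 1\<close> \<open>?S \<le> ?T\<close> \<open>?T - 1 \<le> ?S\<close> in linarith)
qed

definition coset :: "real \<Rightarrow> real set" where "coset r = {x. x - r \<in> \<int>}"

text \<open>Here \<open>a\<close> is half the norm of the lattice generator: \<open>real k\<close>
  for \<open>L\<close> and \<open>2 * real k\<close> for the lattice of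
  \<open>\<beta>\<close>.\<close>

definition theta_sum :: "real \<Rightarrow> real \<Rightarrow> real \<Rightarrow> real" where
  "theta_sum a r y = (\<Sum>\<^sub>\<infinity>x\<in>coset r. exp (- (2 * pi * y) * (a * x\<^sup>2)))"

text \<open>With \<open>s\<close> the fractional part of \<open>r\<close>, the coset splits into the
  points \<open>n + s\<close> and \<open>-(n + (1 - s))\<close> for natural \<open>n\<close>. Each
  half is within 1 of half the Gaussian integral, so the error 2 is uniform in \<open>y\<close> and
  \<open>r\<close> and disappears after multiplication by \<open>sqrt y\<close>.\<close>

lemma theta_sum_bounds:
  assumes a: "a > 0" and y: "y > 0"
  shows "(\<lambda>x. exp (- (2 * pi * y) * (a * x\<^sup>2))) summable_on coset r"
    "\<bar>theta_sum a r y - 1 / sqrt (2 * a * y)\<bar> \<le> 2"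
proof -
  define c where "c = 2 * pi * y * a"
  have c: "c > 0" using a y by (simp add: c_def)
  define f where "f x = exp (- c * x\<^sup>2)" for x
  have f: "exp (- (2 * pi * y) * (a * x\<^sup>2)) = f x" for x by (simp add: f_def c_def mult_ac)
  define s where "s = frac r"
  have s: "0 \<le> s" "s < 1" by (simp_all add: s_def frac_lt_1)
  have cos: "coset r = coset s"
  proof -
    have "x - r \<in> \<int> \<longleftrightarrow> x - s \<in> \<int>" for x
      using Ints_diff[of "x - s" "of_int \<lfloor>r\<rfloor>"] Ints_add[of "x - r" "of_int \<lfloor>r\<rfloor>"] by (auto simp: s_def frac_def algebra_simps)
    then show ?thesis by (simp add: coset_def)
  qed
  obtain S1 where S1: "((\<lambda>n :: nat. f (real n + s)) has_sum S1) UNIV" "\<bar>S1 - sqrt (pi / c) / 2\<bar> \<le> 1"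
    using gaussian_series_bounds[OF c, of s] s unfolding f_def by auto
  obtain S2 where S2: "((\<lambda>n :: nat. f (real n + (1 - s))) has_sum S2) UNIV" "\<bar>S2 - sqrt (pi / c) / 2\<bar> \<le> 1"
    using gaussian_series_bounds[OF c, of "1 - s"] s unfolding f_def by auto
  let ?A = "range (\<lambda>n. real n + s)" and ?B = "range (\<lambda>n. - (real n + (1 - s)))"
  have A: "(f has_sum S1) ?A"
    using S1(1) by (subst has_sum_reindex) (auto simp: inj_on_def o_def)
  have B: "(f has_sum S2) ?B"
  proof (subst has_sum_reindex)
    have "(f \<circ> (\<lambda>n. - (real n + (1 - s)))) = (\<lambda>n :: nat. f (real n + (1 - s)))"
      by (simp only: f_def o_def power2_minus)
    then show "((f \<circ> (\<lambda>n. - (real n + (1 - s)))) has_sum S2) UNIV" using S2(1) by simp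
  qed (auto simp: inj_on_def)
  have "?A \<inter> ?B = {}" using s by auto
  then have AB: "(f has_sum (S1 + S2)) (?A \<union> ?B)" using A B by (intro has_sum_Un_disjoint)
  have "?A \<union> ?B = coset s"
  proof (intro equalityI subsetI)
    fix x assume "x \<in> ?A \<union> ?B"
    then show "x \<in> coset s" by (auto simp: coset_def)
  next
    fix x assume "x \<in> coset s"
    then obtain m where m: "x = of_int m + s" by (auto simp: coset_def elim!: Ints_cases) (metis diff_add_cancel)
    show "x \<in> ?A \<union> ?B"
    proof (cases "m \<ge> 0")
      case True
      then have "x = real (nat m) + s" using m by simp
      then show ?thesis by blast
    next
      case False
      then have "x = - (real (nat (- m - 1)) + (1 - s))" using m by simp
      then show ?thesis by blast
    qed
  qed
  with AB have has: "(f has_sum (S1 + S2)) (coset r)" using cos by simp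
  show "(\<lambda>x. exp (- (2 * pi * y) * (a * x\<^sup>2))) summable_on coset r"
    unfolding f using has_sum_imp_summable[OF has] .
  have "theta_sum a r y = S1 + S2"
    unfolding theta_sum_def f using has by (rule infsumI)
  moreover have "sqrt (pi / c) = 1 / sqrt (2 * a * y)"
  proof -
    have "pi / c = 1 / (2 * a * y)" using a y by (simp add: c_def)
    then show ?thesis by (simp add: real_sqrt_divide)
  qed
  ultimately show "\<bar>theta_sum a r y - 1 / sqrt (2 * a * y)\<bar> \<le> 2"
    using S1(2) S2(2) by linarith
qed

lemma theta_sum_asymptotics:
  assumes a: "a > 0"
  shows "((\<lambda>y. sqrt y * theta_sum a r y) \<longlongrightarrow> 1 / sqrt (2 * a)) (at_right 0)"
proof (rule LIM_zero_cancel)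
  show "((\<lambda>y. sqrt y * theta_sum a r y - 1 / sqrt (2 * a)) \<longlongrightarrow> 0) (at_right 0)"
  proof (rule Lim_null_comparison)
    have "((\<lambda>y. 2 * sqrt y) \<longlongrightarrow> 2 * sqrt 0) (at_right 0)" by (intro tendsto_intros)
    then show "((\<lambda>y. 2 * sqrt y) \<longlongrightarrow> 0) (at_right 0)" by simp
    show "\<forall>\<^sub>F y in at_right 0. norm (sqrt y * theta_sum a r y - 1 / sqrt (2 * a)) \<le> 2 * sqrt y"
      using eventually_at_right_less[of "0 :: real"]
    proof eventually_elim
      case (elim y)
      have "sqrt y * theta_sum a r y - 1 / sqrt (2 * a)
          = sqrt y * (theta_sum a r y - 1 / sqrt (2 * a * y))"
        using elim by (simp add: real_sqrt_mult right_diff_distrib)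
      then have "norm (sqrt y * theta_sum a r y - 1 / sqrt (2 * a))
          = sqrt y * \<bar>theta_sum a r y - 1 / sqrt (2 * a * y)\<bar>"
        using elim by (simp add: abs_mult)
      also have "\<dots> \<le> sqrt y * 2"
        using theta_sum_bounds(2)[OF a elim] elim by (intro mult_left_mono) auto
      finally show ?case by simp
    qed
  qed
qed

section \<open>Characters of the modules\<close>

definition untwisted_basis :: "real \<Rightarrow> fock_basis set" where
  "untwisted_basis r = parts \<int> \<times> coset r"

definition twisted_basis :: "fock_basis set" where
  "twisted_basis = parts half_integers \<times> {0}"

lemma sum_mset_parts_nonneg: "A \<in> parts J \<Longrightarrow> 0 \<le> sum_mset A"
  by (induction A) (auto simp: parts_def)

lemma lattice_space_span: "lattice_space r = cvec.span (basis_vec ` untwisted_basis r)"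
  unfolding lattice_space_def untwisted_basis_def parts_def coset_def
  by (rule arg_cong[of _ _ cvec.span]) auto

lemma twisted_space_span: "mspace (twisted_module N s) = cvec.span (basis_vec ` twisted_basis)"
  unfolding twisted_module_def twisted_basis_def parts_def
  by (simp, rule arg_cong[of _ _ cvec.span]) auto

text \<open>The operator \<open>(1 + e T) / 2\<close> is the identity on the eigenspace and sends
  each monomial to half of its symmetrization, so the symmetrizations span.\<close>

lemma eigenspace_span:
  fixes T :: "('b \<Rightarrow>\<^sub>0 complex) \<Rightarrow> ('b \<Rightarrow>\<^sub>0 complex)"
  assumes T: "clinear T" and Tb: "\<And>b. b \<in> B \<Longrightarrow> T (basis_vec b) = s b *\<^sub>C basis_vec (p b)"
    and pB: "\<And>b. b \<in> B \<Longrightarrow> p b \<in> B" and pp: "\<And>b. b \<in> B \<Longrightarrow> p (p b) = b"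
    and sp: "\<And>b. b \<in> B \<Longrightarrow> s (p b) = s b" and s: "\<And>b. b \<in> B \<Longrightarrow> s b \<in> {1, -1}"
    and e: "e \<in> {1, -1}"
  shows "{m \<in> cvec.span (basis_vec ` B). T m = e *\<^sub>C m}
    = cvec.span ((\<lambda>b. basis_vec b + (e * s b) *\<^sub>C basis_vec (p b)) ` B)" (is "?E = cvec.span (?u ` B)")
proof
  have ee: "e * e = 1" using e by auto
  show "?E \<subseteq> cvec.span (?u ` B)"
  proof
    fix m assume "m \<in> ?E"
    then have m: "m \<in> cvec.span (basis_vec ` B)" "T m = e *\<^sub>C m" by auto
    define g where "g m = (1 / 2) *\<^sub>C (m + e *\<^sub>C T m)" for m
    have g: "clinear g"
      by (rule clinearI) (simp_all add: g_def cpair.linear_add[OF T] cpair.linear_scale[OF T]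
          scaleC_add_right scaleC_scaleC mult_ac)
    have "g m = (1 / 2) *\<^sub>C (1 *\<^sub>C m + 1 *\<^sub>C m)" using m ee by (simp add: g_def scaleC_scaleC scaleC_one)
    also have "\<dots> = m" unfolding scaleC_add_left[symmetric] scaleC_scaleC by (simp add: scaleC_one)
    finally have "m \<in> g ` cvec.span (basis_vec ` B)" using m by (metis image_eqI)
    also have "\<dots> = cvec.span (g ` basis_vec ` B)"
      using cpair.linear_span_image[OF g] by simp
    also have "\<dots> \<subseteq> cvec.span (?u ` B)"
    proof (rule cvec.span_minimal)
      show "g ` basis_vec ` B \<subseteq> cvec.span (?u ` B)"
      proof clarify
        fix b assume b: "b \<in> B"
        then have "g (basis_vec b) = (1 / 2) *\<^sub>C ?u b" by (simp add: g_def Tb scaleC_scaleC)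
        moreover have "?u b \<in> cvec.span (?u ` B)" using b by (intro cvec.span_base imageI)
        ultimately show "g (basis_vec b) \<in> cvec.span (?u ` B)" by (simp add: cvec.span_scale)
      qed
    qed simp
    finally show "m \<in> cvec.span (?u ` B)" .
  qed
  show "cvec.span (?u ` B) \<subseteq> ?E"
  proof (rule cvec.span_minimal)
    show "?u ` B \<subseteq> ?E"
    proof clarify
      fix b assume b: "b \<in> B"
      have ss: "s b * s b = 1" using s[OF b] by auto
      have "T (?u b) = e *\<^sub>C ?u b"
        using b pB pp sp ee ss
        by (simp add: cpair.linear_add[OF T] cpair.linear_scale[OF T] Tb scaleC_add_right scaleC_scaleC
            mult.assoc[symmetric] add.commute)
      then show "?u b \<in> cvec.span (basis_vec ` B) \<and> T (?u b) = e *\<^sub>C ?u b"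
        using b pB by (intro conjI cvec.span_add cvec.span_scale cvec.span_base imageI)
    qed
    show "cvec.subspace ?E"
      by (rule cvec.subspaceI)
        (auto simp: cpair.linear_0[OF T] cpair.linear_add[OF T] cpair.linear_scale[OF T] cvec.span_zero
          cvec.span_add cvec.span_scale scaleC_add_right scaleC_scaleC mult.commute)
  qed
qed

lemma tensor_space_basis:
  "tensor_space (cvec.span (basis_vec ` B1)) (cvec.span (basis_vec ` B2))
    = cvec.span (basis_vec ` (B1 \<times> B2))"
  unfolding tensor_space_span by (rule arg_cong[of _ _ cvec.span]) force

text \<open>Symmetrizing the second factor is symmetrizing pairs under \<open>apsnd p\<close>. This
  brings the eigenspace summands into the form required by
  \<open>graded_char_symmetrized\<close>.\<close>

lemma tensor_space_symmetrized:
  "tensor_space (cvec.span (basis_vec ` B1)) (cvec.span ((\<lambda>b. basis_vec b + (e * s b) *\<^sub>C basis_vec (p b)) ` B2))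
    = cvec.span ((\<lambda>b. basis_vec b + (e * s (snd b)) *\<^sub>C basis_vec (apsnd p b)) ` (B1 \<times> B2))"
proof -
  have "{tensor x y | x y. x \<in> f ` B1 \<and> y \<in> g ` B2} = (\<lambda>b. tensor (f (fst b)) (g (snd b))) ` (B1 \<times> B2)"
    for f :: "'a \<Rightarrow> 'a \<Rightarrow>\<^sub>0 complex" and g :: "'b \<Rightarrow> 'b \<Rightarrow>\<^sub>0 complex"
    by force
  then show ?thesis
    unfolding tensor_space_span by (simp add: tensor_add_right tensor_scale_right apsnd_def map_prod_def split_def)
qed

lemma theta_basis_vec: "theta (basis_vec (A, x)) = (-1) ^ size A *\<^sub>C basis_vec (A, - x)"
  by (simp add: theta_def)

lemma clinear_theta: "clinear theta"
  unfolding theta_def by (rule clinear_lin_ext)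

section \<open>Generating functions of the monomial bases\<close>

lemma has_sum_untwisted:
  assumes N: "N > 0" and y: "y > 0"
  shows "((\<lambda>b. exp (- (2 * pi * y) * weight N b)) has_sum part_sum \<int> y * theta_sum (N / 2) r y)
    (untwisted_basis r)"
proof -
  have 1: "((\<lambda>A. exp (- (2 * pi * y) * sum_mset A)) has_sum part_sum \<int> y) (parts \<int>)"
    unfolding part_sum_def by (rule has_sum_infsum[OF part_sum_Ints(1)[OF y]])
  have 2: "((\<lambda>x. exp (- (2 * pi * y) * (N / 2 * x\<^sup>2))) has_sum theta_sum (N / 2) r y) (coset r)"
    unfolding theta_sum_def using N by (intro has_sum_infsum[OF theta_sum_bounds(1)[OF _ y]]) simp
  show ?thesis
    unfolding untwisted_basis_def
    using has_sum_product_nonneg[OF 1 2]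
    by (rule has_sum_cong[THEN iffD1, rotated])
      (auto simp: weight_def exp_add[symmetric] algebra_simps)
qed

lemma has_sum_tensor_weight:
  assumes "((\<lambda>a. exp (- (2 * pi * y) * w1 a)) has_sum s) A"
    and "((\<lambda>b. exp (- (2 * pi * y) * w2 b)) has_sum t) B"
  shows "((\<lambda>c. exp (- (2 * pi * y) * (w1 (fst c) + w2 (snd c)))) has_sum s * t) (A \<times> B)"
  using has_sum_product_nonneg[OF assms]
  by (rule has_sum_cong[THEN iffD1, rotated]) (auto simp: exp_add[symmetric] algebra_simps)

lemma lattice_mode_om_untwisted:
  assumes "b \<in> untwisted_basis r"
  shows "lattice_mode N (basis_vec omega_basis) 1 (basis_vec b) = of_real (2 * N * weight N b) *\<^sub>C basis_vec b"
  using assms lattice_mode_om[of "fst b" N "snd b"] by (auto simp: untwisted_basis_def parts_def)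

lemma twisted_mode_om_twisted:
  assumes "N \<noteq> 0" "b \<in> twisted_basis"
  shows "twisted_mode N s (basis_vec omega_basis) 1 (basis_vec b)
    = of_real (2 * N * (weight N b + flm_coeff 1 1)) *\<^sub>C basis_vec b"
  using assms twisted_mode_om[of N "fst b" s] by (auto simp: twisted_basis_def parts_def)

lemma vir_beta_tensor:
  "vir (beta_sub k) (tensor_module M N) 0 = tensor_mode (mmode M) (mmode N) (conf2 (4 * real k)) 1"
  by (simp add: fun_eq_iff vir_def conformal_beta_sub tensor_module_def)

section \<open>Characters of the three kinds of summands and of the orbifold\<close>

lemma graded_char_lattice_lattice:
  assumes k: "k \<ge> 1"
  shows "graded_char (beta_sub k) (tensor_module (beta_mod k r) (beta_mod k r'))
    (\<lambda>y. (part_sum \<int> y * theta_sum (2 * real k) r y) * (part_sum \<int> y * theta_sum (2 * real k) r' y))"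
proof (rule graded_char_eigenbasis[where v = basis_vec and C = "untwisted_basis r \<times> untwisted_basis r'"
      and wt = "\<lambda>c. weight (4 * real k) (fst c) + weight (4 * real k) (snd c)"])
  let ?C = "untwisted_basis r \<times> untwisted_basis r'"
  have d: "Poly_Mapping.lookup (basis_vec c) c' = (if c = c' then 1 else 0)" for c c' :: "fock_basis \<times> fock_basis"
    by (simp add: lookup_basis_vec)
  show "inj_on basis_vec ?C" "cvec.independent (basis_vec ` ?C)"
    using dual_family_independent[of ?C basis_vec "\<lambda>c. c", OF d] by auto
  show "mspace (tensor_module (beta_mod k r) (beta_mod k r')) = cvec.span (basis_vec ` ?C)"
    by (simp add: tensor_module_def beta_mod_def lattice_module_def lattice_space_span tensor_space_basis)
  show "clinear (vir (beta_sub k) (tensor_module (beta_mod k r) (beta_mod k r')) 0)"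
    unfolding vir_beta_tensor by (rule clinear_tensor_mode)
  show "vir (beta_sub k) (tensor_module (beta_mod k r) (beta_mod k r')) 0 (basis_vec c)
      = of_real (weight (4 * real k) (fst c) + weight (4 * real k) (snd c)) *\<^sub>C basis_vec c" if "c \<in> ?C" for c
  proof -
    obtain a b where Pair: "c = (a, b)" by (rule prod.exhaust)
    show ?thesis
      unfolding vir_beta_tensor Pair fst_conv snd_conv
      by (rule tensor_mode_conf2)
        (use k that Pair in \<open>auto simp: beta_mod_def lattice_module_def lattice_mode_vac
          lattice_mode_om_untwisted\<close>)
  qed
  show "((\<lambda>c. exp (- (2 * pi * y) * (weight (4 * real k) (fst c) + weight (4 * real k) (snd c)))) has_sum
      (part_sum \<int> y * theta_sum (2 * real k) r y) * (part_sum \<int> y * theta_sum (2 * real k) r' y)) ?C"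
    if "y > 0" for y
    using has_sum_tensor_weight[OF has_sum_untwisted[of "4 * real k" y r] has_sum_untwisted[of "4 * real k" y r']] k that
    by simp
qed

text \<open>Theta flips the charge, so fixed monomials have charge 0 in the second factor and
  contribute at most \<open>P\<close> there, without a theta series. Those of the right sign count
  with weight 1/2 and the others with -1/2, so the deviation from half of the full character is at
  most half of the fixed part.\<close>

lemma graded_char_lattice_eig:
  assumes k: "k \<ge> 1" and r': "2 * r' \<in> \<int>" and e: "e \<in> {1, -1}"
  obtains F where "graded_char (beta_sub k) (tensor_module (beta_mod k r) (beta_mod_eig k r' e)) F"
    "\<And>y. y > 0 \<Longrightarrow> \<bar>F y - (part_sum \<int> y * theta_sum (2 * real k) r y)
        * (part_sum \<int> y * theta_sum (2 * real k) r' y) / 2\<bar>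
      \<le> (part_sum \<int> y * theta_sum (2 * real k) r y) * part_sum \<int> y / 2"
proof -
  let ?B = "untwisted_basis r \<times> untwisted_basis r'"
  define p :: "fock_basis \<Rightarrow> fock_basis" where "p = (\<lambda>(A, x). (A, - x))"
  define s :: "fock_basis \<Rightarrow> complex" where "s b = (-1) ^ size (fst b)" for b
  define wt where "wt c = weight (4 * real k) (fst c) + weight (4 * real k) (snd c)" for c
  define f where "f y c = exp (- (2 * pi * y) * wt c)" for y c
  let ?M = "tensor_module (beta_mod k r) (beta_mod_eig k r' e)"
  \<comment> \<open>The condition on \<open>2 * r'\<close> says exactly that the coset is stable
    under the sign change; the values needed are 0 and 1/2.\<close>
  have neg: "- x \<in> coset r'" if "x \<in> coset r'" for x
  proof -
    have "- (x - r') - 2 * r' \<in> \<int>" using that r' unfolding coset_def by (blast intro: Ints_diff[OF Ints_minus])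
    moreover have "- (x - r') - 2 * r' = - x - r'" by simp
    ultimately show ?thesis unfolding coset_def by (metis mem_Collect_eq)
  qed
  have s1: "s b \<in> {1, -1}" for b by (cases "even (size (fst b))") (auto simp: s_def)
  have eig: "mspace (beta_mod_eig k r' e)
      = cvec.span ((\<lambda>b. basis_vec b + (e * s b) *\<^sub>C basis_vec (p b)) ` untwisted_basis r')"
    unfolding beta_mod_eig_def eigen_module_def beta_mod_def lattice_module_def lattice_space_span
    using eigenspace_span[OF clinear_theta, of "untwisted_basis r'" s p e] neg s1 e
    by (auto simp: theta_basis_vec s_def p_def untwisted_basis_def)
  have M: "mspace ?M = cvec.span ((\<lambda>b. basis_vec b + (e * s (snd b)) *\<^sub>C basis_vec (apsnd p b)) ` ?B)"
    unfolding tensor_module_def vmodule.simps eig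
    by (simp add: beta_mod_def lattice_module_def lattice_space_span tensor_space_symmetrized)
  have lin: "clinear (vir (beta_sub k) ?M 0)"
    unfolding vir_beta_tensor by (rule clinear_tensor_mode)
  have vb: "vir (beta_sub k) ?M 0 (basis_vec c) = of_real (wt c) *\<^sub>C basis_vec c" if "c \<in> ?B" for c
  proof -
    obtain a b where Pair: "c = (a, b)" by (rule prod.exhaust)
    show ?thesis
      unfolding vir_beta_tensor Pair wt_def fst_conv snd_conv
      by (rule tensor_mode_conf2)
        (use k that Pair in \<open>auto simp: beta_mod_def beta_mod_eig_def eigen_module_def lattice_module_def
          lattice_mode_vac lattice_mode_om_untwisted\<close>)
  qed
  have has: "(f y has_sum (part_sum \<int> y * theta_sum (2 * real k) r y)
        * (part_sum \<int> y * theta_sum (2 * real k) r' y)) ?B" if "y > 0" for y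
    using has_sum_tensor_weight[OF has_sum_untwisted[of "4 * real k" y r] has_sum_untwisted[of "4 * real k" y r']] k that
    by (simp add: f_def[abs_def] wt_def)
  let ?Fix = "{b \<in> ?B. apsnd p b = b}" and ?Fe = "{b \<in> ?B. apsnd p b = b \<and> s (snd b) = e}"
  define F where "F y = (infsum (f y) ?B - infsum (f y) ?Fix) / 2 + infsum (f y) ?Fe" for y
  have "graded_char (beta_sub k) ?M (\<lambda>y. (infsum (\<lambda>b. exp (- (2 * pi * y) * wt b)) ?B
      - infsum (\<lambda>b. exp (- (2 * pi * y) * wt b)) ?Fix) / 2 + infsum (\<lambda>b. exp (- (2 * pi * y) * wt b)) ?Fe)"
  proof (rule graded_char_symmetrized[OF _ _ _ _ _ e M lin vb])
    show "(\<lambda>b. exp (- (2 * pi * y) * wt b)) summable_on ?B" if "y > 0" for y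
      using has_sum_imp_summable[OF has[OF that]] by (simp add: f_def[abs_def])
  qed (use neg s1 in \<open>auto simp: p_def s_def untwisted_basis_def wt_def weight_def\<close>)
  then have F: "graded_char (beta_sub k) ?M F" by (simp add: F_def[abs_def] f_def[abs_def])
  show ?thesis
  proof (rule that[OF F])
    fix y :: real assume y: "y > 0"
    have sm: "f y summable_on X" if "X \<subseteq> ?B" for X
      using summable_on_subset_banach[OF has_sum_imp_summable[OF has[OF y]] that] .
    have f0: "f y b \<ge> 0" for b by (simp add: f_def)
    have "((\<lambda>A. exp (- (2 * pi * y) * sum_mset A)) has_sum part_sum \<int> y) (parts \<int>)"
      unfolding part_sum_def by (rule has_sum_infsum[OF part_sum_Ints(1)[OF y]])
    also have "?this \<longleftrightarrow> ((\<lambda>b. exp (- (2 * pi * y) * weight (4 * real k) b)) has_sum part_sum \<int> y) (parts \<int> \<times> {0})"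
      by (rule has_sum_reindex_bij_witness[of _ fst "\<lambda>A. (A, 0)"]) (auto simp: weight_def)
    finally have "(f y has_sum (part_sum \<int> y * theta_sum (2 * real k) r y) * part_sum \<int> y)
        (untwisted_basis r \<times> (parts \<int> \<times> {0}))" (is "(_ has_sum ?b) _")
      using has_sum_tensor_weight[OF has_sum_untwisted[of "4 * real k" y r]] k y
      by (simp add: f_def[abs_def] wt_def)
    then have "infsum (f y) ?Fix \<le> ?b"
      by (intro has_sum_mono2[OF has_sum_infsum[OF sm]]) (auto simp: p_def untwisted_basis_def f0)
    moreover have "infsum (f y) ?Fe \<le> infsum (f y) ?Fix"
      by (rule infsum_mono2) (auto intro: sm simp: f0)
    moreover have "0 \<le> infsum (f y) ?Fe" by (rule infsum_nonneg) (rule f0)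
    ultimately show "\<bar>F y - (part_sum \<int> y * theta_sum (2 * real k) r y)
        * (part_sum \<int> y * theta_sum (2 * real k) r' y) / 2\<bar> \<le> ?b / 2"
      unfolding F_def infsumI[OF has[OF y]] by (simp add: abs_le_iff field_simps)
  qed
qed

definition parity_sum :: "complex \<Rightarrow> real \<Rightarrow> real" where
  "parity_sum e y = (\<Sum>\<^sub>\<infinity>A\<in>{A \<in> parts half_integers. (-1) ^ size A = e}. exp (- (2 * pi * y) * sum_mset A))"

text \<open>On the twisted space theta is diagonal on monomials. The involution is
  \<open>id\<close>, every monomial is fixed, and no orbits of size two remain: the character counts
  the monomials whose number of parts has the parity given by \<open>e\<close>.\<close>

lemma graded_char_lattice_twisted:
  assumes k: "k \<ge> 1" and e: "e \<in> {1, -1}"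
  shows "graded_char (beta_sub k) (tensor_module (beta_mod k r) (beta_twisted_eig k t e))
    (\<lambda>y. (part_sum \<int> y * theta_sum (2 * real k) r y) * (exp (- (2 * pi * y) * flm_coeff 1 1) * parity_sum e y))"
proof -
  let ?B = "untwisted_basis r \<times> twisted_basis"
  define s :: "fock_basis \<Rightarrow> complex" where "s b = (-1) ^ size (fst b)" for b
  define wt where "wt c = weight (4 * real k) (fst c) + (weight (4 * real k) (snd c) + flm_coeff 1 1)" for c
  let ?f = "\<lambda>y b. exp (- (2 * pi * y) * wt b)"
  let ?M = "tensor_module (beta_mod k r) (beta_twisted_eig k t e)"
  have s1: "s b \<in> {1, -1}" for b by (cases "even (size (fst b))") (auto simp: s_def)
  have eig: "mspace (beta_twisted_eig k t e)
      = cvec.span ((\<lambda>b. basis_vec b + (e * s b) *\<^sub>C basis_vec (id b)) ` twisted_basis)"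
    unfolding beta_twisted_eig_def eigen_module_def
    using eigenspace_span[OF clinear_theta, of "twisted_basis" s id e] s1 e
    by (auto simp: theta_basis_vec s_def twisted_basis_def twisted_space_span)
  have M: "mspace ?M = cvec.span ((\<lambda>b. basis_vec b + (e * s (snd b)) *\<^sub>C basis_vec (apsnd id b)) ` ?B)"
    unfolding tensor_module_def vmodule.simps eig
    unfolding beta_mod_def lattice_module_def lattice_space_span vmodule.simps
    by (rule tensor_space_symmetrized)
  have lin: "clinear (vir (beta_sub k) ?M 0)"
    unfolding vir_beta_tensor by (rule clinear_tensor_mode)
  have vb: "vir (beta_sub k) ?M 0 (basis_vec c) = of_real (wt c) *\<^sub>C basis_vec c" if "c \<in> ?B" for c
  proof -
    obtain a b where Pair: "c = (a, b)" by (rule prod.exhaust)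
    show ?thesis
      unfolding vir_beta_tensor Pair wt_def fst_conv snd_conv
    proof (rule tensor_mode_conf2)
      show "mmode (beta_twisted_eig k t e) (basis_vec omega_basis) 1 (basis_vec b)
        = of_real (2 * (4 * real k) * (weight (4 * real k) b + flm_coeff 1 1)) *\<^sub>C basis_vec b"
        using twisted_mode_om_twisted[of "4 * real k" b t] k that Pair
        by (simp add: beta_twisted_eig_def eigen_module_def twisted_module_def)
    qed (use k that Pair in \<open>auto simp: beta_mod_def beta_twisted_eig_def eigen_module_def lattice_module_def
          twisted_module_def lattice_mode_vac twisted_mode_vac lattice_mode_om_untwisted\<close>)
  qed
  let ?H = "{A \<in> parts half_integers. (-1) ^ size A = e}"
  have half: "((\<lambda>b. exp (- (2 * pi * y) * (weight (4 * real k) b + flm_coeff 1 1))) has_sum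
      exp (- (2 * pi * y) * flm_coeff 1 1) * infsum (\<lambda>A. exp (- (2 * pi * y) * sum_mset A)) X) (X \<times> {0})"
    if "y > 0" "X \<subseteq> parts half_integers" for X y
  proof -
    have "((\<lambda>A. exp (- (2 * pi * y) * flm_coeff 1 1) * exp (- (2 * pi * y) * sum_mset A)) has_sum
      exp (- (2 * pi * y) * flm_coeff 1 1) * infsum (\<lambda>A. exp (- (2 * pi * y) * sum_mset A)) X) X"
      by (intro has_sum_cmult_right has_sum_infsum summable_on_subset_banach[OF part_sum_half_integers(1)] that)
    also have "?this \<longleftrightarrow> ((\<lambda>b. exp (- (2 * pi * y) * (weight (4 * real k) b + flm_coeff 1 1))) has_sum
      exp (- (2 * pi * y) * flm_coeff 1 1) * infsum (\<lambda>A. exp (- (2 * pi * y) * sum_mset A)) X) (X \<times> {0})"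
      by (rule has_sum_reindex_bij_witness[of _ fst "\<lambda>A. (A, 0)"])
        (auto simp: weight_def exp_add[symmetric] algebra_simps)
    finally show ?thesis .
  qed
  have has: "(?f y has_sum (part_sum \<int> y * theta_sum (2 * real k) r y) *
      (exp (- (2 * pi * y) * flm_coeff 1 1) * infsum (\<lambda>A. exp (- (2 * pi * y) * sum_mset A)) X))
      (untwisted_basis r \<times> (X \<times> {0}))" if "y > 0" "X \<subseteq> parts half_integers" for y X
    using has_sum_tensor_weight[OF has_sum_untwisted[of "4 * real k" y r] half[OF that]] k that
    by (simp add: wt_def)
  have "graded_char (beta_sub k) ?M (\<lambda>y. (infsum (?f y) ?B - infsum (?f y) {b \<in> ?B. apsnd id b = b}) / 2
      + infsum (?f y) {b \<in> ?B. apsnd id b = b \<and> s (snd b) = e})"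
  proof (rule graded_char_symmetrized[OF _ _ _ _ _ e M lin vb])
    show "?f y summable_on ?B" if "y > 0" for y
      using has_sum_imp_summable[OF has[OF that order_refl]] by (simp add: twisted_basis_def)
  qed (use s1 in auto)
  also have "(\<lambda>y. (infsum (?f y) ?B - infsum (?f y) {b \<in> ?B. apsnd id b = b}) / 2
      + infsum (?f y) {b \<in> ?B. apsnd id b = b \<and> s (snd b) = e})
      = (\<lambda>y. infsum (?f y) (untwisted_basis r \<times> (?H \<times> {0})))"
  proof -
    have "{b \<in> ?B. apsnd id b = b} = ?B" by auto
    moreover have "{b \<in> ?B. apsnd id b = b \<and> s (snd b) = e} = untwisted_basis r \<times> (?H \<times> {0})"
      by (auto simp: twisted_basis_def s_def)
    ultimately show ?thesis by (simp only: diff_self) simp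
  qed
  finally have "graded_char (beta_sub k) ?M (\<lambda>y. infsum (?f y) (untwisted_basis r \<times> (?H \<times> {0})))" .
  then show ?thesis
    unfolding graded_char_def parity_sum_def using infsumI[OF has[of _ ?H]] by auto
qed

text \<open>The pairs fixed by the swap are the \<open>(b, b)\<close>, of twice the weight of
  \<open>b\<close>. As weights are nonnegative, their sum is at most the character \<open>P\<close>
  times theta of a single factor, while the full tensor product has its square. All fixed pairs have
  sign 1, so the deviation is half of this sum.\<close>

lemma graded_char_perm_orbifold:
  assumes k: "k \<ge> 1"
  obtains G where "graded_char (perm_orbifold k) (adjoint_module (perm_orbifold k)) G"
    "\<And>y. y > 0 \<Longrightarrow> \<bar>G y - (part_sum \<int> y * theta_sum (real k) 0 y)\<^sup>2 / 2\<bar>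
      \<le> part_sum \<int> y * theta_sum (real k) 0 y / 2"
proof -
  let ?B = "untwisted_basis 0 \<times> untwisted_basis 0"
  define wt where "wt c = weight (2 * real k) (fst c) + weight (2 * real k) (snd c)" for c
  define f where "f y c = exp (- (2 * pi * y) * wt c)" for y c
  let ?M = "adjoint_module (perm_orbifold k)"
  let ?sw = "prod.swap :: fock_basis \<times> fock_basis \<Rightarrow> _"
  have swap: "clinear (swap_tensor :: fock2 \<Rightarrow> fock2)" unfolding swap_tensor_def by (rule clinear_lin_ext)
  have M: "mspace ?M = cvec.span ((\<lambda>b. basis_vec b + (1 * 1) *\<^sub>C basis_vec (?sw b)) ` ?B)"
    using eigenspace_span[OF swap, of ?B "\<lambda>_. 1" ?sw 1]
    by (auto simp: adjoint_module_def perm_orbifold_def fixed_voa_def tensor_voa_def lattice_voa_def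
        lattice_space_span tensor_space_basis swap_tensor_def scaleC_one)
  have vir: "vir (perm_orbifold k) ?M 0
      = tensor_mode (lattice_mode (2 * real k)) (lattice_mode (2 * real k)) (conf2 (2 * real k)) 1"
    unfolding vir_def conformal_perm_orbifold
    by (simp add: fun_eq_iff adjoint_module_def perm_orbifold_def fixed_voa_def tensor_voa_def lattice_voa_def)
  have lin: "clinear (vir (perm_orbifold k) ?M 0)"
    unfolding vir by (rule clinear_tensor_mode)
  have vb: "vir (perm_orbifold k) ?M 0 (basis_vec c) = of_real (wt c) *\<^sub>C basis_vec c" if "c \<in> ?B" for c
  proof -
    obtain a b where Pair: "c = (a, b)" by (rule prod.exhaust)
    show ?thesis
      unfolding vir Pair wt_def fst_conv snd_conv
      by (rule tensor_mode_conf2)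
        (use k that Pair in \<open>auto simp: lattice_mode_vac lattice_mode_om_untwisted\<close>)
  qed
  have hasZ: "((\<lambda>b. exp (- (2 * pi * y) * weight (2 * real k) b)) has_sum
      part_sum \<int> y * theta_sum (real k) 0 y) (untwisted_basis 0)" if "y > 0" for y
    using has_sum_untwisted[of "2 * real k" y 0] k that by simp
  have has: "(f y has_sum (part_sum \<int> y * theta_sum (real k) 0 y) * (part_sum \<int> y * theta_sum (real k) 0 y)) ?B"
    if "y > 0" for y
    using has_sum_tensor_weight[OF hasZ[OF that] hasZ[OF that]]
    by (simp add: f_def[abs_def] wt_def)
  let ?Fix = "{b \<in> ?B. ?sw b = b}"
  define G where "G y = (infsum (f y) ?B - infsum (f y) ?Fix) / 2 + infsum (f y) ?Fix" for y
  have "graded_char (perm_orbifold k) ?M (\<lambda>y. (infsum (\<lambda>b. exp (- (2 * pi * y) * wt b)) ?B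
      - infsum (\<lambda>b. exp (- (2 * pi * y) * wt b)) ?Fix) / 2
      + infsum (\<lambda>b. exp (- (2 * pi * y) * wt b)) {b \<in> ?B. ?sw b = b \<and> (1 :: complex) = 1})"
  proof (rule graded_char_symmetrized[OF _ _ _ _ _ _ M lin vb])
    show "(\<lambda>b. exp (- (2 * pi * y) * wt b)) summable_on ?B" if "y > 0" for y
      using has_sum_imp_summable[OF has[OF that]] by (simp add: f_def[abs_def])
  qed (auto simp: wt_def)
  then have G: "graded_char (perm_orbifold k) ?M G" by (simp add: G_def[abs_def] f_def[abs_def])
  show ?thesis
  proof (rule that[OF G])
    fix y :: real assume y: "y > 0"
    have sm: "f y summable_on ?Fix"
      using summable_on_subset_banach[OF has_sum_imp_summable[OF has[OF y]]] by auto
    have Fix: "?Fix = (\<lambda>b. (b, b)) ` untwisted_basis 0"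
    proof (intro equalityI subsetI)
      fix c assume c: "c \<in> ?Fix"
      then have "fst (prod.swap c) = fst c" by simp
      then have "c = (fst c, fst c)" by (simp add: prod_eq_iff)
      moreover have "fst c \<in> untwisted_basis 0" using c by (auto simp only: mem_Collect_eq mem_Times_iff)
      ultimately show "c \<in> (\<lambda>b. (b, b)) ` untwisted_basis 0" by (rule image_eqI)
    qed auto
    have w0: "0 \<le> weight (2 * real k) b" if "b \<in> untwisted_basis 0" for b
      using that by (auto simp: weight_def untwisted_basis_def intro!: add_nonneg_nonneg sum_mset_parts_nonneg)
    have "infsum (f y) ?Fix \<le> infsum (\<lambda>b. exp (- (2 * pi * y) * weight (2 * real k) b)) (untwisted_basis 0)"
    proof -
      have "infsum (f y) ?Fix = infsum (\<lambda>b. f y (b, b)) (untwisted_basis 0)"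
        unfolding Fix by (simp add: infsum_reindex inj_on_def o_def)
      also have "\<dots> \<le> infsum (\<lambda>b. exp (- (2 * pi * y) * weight (2 * real k) b)) (untwisted_basis 0)"
      proof (rule infsum_mono)
        show "(\<lambda>b. f y (b, b)) summable_on untwisted_basis 0"
          using sm unfolding Fix by (simp add: summable_on_reindex inj_on_def o_def)
        show "(\<lambda>b. exp (- (2 * pi * y) * weight (2 * real k) b)) summable_on untwisted_basis 0"
          using hasZ[OF y] by (rule has_sum_imp_summable)
        show "f y (b, b) \<le> exp (- (2 * pi * y) * weight (2 * real k) b)" if "b \<in> untwisted_basis 0" for b
          using w0[OF that] y by (simp add: f_def wt_def)
      qed
      finally show ?thesis .
    qed
    also have "\<dots> = part_sum \<int> y * theta_sum (real k) 0 y" by (rule infsumI[OF hasZ[OF y]])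
    finally have "infsum (f y) ?Fix \<le> part_sum \<int> y * theta_sum (real k) 0 y" .
    moreover have "0 \<le> infsum (f y) ?Fix" by (rule infsum_nonneg) (simp add: f_def)
    ultimately show "\<bar>G y - (part_sum \<int> y * theta_sum (real k) 0 y)\<^sup>2 / 2\<bar>
      \<le> part_sum \<int> y * theta_sum (real k) 0 y / 2"
      unfolding G_def infsumI[OF has[OF y]] power2_eq_square by (simp add: abs_le_iff field_simps)
  qed
qed

section \<open>Quantum dimensions\<close>

lemma om_vac_untwisted: "omega_basis \<in> untwisted_basis 0" "vac_basis \<in> untwisted_basis 0"
  by (auto simp: omega_basis_def vac_basis_def untwisted_basis_def parts_def coset_def)

text \<open>The isomorphism with the restriction commutes with modes of vectors of the subalgebra;
  to compare the operators \<open>L(0)\<close> the conformal vector must be one of them.\<close>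

lemma conf2_in_beta_sub: "conf2 (4 * real k) \<in> vspace (beta_sub k)"
proof -
  have omega_basis: "basis_vec omega_basis \<in> vspace (beta_plus k)" and vac_basis: "basis_vec vac_basis \<in> vspace (beta_plus k)"
    using om_vac_untwisted
    by (auto simp: beta_plus_def fixed_voa_def lattice_voa_def lattice_space_span cvec.span_base
        omega_basis_def[symmetric] theta_basis_vec scaleC_one)
      (simp_all add: omega_basis_def vac_basis_def theta_basis_vec scaleC_one)
  have omega_basis': "basis_vec omega_basis \<in> vspace (lattice_voa (4 * real k))"
    and vac_basis': "basis_vec vac_basis \<in> vspace (lattice_voa (4 * real k))"
    using om_vac_untwisted by (auto simp: lattice_voa_def lattice_space_span cvec.span_base)
  have "tensor (basis_vec omega_basis) (basis_vec vac_basis) \<in> vspace (beta_sub k)"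
    "tensor (basis_vec vac_basis) (basis_vec omega_basis) \<in> vspace (beta_sub k)"
    unfolding beta_sub_def tensor_voa_def tensor_space_def
    using omega_basis vac_basis omega_basis' vac_basis' by (auto intro!: cvec.span_base simp del: tensor_basis_vec)
  then show ?thesis
    unfolding conf2_def tensor_basis_vec
    by (auto simp: beta_sub_def tensor_voa_def tensor_space_def intro!: cvec.span_scale cvec.span_add)
qed

text \<open>The module axioms grant closure and linearity for modes of vectors of
  \<open>\<U>\<close> only, so this membership is what makes \<open>L(0)\<close> a linear operator
  on a module.\<close>

lemma conf2_in_perm_orbifold: "conf2 (2 * real k) \<in> vspace (perm_orbifold k)"
proof -
  let ?B = "untwisted_basis 0 \<times> untwisted_basis 0"
  have "basis_vec (omega_basis, vac_basis) \<in> cvec.span (basis_vec ` ?B)" "basis_vec (vac_basis, omega_basis) \<in> cvec.span (basis_vec ` ?B)"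
    using om_vac_untwisted by (auto intro: cvec.span_base)
  then have "conf2 (2 * real k) \<in> cvec.span (basis_vec ` ?B)"
    unfolding conf2_def by (intro cvec.span_scale cvec.span_add)
  moreover have "swap_tensor (conf2 (2 * real k)) = conf2 (2 * real k)"
    unfolding swap_tensor_def conf2_def by (simp add: add.commute)
  ultimately show ?thesis
    by (simp add: perm_orbifold_def fixed_voa_def tensor_voa_def lattice_voa_def lattice_space_span
        tensor_space_basis)
qed

text \<open>The squares of \<open>\<alpha>^1 + \<alpha>^2\<close> and
  \<open>\<alpha>^1 - \<alpha>^2\<close> at mode -1 add up to twice the sum of the two squares, the
  mixed terms cancelling. The factor 2 turns \<open>1 / (8k)\<close> into
  \<open>1 / (4k)\<close>.\<close>

lemma beta_embed_conf2:
  assumes "k \<ge> 1"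
  shows "beta_embed k (conf2 (4 * real k)) = conf2 (2 * real k)"
proof -
  have L: "osc_left N (- 1) (basis_vec ((A, x), b)) = basis_vec ((add_mset 1 A, x), b)" for N A x b
    by (simp add: osc_left_def osc_basis_vec)
  have R: "osc_right N (- 1) (basis_vec (a, (B, y))) = basis_vec (a, (add_mset 1 B, y))" for N a B y
    by (simp add: osc_right_def osc_basis_vec)
  have add: "osc_left N j (u + v) = osc_left N j u + osc_left N j v"
    "osc_right N j (u + v) = osc_right N j u + osc_right N j v"
    "osc_left N j (u - v) = osc_left N j u - osc_left N j v"
    "osc_right N j (u - v) = osc_right N j u - osc_right N j v" for N j u v
    by (simp_all add: osc_left_def osc_right_def)
  let ?LL = "basis_vec (({#1, 1#}, 0), ({#}, 0)) :: fock2"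
    and ?RR = "basis_vec (({#}, 0), ({#1, 1#}, 0)) :: fock2"
    and ?LR = "basis_vec (({#1#}, 0), ({#1#}, 0)) :: fock2"
  have 1: "beta_embed k (basis_vec (omega_basis, vac_basis)) = ?LL + ?LR + (?LR + ?RR)"
    by (simp add: beta_embed_def omega_basis_def vac_basis_def L R add)
  have 2: "beta_embed k (basis_vec (vac_basis, omega_basis)) = ?LL - ?LR - (?LR - ?RR)"
    by (simp add: beta_embed_def omega_basis_def vac_basis_def L R add)
  have "beta_embed k (conf2 (4 * real k)) = of_real (1 / (2 * (4 * real k))) *\<^sub>C
      (beta_embed k (basis_vec (omega_basis, vac_basis)) + beta_embed k (basis_vec (vac_basis, omega_basis)))"
    unfolding conf2_def beta_embed_def lin_ext_scale lin_ext_add ..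
  also have "beta_embed k (basis_vec (omega_basis, vac_basis)) + beta_embed k (basis_vec (vac_basis, omega_basis))
      = (1 + 1) *\<^sub>C (?LL + ?RR)"
    unfolding 1 2 scaleC_add_left scaleC_one by simp
  also have "of_real (1 / (2 * (4 * real k))) *\<^sub>C (1 + 1) *\<^sub>C (?LL + ?RR) = conf2 (2 * real k)"
    using assms unfolding scaleC_scaleC by (simp add: conf2_def omega_basis_def vac_basis_def)
  finally show ?thesis .
qed

text \<open>The embedding preserves the conformal vector, so the isomorphism \<open>f\<close>
  intertwines the two operators \<open>L(0)\<close> and restricts to bijections of weight spaces.
  Dimensions agree by transport along \<open>f\<close>; the finite bases on the side of
  \<open>M\<close> come from the module axiom on weight spaces.\<close>

lemma graded_char_restriction:
  assumes k: "k \<ge> 1" and M: "irreducible_with_restriction k M N1 N2"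
    and F: "graded_char (beta_sub k) (direct_sum N1 N2) F"
  shows "graded_char (perm_orbifold k) M F"
proof -
  let ?U = "perm_orbifold k" and ?c = "conf2 (2 * real k)" and ?D = "direct_sum N1 N2"
  have vm: "voa_module ?U M"
    using M by (simp add: irreducible_with_restriction_def irreducible_module_def)
  have sub: "cvec.subspace (mspace M)"
    using vm unfolding voa_module_def by (elim conjE)
  have cU: "?c \<in> vspace ?U" by (rule conf2_in_perm_orbifold)
  have "\<forall>u\<in>vspace ?U. \<forall>n. \<forall>m\<in>mspace M. mmode M u n m \<in> mspace M"
    using vm unfolding voa_module_def by (elim conjE)
  then have closed: "mmode M ?c 1 m \<in> mspace M" if "m \<in> mspace M" for m
    using that cU by blast
  have "\<forall>u\<in>vspace ?U. \<forall>a n. \<forall>m\<in>mspace M. \<forall>m'\<in>mspace M.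
      mmode M u n (m + m') = mmode M u n m + mmode M u n m' \<and> mmode M u n (a *\<^sub>C m) = a *\<^sub>C mmode M u n m"
    using vm unfolding voa_module_def by (elim conjE)
  then have modeadd: "mmode M ?c 1 (m + m') = mmode M ?c 1 m + mmode M ?c 1 m'"
    and modescale: "mmode M ?c 1 (a *\<^sub>C m) = a *\<^sub>C mmode M ?c 1 m"
    if "m \<in> mspace M" "m' \<in> mspace M" for m m' a
    using that cU by blast+
  have findim: "\<forall>w. \<exists>B. finite B \<and> weight_space ?U M w \<subseteq> cvec.span B"
    using vm unfolding voa_module_def by (elim conjE)
  have ws: "weight_space ?U M w = {m \<in> mspace M. mmode M ?c 1 m = w *\<^sub>C m}" for w
    by (simp add: weight_space_def vir_def conformal_perm_orbifold)
  have wsD: "weight_space (beta_sub k) ?D w = {m \<in> mspace ?D. mmode ?D (conf2 (4 * real k)) 1 m = w *\<^sub>C m}" for w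
    by (simp add: weight_space_def vir_def conformal_beta_sub)
  have subw: "cvec.subspace (weight_space ?U M w)" for w
  proof (rule cvec.subspaceI)
    \<comment> \<open>The mode is linear on \<open>mspace M\<close> only, so its value at 0 is
      obtained by writing 0 as a multiple of itself.\<close>
    have "mmode M ?c 1 (0 *\<^sub>C 0) = 0 *\<^sub>C mmode M ?c 1 0"
      by (rule modescale) (auto intro: cvec.subspace_0[OF sub])
    then show "0 \<in> weight_space ?U M w"
      by (simp add: ws cvec.subspace_0[OF sub])
  qed (auto simp: ws modeadd modescale cvec.subspace_add[OF sub] cvec.subspace_scale[OF sub]
      scaleC_add_right scaleC_scaleC mult.commute[of w])
  obtain f where bij: "bij_betw f (mspace M) (mspace ?D)"
    and fadd: "\<And>x y. x \<in> mspace M \<Longrightarrow> y \<in> mspace M \<Longrightarrow> f (x + y) = f x + f y"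
    and fscale: "\<And>a x. x \<in> mspace M \<Longrightarrow> f (a *\<^sub>C x) = a *\<^sub>C f x"
    and fmode: "\<And>u n x. u \<in> vspace (beta_sub k) \<Longrightarrow> x \<in> mspace M \<Longrightarrow>
      f (mmode M (beta_embed k u) n x) = mmode ?D u n (f x)"
    using M unfolding irreducible_with_restriction_def module_iso_def pullback_def vmodule.simps by blast
  have fc: "f (mmode M ?c 1 x) = mmode ?D (conf2 (4 * real k)) 1 (f x)" if "x \<in> mspace M" for x
    using fmode[OF conf2_in_beta_sub that, of 1] beta_embed_conf2[OF k] by simp
  have eq: "mmode M ?c 1 x = w *\<^sub>C x \<longleftrightarrow> mmode ?D (conf2 (4 * real k)) 1 (f x) = w *\<^sub>C f x"
    if x: "x \<in> mspace M" for x w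
  proof -
    have "mmode M ?c 1 x = w *\<^sub>C x \<longleftrightarrow> f (mmode M ?c 1 x) = f (w *\<^sub>C x)"
      using bij_betw_imp_inj_on[OF bij] closed[OF x] cvec.subspace_scale[OF sub x]
      by (auto dest: inj_onD)
    then show ?thesis using fc[OF x] fscale[OF x] by simp
  qed
  have bijw: "bij_betw f (weight_space ?U M w) (weight_space (beta_sub k) ?D w)" for w
    unfolding bij_betw_def
  proof
    show "inj_on f (weight_space ?U M w)"
      using bij_betw_imp_inj_on[OF bij] by (rule inj_on_subset) (auto simp: ws)
    show "f ` weight_space ?U M w = weight_space (beta_sub k) ?D w"
    proof (intro equalityI subsetI)
      fix z assume z: "z \<in> weight_space (beta_sub k) ?D w"
      then obtain x where "x \<in> mspace M" "z = f x"
        using bij_betw_imp_surj_on[OF bij] unfolding wsD by blast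
      with z show "z \<in> f ` weight_space ?U M w" by (simp add: ws wsD eq)
    next
      fix z assume "z \<in> f ` weight_space ?U M w"
      then obtain x where "x \<in> mspace M" "mmode M ?c 1 x = w *\<^sub>C x" "z = f x" by (auto simp: ws)
      then show "z \<in> weight_space (beta_sub k) ?D w"
        using bij_betw_imp_surj_on[OF bij] eq by (auto simp: wsD simp del: split_paired_All)
    qed
  qed
  have dim: "cvec.dim (weight_space ?U M w) = cvec.dim (weight_space (beta_sub k) ?D w)" for w
    by (rule dim_bij_additive[OF subw bijw]) (auto simp: ws fadd fscale)
  have "\<exists>B. finite B \<and> cvec.independent B \<and> weight_space ?U M w = cvec.span B" for w
  proof -
    obtain C where C: "finite C" "weight_space ?U M w \<subseteq> cvec.span C" using spec[OF findim, of w] by (elim exE conjE)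
    obtain B where B: "B \<subseteq> weight_space ?U M w" "cvec.independent B" "weight_space ?U M w \<subseteq> cvec.span B"
      by (rule cvec.basis_exists[of "weight_space ?U M w"]) (rule that)
    have "finite B"
      using cvec.independent_span_bound[OF C(1) B(2) order_trans[OF B(1) C(2)]] by simp
    moreover have "weight_space ?U M w = cvec.span B"
      by (rule antisym[OF B(3) cvec.span_minimal[OF B(1) subw]])
    ultimately show ?thesis using B(2) by blast
  qed
  then show ?thesis
    using F unfolding graded_char_def dim by simp
qed

section \<open>Limits of characters multiplied by \<open>y / P^2\<close>\<close>

lemma at_right_pos: "\<forall>\<^sub>F y in at_right 0. (0 :: real) < y"
  by (rule eventually_at_right_less)

text \<open>The normalized character of \<open>\<U>\<close> tends to half the limit
  \<open>1 / (2k)\<close> of \<open>y\<close> times the squared theta series, which explains the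
  factor \<open>4 * real k\<close>. Its error is at most half of \<open>y\<close> times theta
  divided by \<open>P\<close>. Since \<open>P \<ge> 1\<close>, this is bounded by
  \<open>sqrt y\<close> times a convergent quantity.\<close>

lemma has_qdim_restriction:
  assumes k: "k \<ge> 1" and M: "irreducible_with_restriction k M N1 N2"
    and F1: "graded_char (beta_sub k) N1 F1" and F2: "graded_char (beta_sub k) N2 F2"
    and L1: "((\<lambda>y. y * F1 y / (part_sum \<int> y)\<^sup>2) \<longlongrightarrow> L1) (at_right 0)"
    and L2: "((\<lambda>y. y * F2 y / (part_sum \<int> y)\<^sup>2) \<longlongrightarrow> L2) (at_right 0)"
  shows "has_qdim (perm_orbifold k) M (complex_of_real ((L1 + L2) * (4 * real k)))"
proof -
  let ?P = "part_sum \<int>" and ?t = "theta_sum (real k) 0"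
  obtain G where G: "graded_char (perm_orbifold k) (adjoint_module (perm_orbifold k)) G"
    and Gb: "\<And>y. y > 0 \<Longrightarrow> \<bar>G y - (?P y * ?t y)\<^sup>2 / 2\<bar> \<le> ?P y * ?t y / 2"
    using graded_char_perm_orbifold[OF k] by blast
  have t: "((\<lambda>y. sqrt y * ?t y) \<longlongrightarrow> 1 / sqrt (2 * real k)) (at_right 0)"
    using theta_sum_asymptotics[of "real k" 0] k by simp
  have s: "((\<lambda>y. sqrt y) \<longlongrightarrow> 0) (at_right 0)"
    using tendsto_real_sqrt[OF tendsto_ident_at[of "0 :: real" "{0<..}"]] by simp
  have "((\<lambda>y. y * G y / (?P y)\<^sup>2 - (sqrt y * ?t y)\<^sup>2 / 2) \<longlongrightarrow> 0) (at_right 0)"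
  proof (rule Lim_null_comparison)
    show "((\<lambda>y. sqrt y * (sqrt y * ?t y) / 2) \<longlongrightarrow> 0) (at_right 0)"
      using tendsto_divide[OF tendsto_mult[OF s t] tendsto_const[of 2]] by simp
    show "\<forall>\<^sub>F y in at_right 0. norm (y * G y / (?P y)\<^sup>2 - (sqrt y * ?t y)\<^sup>2 / 2) \<le> sqrt y * (sqrt y * ?t y) / 2"
      using at_right_pos
    proof eventually_elim
      case (elim y)
      have P: "?P y \<ge> 1" using part_sum_Ints(2)[OF elim] .
      have t0: "0 \<le> ?t y" unfolding theta_sum_def by (rule infsum_nonneg) simp
      have "y * G y / (?P y)\<^sup>2 - (sqrt y * ?t y)\<^sup>2 / 2 = y / (?P y)\<^sup>2 * (G y - (?P y * ?t y)\<^sup>2 / 2)"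
        using P elim by (simp add: power_mult_distrib field_simps)
      then have "norm (y * G y / (?P y)\<^sup>2 - (sqrt y * ?t y)\<^sup>2 / 2) = y / (?P y)\<^sup>2 * \<bar>G y - (?P y * ?t y)\<^sup>2 / 2\<bar>"
        using elim by (simp add: abs_mult)
      also have "\<dots> \<le> y / (?P y)\<^sup>2 * (?P y * ?t y / 2)"
        using Gb[OF elim] elim by (intro mult_left_mono) auto
      also have "\<dots> = y * ?t y / 2 / ?P y" using P by (simp add: power2_eq_square)
      also have "\<dots> \<le> y * ?t y / 2 / 1"
        using P t0 elim by (intro divide_left_mono) auto
      also have "\<dots> = sqrt y * (sqrt y * ?t y) / 2" using elim by simp
      finally show ?case .
    qed
  qed
  moreover have "((\<lambda>y. (sqrt y * ?t y)\<^sup>2 / 2) \<longlongrightarrow> (1 / sqrt (2 * real k))\<^sup>2 / 2) (at_right 0)"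
    by (intro tendsto_intros t) simp
  ultimately have "((\<lambda>y. y * G y / (?P y)\<^sup>2) \<longlongrightarrow> (1 / sqrt (2 * real k))\<^sup>2 / 2) (at_right 0)"
    by (rule Lim_transform[rotated])
  then have GL: "((\<lambda>y. y * G y / (?P y)\<^sup>2) \<longlongrightarrow> 1 / (4 * real k)) (at_right 0)"
    using k by (simp add: power_divide)
  have "((\<lambda>y. (y * F1 y / (?P y)\<^sup>2 + y * F2 y / (?P y)\<^sup>2) / (y * G y / (?P y)\<^sup>2))
      \<longlongrightarrow> (L1 + L2) / (1 / (4 * real k))) (at_right 0)"
    using k by (intro tendsto_divide tendsto_add L1 L2 GL) simp
  moreover have "\<forall>\<^sub>F y in at_right 0. (y * F1 y / (?P y)\<^sup>2 + y * F2 y / (?P y)\<^sup>2) / (y * G y / (?P y)\<^sup>2)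
      = (F1 y + F2 y) / G y"
    using at_right_pos
  proof eventually_elim
    case (elim y)
    have "y / (?P y)\<^sup>2 \<noteq> 0" using part_sum_Ints(2)[OF elim] elim by auto
    then have "(y / (?P y)\<^sup>2 * (F1 y + F2 y)) / (y / (?P y)\<^sup>2 * G y) = (F1 y + F2 y) / G y"
      by (rule mult_divide_mult_cancel_left)
    then show ?case by (simp add: distrib_left add_divide_distrib)
  qed
  ultimately have "((\<lambda>y. (F1 y + F2 y) / G y) \<longlongrightarrow> (L1 + L2) * (4 * real k)) (at_right 0)"
    by (simp add: tendsto_cong)
  then show ?thesis
    by (rule has_qdim_graded[OF graded_char_restriction[OF k M graded_char_direct_sum[OF F1 F2]] G])
qed

context
  fixes k :: nat
  assumes k: "k \<ge> 1"
begin

lemma theta_lim: "((\<lambda>y. sqrt y * theta_sum (2 * real k) r y) \<longlongrightarrow> 1 / sqrt (4 * real k)) (at_right 0)"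
  using theta_sum_asymptotics[of "2 * real k" r] k by simp

lemma lattice_lattice_limit:
  "((\<lambda>y. y * ((part_sum \<int> y * theta_sum (2 * real k) r y) * (part_sum \<int> y * theta_sum (2 * real k) r' y))
     / (part_sum \<int> y)\<^sup>2) \<longlongrightarrow> 1 / (4 * real k)) (at_right 0)"
proof -
  have "((\<lambda>y. (sqrt y * theta_sum (2 * real k) r y) * (sqrt y * theta_sum (2 * real k) r' y))
      \<longlongrightarrow> 1 / sqrt (4 * real k) * (1 / sqrt (4 * real k))) (at_right 0)"
    by (intro tendsto_mult theta_lim)
  moreover have "1 / sqrt (4 * real k) * (1 / sqrt (4 * real k)) = 1 / (4 * real k)"
    by simp
  moreover have "\<forall>\<^sub>F y in at_right 0. (sqrt y * theta_sum (2 * real k) r y) * (sqrt y * theta_sum (2 * real k) r' y)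
      = y * ((part_sum \<int> y * theta_sum (2 * real k) r y) * (part_sum \<int> y * theta_sum (2 * real k) r' y))
     / (part_sum \<int> y)\<^sup>2"
    using at_right_pos
  proof eventually_elim
    case (elim y)
    have "(sqrt y * a) * (sqrt y * b) = y * ((P * a) * (P * b)) / P\<^sup>2" if "P \<noteq> 0" for a b P
      using that elim real_sqrt_mult_self[of y] by (simp add: power2_eq_square field_simps)
    moreover have "part_sum \<int> y \<noteq> 0" using part_sum_Ints(2)[OF elim] by auto
    ultimately show ?case .
  qed
  ultimately show ?thesis by (simp add: tendsto_cong)
qed

text \<open>After normalization the permitted error is \<open>sqrt y\<close> times the convergent
  \<open>sqrt y * theta_sum (2 * real k) r y\<close>, up to the factor 1/2, so the limit is half of
  that for the full tensor product.\<close>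

lemma lattice_eig_limit:
  assumes F: "\<And>y. y > 0 \<Longrightarrow> \<bar>F y - (part_sum \<int> y * theta_sum (2 * real k) r y)
        * (part_sum \<int> y * theta_sum (2 * real k) r' y) / 2\<bar>
      \<le> (part_sum \<int> y * theta_sum (2 * real k) r y) * part_sum \<int> y / 2"
  shows "((\<lambda>y. y * F y / (part_sum \<int> y)\<^sup>2) \<longlongrightarrow> 1 / (8 * real k)) (at_right 0)"
proof -
  let ?P = "part_sum \<int>" and ?t = "theta_sum (2 * real k)"
  let ?H = "\<lambda>y. y * ((?P y * ?t r y) * (?P y * ?t r' y)) / (?P y)\<^sup>2"
  have "((\<lambda>y. y * F y / (?P y)\<^sup>2 - ?H y / 2) \<longlongrightarrow> 0) (at_right 0)"
  proof (rule Lim_null_comparison)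
    have s: "((\<lambda>y. sqrt y) \<longlongrightarrow> 0) (at_right 0)"
      using tendsto_real_sqrt[OF tendsto_ident_at[of "0 :: real" "{0<..}"]] by simp
    show "((\<lambda>y. sqrt y * (sqrt y * ?t r y) / 2) \<longlongrightarrow> 0) (at_right 0)"
      using tendsto_divide[OF tendsto_mult[OF s theta_lim[of r]] tendsto_const[of 2]] by simp
    show "\<forall>\<^sub>F y in at_right 0. norm (y * F y / (?P y)\<^sup>2 - ?H y / 2) \<le> sqrt y * (sqrt y * ?t r y) / 2"
      using at_right_pos
    proof eventually_elim
      case (elim y)
      have P: "?P y > 0" using part_sum_Ints(2)[OF elim] by linarith
      have "y * F y / (?P y)\<^sup>2 - ?H y / 2 = y / (?P y)\<^sup>2 * (F y - (?P y * ?t r y) * (?P y * ?t r' y) / 2)"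
        by (simp add: right_diff_distrib)
      then have "norm (y * F y / (?P y)\<^sup>2 - ?H y / 2)
          = y / (?P y)\<^sup>2 * \<bar>F y - (?P y * ?t r y) * (?P y * ?t r' y) / 2\<bar>"
        using elim by (simp add: abs_mult)
      also have "\<dots> \<le> y / (?P y)\<^sup>2 * ((?P y * ?t r y) * ?P y / 2)"
        using F[OF elim] elim by (intro mult_left_mono) auto
      also have "\<dots> = sqrt y * (sqrt y * ?t r y) / 2" using P elim by (simp add: power2_eq_square)
      finally show ?case .
    qed
  qed
  moreover have "((\<lambda>y. ?H y / 2) \<longlongrightarrow> 1 / (4 * real k) / 2) (at_right 0)"
    by (rule tendsto_divide[OF lattice_lattice_limit tendsto_const]) simp
  ultimately have "((\<lambda>y. y * F y / (?P y)\<^sup>2) \<longlongrightarrow> 1 / (4 * real k) / 2) (at_right 0)"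
    by (rule Lim_transform[rotated])
  then show ?thesis by simp
qed

lemma lattice_eig_char:
  assumes r': "2 * r' \<in> \<int>" and e: "e \<in> {1, -1}"
  obtains F where "graded_char (beta_sub k) (tensor_module (beta_mod k r) (beta_mod_eig k r' e)) F"
    "((\<lambda>y. y * F y / (part_sum \<int> y)\<^sup>2) \<longlongrightarrow> 1 / (8 * real k)) (at_right 0)"
proof (rule graded_char_lattice_eig[OF k r' e, of r])
  fix F assume F: "graded_char (beta_sub k) (tensor_module (beta_mod k r) (beta_mod_eig k r' e)) F"
    and "\<And>y. y > 0 \<Longrightarrow> \<bar>F y - (part_sum \<int> y * theta_sum (2 * real k) r y)
        * (part_sum \<int> y * theta_sum (2 * real k) r' y) / 2\<bar>
      \<le> (part_sum \<int> y * theta_sum (2 * real k) r y) * part_sum \<int> y / 2"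
  then show thesis using that[OF F lattice_eig_limit] by blast
qed

text \<open>The factor \<open>y\<close> is split into two square roots, one for the theta series and
  one for \<open>Q/P\<close>. The limit is left as a product of four numbers: theta series, weight
  shift, parity, and \<open>Q/P\<close>.\<close>

lemma lattice_twisted_limit:
  assumes e: "e \<in> {1, -1}"
  shows "((\<lambda>y. y * ((part_sum \<int> y * theta_sum (2 * real k) r y) * (exp (- (2 * pi * y) * c) * parity_sum e y))
     / (part_sum \<int> y)\<^sup>2) \<longlongrightarrow> 1 / sqrt (4 * real k) * 1 * (1 / 2) * (1 / sqrt 2)) (at_right 0)"
proof -
  let ?P = "part_sum \<int>" and ?Q = "part_sum half_integers" and ?t = "theta_sum (2 * real k)"
  have "((\<lambda>y. exp (- (2 * pi * y) * c)) \<longlongrightarrow> exp (- (2 * pi * 0) * c)) (at_right 0)"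
    by (intro tendsto_intros)
  then have ex: "((\<lambda>y. exp (- (2 * pi * y) * c)) \<longlongrightarrow> 1) (at_right 0)" by simp
  have "((\<lambda>y. (sqrt y * ?t r y) * exp (- (2 * pi * y) * c) * (parity_sum e y / ?Q y) * (sqrt y * (?Q y / ?P y)))
     \<longlongrightarrow> 1 / sqrt (4 * real k) * 1 * (1 / 2) * (1 / sqrt 2)) (at_right 0)"
    by (intro tendsto_mult theta_lim ex part_sum_ratio part_sum_parity[OF e, folded parity_sum_def])
  moreover have "\<forall>\<^sub>F y in at_right 0.
      (sqrt y * ?t r y) * exp (- (2 * pi * y) * c) * (parity_sum e y / ?Q y) * (sqrt y * (?Q y / ?P y))
      = y * ((?P y * ?t r y) * (exp (- (2 * pi * y) * c) * parity_sum e y)) / (?P y)\<^sup>2"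
    using at_right_pos
  proof eventually_elim
    case (elim y)
    have "(sqrt y * t) * x * (E / Q) * (sqrt y * (Q / P)) = y * ((P * t) * (x * E)) / P\<^sup>2"
      if "P \<noteq> 0" "Q \<noteq> 0" for t x E P Q
    proof -
      have "(sqrt y * t) * x * (E / Q) * (sqrt y * (Q / P)) = (sqrt y * sqrt y) * (t * x * E) / P"
        using that by simp
      then show ?thesis using that elim by (simp add: power2_eq_square)
    qed
    moreover have "?P y \<noteq> 0" "?Q y \<noteq> 0"
      using part_sum_Ints(2)[OF elim] part_sum_half_integers(2)[OF elim] by auto
    ultimately show ?case .
  qed
  ultimately show ?thesis by (rule Lim_transform_eventually)
qed

lemma twisted_qdim_value:
  "(1 / sqrt (4 * real k) * 1 * (1 / 2) * (1 / sqrt 2) + 1 / sqrt (4 * real k) * 1 * (1 / 2) * (1 / sqrt 2))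
     * (4 * real k) = sqrt (2 * real k)"
proof -
  have "(1 / sqrt (4 * real k) * 1 * (1 / 2) * (1 / sqrt 2) + 1 / sqrt (4 * real k) * 1 * (1 / 2) * (1 / sqrt 2))
     * (4 * real k) = (4 * real k) / sqrt (4 * real k) / sqrt 2"
    by simp
  also have "(4 * real k) / sqrt (4 * real k) = sqrt (4 * real k)"
    by (rule real_div_sqrt) simp
  also have "\<dots> / sqrt 2 = sqrt (2 * real k)"
    unfolding real_sqrt_divide[symmetric] by simp
  finally show ?thesis .
qed

section \<open>The three families of modules\<close>

lemma qdim_pair:
  assumes "is_pair_module k i j M"
  shows "has_qdim (perm_orbifold k) M 2"
proof -
  have "has_qdim (perm_orbifold k) M
      (complex_of_real ((1 / (4 * real k) + 1 / (4 * real k)) * (4 * real k)))"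
    by (rule has_qdim_restriction[OF k assms[unfolded is_pair_module_def] graded_char_lattice_lattice[OF k]
          graded_char_lattice_lattice[OF k] lattice_lattice_limit lattice_lattice_limit])
  then show ?thesis using k by simp
qed

lemma qdim_tilde:
  assumes "is_tilde_module k i \<epsilon> M"
  shows "has_qdim (perm_orbifold k) M 1"
proof -
  have e: "(-1) ^ \<epsilon> \<in> {1, -1 :: complex}" by (cases "even \<epsilon>") auto
  obtain F1 where F1: "graded_char (beta_sub k)
      (tensor_module (beta_mod k (real i / (2 * real k))) (beta_mod_eig k 0 ((-1) ^ \<epsilon>))) F1"
    and L1: "((\<lambda>y. y * F1 y / (part_sum \<int> y)\<^sup>2) \<longlongrightarrow> 1 / (8 * real k)) (at_right 0)"
    using lattice_eig_char[of 0, OF _ e, of "real i / (2 * real k)"] by auto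
  obtain F2 where F2: "graded_char (beta_sub k)
      (tensor_module (beta_mod k ((real i + real k) / (2 * real k))) (beta_mod_eig k (1 / 2) ((-1) ^ \<epsilon>))) F2"
    and L2: "((\<lambda>y. y * F2 y / (part_sum \<int> y)\<^sup>2) \<longlongrightarrow> 1 / (8 * real k)) (at_right 0)"
    using lattice_eig_char[of "1 / 2", OF _ e, of "(real i + real k) / (2 * real k)"] by auto
  have "has_qdim (perm_orbifold k) M
      (complex_of_real ((1 / (8 * real k) + 1 / (8 * real k)) * (4 * real k)))"
    by (rule has_qdim_restriction[OF k assms[unfolded is_tilde_module_def] F1 F2 L1 L2])
  then show ?thesis using k by simp
qed

lemma qdim_hat:
  assumes "is_hat_module k i \<epsilon> M"
  shows "has_qdim (perm_orbifold k) M (complex_of_real (sqrt (2 * real k)))"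
proof -
  have e: "(-1) ^ \<epsilon> \<in> {1, -1 :: complex}" "- ((-1) ^ \<epsilon>) \<in> {1, -1 :: complex}"
    by (cases "even \<epsilon>"; simp)+
  \<comment> \<open>The two parities of \<open>k + i\<close> differ only in the twisted sector and
    in the signs, and the limit of a summand is the same for all of them.\<close>
  obtain r1 r2 s1 s2 e1 e2 where M: "irreducible_with_restriction k M
        (tensor_module (beta_mod k r1) (beta_twisted_eig k s1 e1))
        (tensor_module (beta_mod k r2) (beta_twisted_eig k s2 e2))"
    and e1: "e1 \<in> {1, -1}" and e2: "e2 \<in> {1, -1}"
    using assms e unfolding is_hat_module_def by (meson)
  show ?thesis
    using has_qdim_restriction[OF k M graded_char_lattice_twisted[OF k e1] graded_char_lattice_twisted[OF k e2]
          lattice_twisted_limit[OF e1] lattice_twisted_limit[OF e2]]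
    unfolding twisted_qdim_value .
qed

end

theorem proposition6p7:
  fixes k :: nat
  assumes "k \<ge> 1"
  shows "(\<forall>i j. \<forall>M :: (fock2, 'm :: complex_vector) vmodule.
            j < i \<and> i \<le> 2 * k - 1 \<and> is_pair_module k i j M
              \<longrightarrow> has_qdim (perm_orbifold k) M 2) \<and>
         (\<forall>i \<epsilon>. \<forall>M :: (fock2, 'm) vmodule.
            i \<le> 2 * k - 1 \<and> \<epsilon> \<in> {0, 1} \<and> is_tilde_module k i \<epsilon> M
              \<longrightarrow> has_qdim (perm_orbifold k) M 1) \<and>
         (\<forall>i \<epsilon>. \<forall>M :: (fock2, 'm) vmodule.
            i \<le> 2 * k - 1 \<and> \<epsilon> \<in> {0, 1} \<and> is_hat_module k i \<epsilon> M
              \<longrightarrow> has_qdim (perm_orbifold k) M (complex_of_real (sqrt (2 * real k))))"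
  using qdim_pair[OF assms] qdim_tilde[OF assms] qdim_hat[OF assms] by blast

end
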